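(* Let $X$ be a set, $H$ a Hilbert space, $A\subseteq \mathcal{B}(H)$ a non-degenerate $C^*$-algebra, and $\varphi : X\times X\to CB(A,\mathcal{B}(H))$ a bounded function. The following are equivalent: (i) $\varphi$ is of positive type; (ii) $\varphi$ is a Schur $A$-multiplier, $S_\varphi$ is completely positive as a map from $\mathcal{K}\otimes A$ to $\mathcal{K}\otimes\mathcal{B}(H)$, and $\|S_{\varphi}\|_{\mathrm{cb}} = \sup_{x\in X}\|\varphi(x,x)\|_{\mathrm{cb}}$; (iii) there exist a Hilbert space $K$, a non-degenerate $*$-representation $\rho : A\to \mathcal{B}(K)$, and a bounded function $V : X\to\mathcal{B}(H,K)$, such that $\varphi(x,y)(a)=V(x)^* \rho(a) V(y)$ for all $x,y\in X$, $a\in A$. Further, if these conditions hold then the canonical extension of $S_\varphi$ to a map from $\mathcal{B}(\ell^2(X))\otimes A$ into $\mathcal{B}(\ell^2(X))\bar\otimes\mathcal{B}(H)$ is also completely positive.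
   Context: $\otimes$ between $C^*$-algebras is the minimal (spatial) tensor product, $\bar\otimes$ is the weak* spatial tensor product. $CB(A,\mathcal{B}(H))$ is the space of completely bounded linear maps $A\to\mathcal{B}(H)$; $\varphi$ bounded means $\sup_{x,y}\|\varphi(x,y)\|_{\mathrm{cb}}<\infty$. $\mathcal{K}=\mathcal{K}(\ell^2(X))$ is the algebra of compact operators on $\ell^2(X)$ ($X$ discrete), and $\ell^2(X)\otimes H$ is identified with $\ell^2(X,H)$. Schur $A$-multipliers: for $k\in\ell^2(X\times X,A)$ (i.e. $k:X\times X\to A$ with $\sum_{x,y}\|k(x,y)\|^2<\infty$) let $T_k$ be the bounded operator on $\ell^2(X,H)$ given by $(T_k\xi)(x)=\sum_{y\in X}k(x,y)(\xi(y))$; let $\mathcal{S}_2(X\times X,A)=\{T_k: k\in \ell^2(X\times X,A)\}$, a dense subspace of $\mathcal{K}\otimes A$ (similarly with $\mathcal{B}(H)$ in place of $A$). For a bounded $\varphi: X\times X\to CB(A,\mathcal{B}(H))$ put $(\varphi\cdot k)(x,y)=\varphi(x,y)(k(x,y))$ and $S_\varphi(T_k)=T_{\varphi\cdot k}$, a linear map $\mathcal{S}_2(X\times X,A)\to\mathcal{S}_2(X\times X,\mathcal{B}(H))$. $\varphi$ is a Schur $A$-multiplier if $S_\varphi$ is completely bounded when $\mathcal{S}_2(X\times X,A)$ carries the operator space structure inherited from $\mathcal{K}\otimes A$; in that case $S_\varphi$ also denotes its unique completely bounded extension to $\mathcal{K}\otimes A$. Canonical extension: every $T\in\mathcal{B}(\ell^2(X))\otimes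 A$ is identified with its matrix $T=(a_{x,y})_{x,y\in X}$, $a_{x,y}\in A$; for a Schur $A$-multiplier $\varphi$ the canonical extension of $S_\varphi$ maps $T$ to the bounded operator on $\ell^2(X)\otimes H$ with matrix $(\varphi(x,y)(a_{x,y}))_{x,y}$. Positive type: a bounded function $\varphi: X\times X\to CB(A,\mathcal{B}(H))$ is of positive type if for any $x_1,\ldots,x_m\in X$ (not necessarily distinct) and any $a_{p,q}\in A$, $p,q=1,\dots,m$, with $(a_{p,q})_{p,q}\in M_m(A)^+$, one has $(\varphi(x_p,x_q)(a_{p,q}))_{p,q}\in M_m(\mathcal{B}(H))^+$. *)

theory Defs
  imports "HOL-Analysis.Analysis"
begin

section \<open>Complex Hilbert spaces\<close>

class complex_vector = real_vector +
  fixes scaleC :: "complex \<Rightarrow> 'a \<Rightarrow> 'a"  (infixr "*\<^sub>C" 75)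
  assumes scaleC_add_right: "c *\<^sub>C (x + y) = c *\<^sub>C x + c *\<^sub>C y"
    and scaleC_add_left: "(c + d) *\<^sub>C x = c *\<^sub>C x + d *\<^sub>C x"
    and scaleC_scaleC: "c *\<^sub>C d *\<^sub>C x = (c * d) *\<^sub>C x"
    and scaleR_scaleC: "r *\<^sub>R x = complex_of_real r *\<^sub>C x"

lemma scaleC_one: "1 *\<^sub>C x = x" for x :: "'a::complex_vector"
  using scaleR_scaleC [of 1 x] by simp

global_interpretation complex_vector: vector_space "scaleC :: complex \<Rightarrow> 'a \<Rightarrow> 'a :: complex_vector"
  defines csubspace = complex_vector.subspace
    and cspan = complex_vector.span
  by unfold_locales (auto simp: scaleC_add_right scaleC_add_left scaleC_scaleC scaleC_one)

class complex_normed_vector = complex_vector + real_normed_vector +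
  assumes norm_scaleC: "norm (c *\<^sub>C x) = cmod c * norm x"

text \<open>The inner product is linear in the first and conjugate linear in the second variable.\<close>

class chilbert_space = complex_normed_vector + real_inner + complete_space +
  fixes cinner :: "'a \<Rightarrow> 'a \<Rightarrow> complex"
  assumes cinner_commute: "cinner x y = cnj (cinner y x)"
    and cinner_add_left: "cinner (x + y) z = cinner x z + cinner y z"
    and cinner_scaleC_left: "cinner (c *\<^sub>C x) y = c * cinner x y"
    and inner_eq_Re_cinner: "inner x y = Re (cinner x y)"

instantiation complex :: chilbert_space
begin

definition scaleC_complex :: "complex \<Rightarrow> complex \<Rightarrow> complex"
  where "scaleC_complex c x = c * x"

definition cinner_complex :: "complex \<Rightarrow> complex \<Rightarrow> complex"
  where "cinner_complex x y = x * cnj y"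

instance
  by standard
    (auto simp: scaleC_complex_def cinner_complex_def algebra_simps norm_mult
      scaleR_conv_of_real inner_complex_def)

end

lemma bounded_linear_scaleC: "bounded_linear ((*\<^sub>C) c :: 'a \<Rightarrow> 'a::complex_normed_vector)"
  by (rule bounded_linear_intro [where K = "cmod c"])
    (auto simp: scaleC_add_right scaleR_scaleC scaleC_scaleC norm_scaleC mult.commute)

instantiation blinfun :: (real_normed_vector, complex_normed_vector) complex_normed_vector
begin

lift_definition scaleC_blinfun :: "complex \<Rightarrow> ('a \<Rightarrow>\<^sub>L 'b) \<Rightarrow> ('a \<Rightarrow>\<^sub>L 'b)"
  is "\<lambda>c T x. c *\<^sub>C T x"
  by (rule bounded_linear_compose [OF bounded_linear_scaleC])

instance
proof
  fix c d :: complex and r :: real and S T :: "'a \<Rightarrow>\<^sub>L 'b"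
  show "c *\<^sub>C (S + T) = c *\<^sub>C S + c *\<^sub>C T"
    by transfer (simp add: scaleC_add_right)
  show "(c + d) *\<^sub>C T = c *\<^sub>C T + d *\<^sub>C T"
    by transfer (simp add: scaleC_add_left)
  show "c *\<^sub>C d *\<^sub>C T = (c * d) *\<^sub>C T"
    by transfer (simp add: scaleC_scaleC)
  show "r *\<^sub>R T = complex_of_real r *\<^sub>C T"
    by transfer (simp add: scaleR_scaleC)
  have le: "norm (c *\<^sub>C T) \<le> cmod c * norm T" for c and T :: "'a \<Rightarrow>\<^sub>L 'b"
  proof (rule norm_blinfun_bound)
    show "norm (blinfun_apply (c *\<^sub>C T) x) \<le> cmod c * norm T * norm x" for x
      using mult_left_mono [OF norm_blinfun [of T x], of "cmod c"]
      by (simp add: scaleC_blinfun.rep_eq norm_scaleC mult.assoc)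
  qed simp
  show "norm (c *\<^sub>C T) = cmod c * norm T"
  proof (cases "c = 0")
    case True
    then show ?thesis using le [of c T] by simp
  next
    case False
    have one: "inverse c *\<^sub>C c *\<^sub>C T = T"
      using False by transfer (simp add: scaleC_scaleC scaleC_one)
    have "cmod c * norm T \<le> cmod c * (cmod (inverse c) * norm (c *\<^sub>C T))"
      using le [of "inverse c" "c *\<^sub>C T"] unfolding one by (simp add: mult_left_mono)
    also have "\<dots> = norm (c *\<^sub>C T)"
      using False by (simp add: norm_inverse)
    finally show ?thesis using le [of c T] by simp
  qed
qed

end


section \<open>The Hilbert space of square summable families\<close>

lemma square_summable_add:
  fixes f g :: "'x \<Rightarrow> 'h::real_normed_vector"
  assumes "(\<lambda>x. (norm (f x))\<^sup>2) summable_on UNIV" "(\<lambda>x. (norm (g x))\<^sup>2) summable_on UNIV"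
  shows "(\<lambda>x. (norm (f x + g x))\<^sup>2) summable_on UNIV"
proof (rule summable_on_comparison_test)
  show "(\<lambda>x. 2 * (norm (f x))\<^sup>2 + 2 * (norm (g x))\<^sup>2) summable_on UNIV"
    using assms by (intro summable_on_add summable_on_cmult_right)
  fix x
  have "(norm (f x + g x))\<^sup>2 \<le> (norm (f x) + norm (g x))\<^sup>2"
    by (simp add: norm_triangle_ineq power_mono)
  also have "\<dots> \<le> 2 * (norm (f x))\<^sup>2 + 2 * (norm (g x))\<^sup>2"
    using sum_squares_bound [of "norm (f x)" "norm (g x)"]
    by (simp add: power2_sum)
  finally show "(norm (f x + g x))\<^sup>2 \<le> 2 * (norm (f x))\<^sup>2 + 2 * (norm (g x))\<^sup>2" .
qed simp

lemma square_summable_scale: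
  fixes f :: "'x \<Rightarrow> 'h::complex_normed_vector"
  assumes "(\<lambda>x. (norm (f x))\<^sup>2) summable_on UNIV"
  shows "(\<lambda>x. (norm (c *\<^sub>C f x))\<^sup>2) summable_on UNIV"
  using assms by (simp add: norm_scaleC power_mult_distrib summable_on_cmult_right)

typedef (overloaded) ('x, 'h) l2 =
  "{f :: 'x \<Rightarrow> 'h::chilbert_space. (\<lambda>x. (norm (f x))\<^sup>2) summable_on UNIV}"
  by (rule exI [where x = "\<lambda>_. 0"]) simp

setup_lifting type_definition_l2

lemma norm_cinner_le:
  fixes x y :: "'h::chilbert_space"
  shows "cmod (cinner x y) \<le> norm x * norm y"
proof -
  obtain c where c: "cmod c = 1" "c * cinner x y = complex_of_real (cmod (cinner x y))"
  proof (cases "cinner x y = 0")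
    case False
    then have "cmod (cnj (cinner x y) / cmod (cinner x y)) = 1"
      "cnj (cinner x y) / cmod (cinner x y) * cinner x y = complex_of_real (cmod (cinner x y))"
      by (simp_all add: norm_divide complex_norm_square [symmetric] power2_eq_square
          mult.commute [of "cnj _"] nonzero_divide_eq_eq)
    then show ?thesis using that by blast
  qed (use that [of 1] in simp)
  have "cmod (cinner x y) = Re (cinner (c *\<^sub>C x) y)"
    by (simp add: cinner_scaleC_left c)
  also have "\<dots> \<le> norm (c *\<^sub>C x) * norm y"
    by (metis inner_eq_Re_cinner norm_cauchy_schwarz)
  finally show ?thesis by (simp add: norm_scaleC c)
qed

lemma l2_cinner_abs_summable:
  fixes f g :: "'x \<Rightarrow> 'h::chilbert_space"
  assumes "(\<lambda>x. (norm (f x))\<^sup>2) summable_on UNIV" "(\<lambda>x. (norm (g x))\<^sup>2) summable_on UNIV"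
  shows "(\<lambda>x. norm (cinner (f x) (g x))) summable_on UNIV"
proof (rule Infinite_Sum.abs_summable_on_comparison_test')
  show "(\<lambda>x. (norm (f x))\<^sup>2 + (norm (g x))\<^sup>2) summable_on UNIV"
    using assms by (rule summable_on_add)
  fix x
  have "2 * (norm (f x) * norm (g x)) \<le> (norm (f x))\<^sup>2 + (norm (g x))\<^sup>2"
    using sum_squares_bound [of "norm (f x)" "norm (g x)"] by simp
  moreover have "0 \<le> norm (f x) * norm (g x)" by simp
  ultimately show "cmod (cinner (f x) (g x)) \<le> (norm (f x))\<^sup>2 + (norm (g x))\<^sup>2"
    using norm_cinner_le [of "f x" "g x"] by linarith
qed

lemmas l2_cinner_summable = abs_summable_summable [OF l2_cinner_abs_summable]

lemma cinner_self: "cinner x x = complex_of_real ((norm x)\<^sup>2)"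
proof (rule complex_eqI)
  show "Re (cinner x x) = Re (complex_of_real ((norm x)\<^sup>2))"
    by (metis Re_complex_of_real inner_eq_Re_cinner power2_norm_eq_inner)
  show "Im (cinner x x) = Im (complex_of_real ((norm x)\<^sup>2))"
    using arg_cong [OF cinner_commute [of x x], of Im] by simp
qed

instantiation l2 :: (type, chilbert_space) real_inner
begin

lift_definition zero_l2 :: "('a, 'b) l2" is "\<lambda>_. 0" by simp
lift_definition plus_l2 :: "('a, 'b) l2 \<Rightarrow> ('a, 'b) l2 \<Rightarrow> ('a, 'b) l2"
  is "\<lambda>f g x. f x + g x" by (rule square_summable_add)
lift_definition uminus_l2 :: "('a, 'b) l2 \<Rightarrow> ('a, 'b) l2" is "\<lambda>f x. - f x" by simp
lift_definition minus_l2 :: "('a, 'b) l2 \<Rightarrow> ('a, 'b) l2 \<Rightarrow> ('a, 'b) l2"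
  is "\<lambda>f g x. f x - g x"
  using square_summable_add [where g = "\<lambda>x. - g x" for g] by fastforce
lift_definition scaleR_l2 :: "real \<Rightarrow> ('a, 'b) l2 \<Rightarrow> ('a, 'b) l2" is "\<lambda>r f x. r *\<^sub>R f x"
  by (simp add: scaleR_scaleC square_summable_scale)
lift_definition inner_l2 :: "('a, 'b) l2 \<Rightarrow> ('a, 'b) l2 \<Rightarrow> real"
  is "\<lambda>f g. \<Sum>\<^sub>\<infinity>x. inner (f x) (g x)" .

definition norm_l2 :: "('a, 'b) l2 \<Rightarrow> real" where "norm_l2 f = sqrt (inner f f)"
definition dist_l2 :: "('a, 'b) l2 \<Rightarrow> ('a, 'b) l2 \<Rightarrow> real" where "dist_l2 f g = norm (f - g)"
definition sgn_l2 :: "('a, 'b) l2 \<Rightarrow> ('a, 'b) l2" where "sgn_l2 f = scaleR (inverse (norm f)) f"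
definition uniformity_l2 :: "(('a, 'b) l2 \<times> ('a, 'b) l2) filter"
  where "uniformity_l2 = (INF e\<in>{0<..}. principal {(x, y). dist x y < e})"
definition open_l2 :: "('a, 'b) l2 set \<Rightarrow> bool"
  where "open_l2 U \<longleftrightarrow> (\<forall>x\<in>U. eventually (\<lambda>(x', y). x' = x \<longrightarrow> y \<in> U) uniformity)"

instance
proof
  fix f g h :: "('a, 'b) l2" and r s :: real
  show "dist f g = norm (f - g)" by (rule dist_l2_def)
  show "sgn f = scaleR (inverse (norm f)) f" by (rule sgn_l2_def)
  show "(uniformity :: (('a, 'b) l2 \<times> ('a, 'b) l2) filter) =
      (INF e\<in>{0<..}. principal {(x, y). dist x y < e})" by (rule uniformity_l2_def)
  show "open U \<longleftrightarrow> (\<forall>x\<in>U. eventually (\<lambda>(x', y). x' = x \<longrightarrow> y \<in> U) uniformity)"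
    for U :: "('a, 'b) l2 set" by (rule open_l2_def)
  show "norm f = sqrt (inner f f)" by (rule norm_l2_def)
  show "f + g + h = f + (g + h)" by transfer (simp add: algebra_simps)
  show "f + g = g + f" by transfer (simp add: algebra_simps)
  show "0 + f = f" by transfer simp
  show "- f + f = 0" by transfer simp
  show "f - g = f + - g" by transfer simp
  show "r *\<^sub>R (f + g) = r *\<^sub>R f + r *\<^sub>R g" by transfer (simp add: algebra_simps)
  show "(r + s) *\<^sub>R f = r *\<^sub>R f + s *\<^sub>R f" by transfer (simp add: algebra_simps)
  show "r *\<^sub>R s *\<^sub>R f = (r * s) *\<^sub>R f" by transfer simp
  show "1 *\<^sub>R f = f" by transfer simp
  show "inner f g = inner g f" by transfer (simp add: inner_commute)
  show "inner (f + g) h = inner f h + inner g h"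
  proof transfer
    fix f g h :: "'a \<Rightarrow> 'b"
    assume *: "(\<lambda>x. (norm (f x))\<^sup>2) summable_on UNIV" "(\<lambda>x. (norm (g x))\<^sup>2) summable_on UNIV"
      "(\<lambda>x. (norm (h x))\<^sup>2) summable_on UNIV"
    have "(\<lambda>x. inner (f x) (h x)) summable_on UNIV" "(\<lambda>x. inner (g x) (h x)) summable_on UNIV"
      unfolding inner_eq_Re_cinner using * by (intro summable_on_Re l2_cinner_summable; simp)+
    then show "(\<Sum>\<^sub>\<infinity>x. inner (f x + g x) (h x)) = (\<Sum>\<^sub>\<infinity>x. inner (f x) (h x)) + (\<Sum>\<^sub>\<infinity>x. inner (g x) (h x))"
      by (simp add: inner_add_left infsum_add)
  qed
  show "inner (r *\<^sub>R f) g = r * inner f g"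
    by transfer (simp add: infsum_cmult_right')
  show "0 \<le> inner f f"
    by transfer (simp add: infsum_nonneg)
  show "inner f f = 0 \<longleftrightarrow> f = 0"
  proof transfer
    fix f :: "'a \<Rightarrow> 'b"
    assume *: "(\<lambda>x. (norm (f x))\<^sup>2) summable_on UNIV"
    show "(\<Sum>\<^sub>\<infinity>x. inner (f x) (f x)) = 0 \<longleftrightarrow> f = (\<lambda>_. 0)"
    proof
      assume "(\<Sum>\<^sub>\<infinity>x. inner (f x) (f x)) = 0"
      then have "inner (f x) (f x) = 0" for x
        using nonneg_infsum_le_0D [of "\<lambda>x. inner (f x) (f x)" UNIV x] *
        by (simp add: power2_norm_eq_inner)
      then show "f = (\<lambda>_. 0)" by (simp add: fun_eq_iff)
    qed simp
  qed
qed

end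

lemma norm_l2_eq: "(norm f)\<^sup>2 = (\<Sum>\<^sub>\<infinity>x. (norm (Rep_l2 f x))\<^sup>2)"
  by (simp add: power2_norm_eq_inner inner_l2.rep_eq)

lemma norm_l2_sum_le:
  assumes "finite F"
  shows "(\<Sum>x\<in>F. (norm (Rep_l2 f x))\<^sup>2) \<le> (norm f)\<^sup>2"
  unfolding norm_l2_eq using Rep_l2 [of f] assms
  by (intro finite_sum_le_infsum) auto

instance l2 :: (type, chilbert_space) complete_space
proof
  fix X :: "nat \<Rightarrow> ('a, 'b) l2"
  assume X: "Cauchy X"
  have pt: "norm (Rep_l2 f x) \<le> norm f" for f :: "('a, 'b) l2" and x
    using norm_l2_sum_le [of "{x}" f] by (simp add: power2_le_iff_abs_le)
  have "Cauchy (\<lambda>n. Rep_l2 (X n) x)" for x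
  proof (rule metric_CauchyI)
    fix e :: real assume "0 < e"
    then obtain M where M: "\<And>m n. m \<ge> M \<Longrightarrow> n \<ge> M \<Longrightarrow> dist (X m) (X n) < e"
      using metric_CauchyD [OF X] by blast
    have "dist (Rep_l2 (X m) x) (Rep_l2 (X n) x) \<le> dist (X m) (X n)" for m n
      using pt [of "X m - X n" x] by (simp add: dist_norm minus_l2.rep_eq)
    with M show "\<exists>M. \<forall>m\<ge>M. \<forall>n\<ge>M. dist (Rep_l2 (X m) x) (Rep_l2 (X n) x) < e"
      by (meson le_less_trans)
  qed
  then obtain g where g: "\<And>x. (\<lambda>n. Rep_l2 (X n) x) \<longlonglongrightarrow> g x"
    unfolding Cauchy_convergent_iff convergent_def by metis
  have tail: "(\<Sum>x\<in>F. (norm (Rep_l2 (X m) x - g x))\<^sup>2) \<le> e\<^sup>2"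
    if "finite F" "\<And>n. n \<ge> m \<Longrightarrow> dist (X m) (X n) < e" for F m e
  proof (rule tendsto_upperbound)
    show "(\<lambda>n. \<Sum>x\<in>F. (norm (Rep_l2 (X m) x - Rep_l2 (X n) x))\<^sup>2)
        \<longlonglongrightarrow> (\<Sum>x\<in>F. (norm (Rep_l2 (X m) x - g x))\<^sup>2)"
      by (intro tendsto_intros g)
    have "(\<Sum>x\<in>F. (norm (Rep_l2 (X m) x - Rep_l2 (X n) x))\<^sup>2) \<le> e\<^sup>2" if "n \<ge> m" for n
    proof -
      have "(\<Sum>x\<in>F. (norm (Rep_l2 (X m) x - Rep_l2 (X n) x))\<^sup>2) \<le> (norm (X m - X n))\<^sup>2"
        using norm_l2_sum_le [OF \<open>finite F\<close>, of "X m - X n"] by (simp add: minus_l2.rep_eq)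
      also have "\<dots> \<le> e\<^sup>2"
        using \<open>\<And>n. n \<ge> m \<Longrightarrow> dist (X m) (X n) < e\<close> [OF that]
        by (intro power_mono) (auto simp: dist_norm)
      finally show ?thesis .
    qed
    then show "\<forall>\<^sub>F n in sequentially.
        (\<Sum>x\<in>F. (norm (Rep_l2 (X m) x - Rep_l2 (X n) x))\<^sup>2) \<le> e\<^sup>2"
      by (auto simp: eventually_sequentially)
  qed simp
  have diff: "(\<lambda>x. (norm (Rep_l2 (X m) x - g x))\<^sup>2) summable_on UNIV"
    if "\<And>n. n \<ge> m \<Longrightarrow> dist (X m) (X n) < e" for m e
    using tail [of _ m e] that
    by (intro nonneg_bdd_above_summable_on bdd_aboveI [where M = "e\<^sup>2"]) auto
  obtain M1 where M1: "\<And>n. n \<ge> M1 \<Longrightarrow> dist (X M1) (X n) < 1"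
    using metric_CauchyD [OF X, of 1] by auto
  have "(\<lambda>x. (norm (g x))\<^sup>2) summable_on UNIV"
    using square_summable_add [OF _ diff [OF M1], of "\<lambda>x. - Rep_l2 (X M1) x"] Rep_l2 [of "X M1"]
    by simp
  then obtain G where G: "Rep_l2 G = g"
    by (metis (mono_tags, lifting) Abs_l2_inverse mem_Collect_eq)
  have "X \<longlonglongrightarrow> G"
  proof (rule metric_LIMSEQ_I)
    fix e :: real assume "0 < e"
    then obtain M where M: "\<And>m n. m \<ge> M \<Longrightarrow> n \<ge> M \<Longrightarrow> dist (X m) (X n) < e / 2"
      using metric_CauchyD [OF X, of "e / 2"] by auto
    have "dist (X m) G < e" if "m \<ge> M" for m
    proof -
      have *: "\<And>n. n \<ge> m \<Longrightarrow> dist (X m) (X n) < e / 2" using M that by simp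
      have "(norm (X m - G))\<^sup>2 \<le> (e / 2)\<^sup>2"
        unfolding norm_l2_eq minus_l2.rep_eq G
        using diff [OF *] tail [OF _ *] by (intro infsum_le_finite_sums) auto
      then have "norm (X m - G) \<le> e / 2" using \<open>0 < e\<close> by (simp add: power2_le_iff_abs_le)
      with \<open>0 < e\<close> show ?thesis by (simp add: dist_norm)
    qed
    then show "\<exists>M. \<forall>m\<ge>M. dist (X m) G < e" by blast
  qed
  then show "convergent X" by (auto simp: convergent_def)
qed

instantiation l2 :: (type, chilbert_space) chilbert_space
begin

lift_definition scaleC_l2 :: "complex \<Rightarrow> ('a, 'b) l2 \<Rightarrow> ('a, 'b) l2" is "\<lambda>c f x. c *\<^sub>C f x"
  by (simp add: square_summable_scale)
lift_definition cinner_l2 :: "('a, 'b) l2 \<Rightarrow> ('a, 'b) l2 \<Rightarrow> complex"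
  is "\<lambda>f g. \<Sum>\<^sub>\<infinity>x. cinner (f x) (g x)" .

instance
proof
  fix f g h :: "('a, 'b) l2" and r :: real and c d :: complex
  show "c *\<^sub>C (f + g) = c *\<^sub>C f + c *\<^sub>C g" by transfer (simp add: scaleC_add_right)
  show "(c + d) *\<^sub>C f = c *\<^sub>C f + d *\<^sub>C f" by transfer (simp add: scaleC_add_left)
  show "c *\<^sub>C d *\<^sub>C f = (c * d) *\<^sub>C f" by transfer (simp add: scaleC_scaleC)
  show "r *\<^sub>R f = complex_of_real r *\<^sub>C f" by transfer (simp add: scaleR_scaleC)
  have "(norm (c *\<^sub>C f))\<^sup>2 = (cmod c * norm f)\<^sup>2"
    by (simp add: norm_l2_eq power_mult_distrib scaleC_l2.rep_eq norm_scaleC infsum_cmult_right')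
  then show "norm (c *\<^sub>C f) = cmod c * norm f"
    by (rule power2_eq_imp_eq) auto
  show "cinner f g = cnj (cinner g f)"
    by transfer (subst infsum_cnj [symmetric], subst cinner_commute, rule refl)
  show "cinner (f + g) h = cinner f h + cinner g h"
    by transfer (simp add: cinner_add_left infsum_add l2_cinner_summable)
  show "cinner (c *\<^sub>C f) g = c * cinner f g"
    by transfer (simp add: cinner_scaleC_left infsum_cmult_right')
  show "inner f g = Re (cinner f g)"
    by transfer (simp add: inner_eq_Re_cinner infsum_Re l2_cinner_summable)
qed

end

text \<open>The elementary tensors under the identification of \<open>\<ell>\<^sup>2(X) \<otimes> H\<close> with \<open>\<ell>\<^sup>2(X, H)\<close>.\<close>

lift_definition tensor_vec :: "('x, complex) l2 \<Rightarrow> 'h \<Rightarrow> ('x, 'h::chilbert_space) l2"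
  is "\<lambda>f h x. f x *\<^sub>C h"
  by (simp add: norm_scaleC power_mult_distrib summable_on_cmult_left)

lift_definition delta_vec :: "'x \<Rightarrow> 'h \<Rightarrow> ('x, 'h::chilbert_space) l2"
  is "\<lambda>x h z. if z = x then h else 0"
  by (rule finite_nonzero_values_imp_summable_on) (simp add: if_distrib cong: if_cong)


section \<open>Bounded operators\<close>

text \<open>
  The type \<open>'a \<Rightarrow>\<^sub>L 'b\<close> consists of the bounded real-linear maps;
  \<open>bops\<close> is the space of bounded complex-linear operators, with the operator norm.
\<close>

definition bops :: "('a::chilbert_space \<Rightarrow>\<^sub>L 'b::chilbert_space) set" where
  "bops = {T. \<forall>c x. blinfun_apply T (c *\<^sub>C x) = c *\<^sub>C blinfun_apply T x}"

definition adj :: "('a::chilbert_space \<Rightarrow>\<^sub>L 'b::chilbert_space) \<Rightarrow> ('b \<Rightarrow>\<^sub>L 'a)" where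
  "adj T = (THE S. \<forall>x y. cinner (blinfun_apply T x) y = cinner x (blinfun_apply S y))"

definition compact_ops :: "('a::chilbert_space \<Rightarrow>\<^sub>L 'a) set" where
  "compact_ops = {T \<in> bops. compact (closure (blinfun_apply T ` cball 0 1))}"

definition cstar_subalgebra :: "('h::chilbert_space \<Rightarrow>\<^sub>L 'h) set \<Rightarrow> bool" where
  "cstar_subalgebra A \<longleftrightarrow> A \<subseteq> bops \<and> csubspace A \<and> closed A \<and>
    (\<forall>a\<in>A. \<forall>b\<in>A. a o\<^sub>L b \<in> A) \<and> (\<forall>a\<in>A. adj a \<in> A)"

definition nondegenerate :: "('h::chilbert_space \<Rightarrow>\<^sub>L 'h) set \<Rightarrow> bool" where
  "nondegenerate A \<longleftrightarrow> closure (cspan {blinfun_apply a h | a h. a \<in> A}) = UNIV"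


section \<open>Matrices of operators, complete boundedness and complete positivity\<close>

text \<open>
  An \<open>n \<times> n\<close> matrix of operators is a function of two indices, of which only the values at
  \<open>i, j < n\<close> matter. It acts on the \<open>n\<close>-fold Hilbert space direct sum; \<open>mat_norm\<close> is its
  operator norm there, and \<open>mat_pos\<close> says that it is a positive operator there.
\<close>

definition mat_norm :: "nat \<Rightarrow> (nat \<Rightarrow> nat \<Rightarrow> ('a::chilbert_space \<Rightarrow>\<^sub>L 'b::chilbert_space)) \<Rightarrow> real"
  where "mat_norm n a =
    (SUP \<xi>\<in>{\<xi>. L2_set (\<lambda>j. norm (\<xi> j)) {..<n} \<le> 1}.
      L2_set (\<lambda>i. norm (\<Sum>j<n. blinfun_apply (a i j) (\<xi> j))) {..<n})"

definition mat_pos :: "nat \<Rightarrow> (nat \<Rightarrow> nat \<Rightarrow> ('a::chilbert_space \<Rightarrow>\<^sub>L 'a)) \<Rightarrow> bool"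
  where "mat_pos n a \<longleftrightarrow>
    (\<forall>\<xi>. (\<Sum>i<n. cinner (\<Sum>j<n. blinfun_apply (a i j) (\<xi> j)) (\<xi> i)) \<in> \<real>\<^sub>\<ge>\<^sub>0)"

definition mats :: "nat \<Rightarrow> 'c set \<Rightarrow> (nat \<Rightarrow> nat \<Rightarrow> 'c) set" where
  "mats n S = {a. \<forall>i<n. \<forall>j<n. a i j \<in> S}"

definition clinear_on :: "'a::complex_vector set \<Rightarrow> ('a \<Rightarrow> 'b::complex_vector) \<Rightarrow> bool" where
  "clinear_on S F \<longleftrightarrow> (\<forall>a\<in>S. \<forall>b\<in>S. F (a + b) = F a + F b) \<and> (\<forall>c. \<forall>a\<in>S. F (c *\<^sub>C a) = c *\<^sub>C F a)"

text \<open>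
  Maps between operator spaces are functions on the operator types that are only constrained
  on their domain, a complex subspace \<open>S\<close> of some \<open>B(G)\<close>.
\<close>

definition cb_norm :: "('a::chilbert_space \<Rightarrow>\<^sub>L 'a) set \<Rightarrow>
    (('a \<Rightarrow>\<^sub>L 'a) \<Rightarrow> ('b::chilbert_space \<Rightarrow>\<^sub>L 'b)) \<Rightarrow> ennreal" where
  "cb_norm S F =
    (SUP n. SUP a\<in>{a \<in> mats n S. mat_norm n a \<le> 1}. ennreal (mat_norm n (\<lambda>i j. F (a i j))))"

definition completely_bounded :: "('a::chilbert_space \<Rightarrow>\<^sub>L 'a) set \<Rightarrow>
    (('a \<Rightarrow>\<^sub>L 'a) \<Rightarrow> ('b::chilbert_space \<Rightarrow>\<^sub>L 'b)) \<Rightarrow> bool" where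
  "completely_bounded S F \<longleftrightarrow> clinear_on S F \<and> F ` S \<subseteq> bops \<and> cb_norm S F < \<infinity>"

definition completely_positive :: "('a::chilbert_space \<Rightarrow>\<^sub>L 'a) set \<Rightarrow>
    (('a \<Rightarrow>\<^sub>L 'a) \<Rightarrow> ('b::chilbert_space \<Rightarrow>\<^sub>L 'b)) \<Rightarrow> bool" where
  "completely_positive S F \<longleftrightarrow> clinear_on S F \<and> F ` S \<subseteq> bops \<and>
    (\<forall>n. \<forall>a\<in>mats n S. mat_pos n a \<longrightarrow> mat_pos n (\<lambda>i j. F (a i j)))"


section \<open>Tensor products of operator algebras on \<open>\<ell>\<^sup>2(X, H)\<close>\<close>

definition elementary_tensors :: "(('x, complex) l2 \<Rightarrow>\<^sub>L ('x, complex) l2) set \<Rightarrow>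
    ('h::chilbert_space \<Rightarrow>\<^sub>L 'h) set \<Rightarrow> (('x, 'h) l2 \<Rightarrow>\<^sub>L ('x, 'h) l2) set" where
  "elementary_tensors B A = {S \<in> bops. \<exists>T\<in>B. \<exists>a\<in>A. \<forall>f h.
    blinfun_apply S (tensor_vec f h) = tensor_vec (blinfun_apply T f) (blinfun_apply a h)}"

definition min_tensor :: "(('x, complex) l2 \<Rightarrow>\<^sub>L ('x, complex) l2) set \<Rightarrow>
    ('h::chilbert_space \<Rightarrow>\<^sub>L 'h) set \<Rightarrow> (('x, 'h) l2 \<Rightarrow>\<^sub>L ('x, 'h) l2) set" where
  "min_tensor B A = closure (cspan (elementary_tensors B A))"

text \<open>The weak* topology of \<open>B(G)\<close> is induced by the functionals
  \<open>T \<mapsto> \<Sum>\<^sub>n \<langle>T \<xi>\<^sub>n, \<eta>\<^sub>n\<rangle>\<close> with square summable sequences \<open>\<xi>\<close>, \<open>\<eta>\<close>,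
  which form its predual, the trace class.\<close>

definition normal_functionals :: "(('a::chilbert_space \<Rightarrow>\<^sub>L 'a) \<Rightarrow> complex) set" where
  "normal_functionals = {\<lambda>T. \<Sum>n. cinner (blinfun_apply T (\<xi> n)) (\<eta> n) | \<xi> \<eta> :: nat \<Rightarrow> 'a.
    summable (\<lambda>n. (norm (\<xi> n))\<^sup>2) \<and> summable (\<lambda>n. (norm (\<eta> n))\<^sup>2)}"

definition weak_star_topology :: "('a::chilbert_space \<Rightarrow>\<^sub>L 'a) topology" where
  "weak_star_topology =
    topology_generated_by {{T \<in> bops. \<omega> T \<in> U} | \<omega> U. \<omega> \<in> normal_functionals \<and> open U}"

definition weak_star_tensor :: "(('x, complex) l2 \<Rightarrow>\<^sub>L ('x, complex) l2) set \<Rightarrow>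
    ('h::chilbert_space \<Rightarrow>\<^sub>L 'h) set \<Rightarrow> (('x, 'h) l2 \<Rightarrow>\<^sub>L ('x, 'h) l2) set" where
  "weak_star_tensor B A = weak_star_topology closure_of (cspan (elementary_tensors B A))"


section \<open>Schur multipliers\<close>

definition l2_kernels :: "('h::chilbert_space \<Rightarrow>\<^sub>L 'h) set \<Rightarrow> ('x \<Rightarrow> 'x \<Rightarrow> ('h \<Rightarrow>\<^sub>L 'h)) set" where
  "l2_kernels A = {k. (\<forall>x y. k x y \<in> A) \<and> (\<lambda>(x, y). (norm (k x y))\<^sup>2) summable_on UNIV}"

text \<open>The operator \<open>T\<^sub>k\<close>.\<close>

definition kernel_op :: "('x \<Rightarrow> 'x \<Rightarrow> ('h::chilbert_space \<Rightarrow>\<^sub>L 'h)) \<Rightarrow>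
    (('x, 'h) l2 \<Rightarrow>\<^sub>L ('x, 'h) l2)" where
  "kernel_op k = Blinfun (\<lambda>\<xi>. Abs_l2 (\<lambda>x. \<Sum>\<^sub>\<infinity>y. blinfun_apply (k x y) (Rep_l2 \<xi> y)))"

definition hs_ops :: "('h::chilbert_space \<Rightarrow>\<^sub>L 'h) set \<Rightarrow> (('x, 'h) l2 \<Rightarrow>\<^sub>L ('x, 'h) l2) set" where
  "hs_ops A = kernel_op ` l2_kernels A"

text \<open>\<open>S\<^sub>\<phi>(T\<^sub>k) = T\<^bsub>\<phi> \<cdot> k\<^esub>\<close>; the kernel \<open>k\<close> is determined by \<open>T\<^sub>k\<close>.\<close>

definition schur_map_hs :: "('h::chilbert_space \<Rightarrow>\<^sub>L 'h) set \<Rightarrow>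
    ('x \<Rightarrow> 'x \<Rightarrow> ('h \<Rightarrow>\<^sub>L 'h) \<Rightarrow> ('h \<Rightarrow>\<^sub>L 'h)) \<Rightarrow>
    (('x, 'h) l2 \<Rightarrow>\<^sub>L ('x, 'h) l2) \<Rightarrow> (('x, 'h) l2 \<Rightarrow>\<^sub>L ('x, 'h) l2)" where
  "schur_map_hs A \<phi> T =
    (let k = inv_into (l2_kernels A) kernel_op T in kernel_op (\<lambda>x y. \<phi> x y (k x y)))"

definition schur_multiplier :: "('h::chilbert_space \<Rightarrow>\<^sub>L 'h) set \<Rightarrow>
    ('x \<Rightarrow> 'x \<Rightarrow> ('h \<Rightarrow>\<^sub>L 'h) \<Rightarrow> ('h \<Rightarrow>\<^sub>L 'h)) \<Rightarrow> bool" where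
  "schur_multiplier A \<phi> \<longleftrightarrow> completely_bounded (hs_ops A) (schur_map_hs A \<phi>)"

text \<open>The completely bounded extension of \<open>S\<^sub>\<phi>\<close> to \<open>K \<otimes> A\<close>, which is unique on \<open>K \<otimes> A\<close>;
  the values elsewhere are irrelevant.\<close>

definition schur_map :: "('h::chilbert_space \<Rightarrow>\<^sub>L 'h) set \<Rightarrow>
    ('x \<Rightarrow> 'x \<Rightarrow> ('h \<Rightarrow>\<^sub>L 'h) \<Rightarrow> ('h \<Rightarrow>\<^sub>L 'h)) \<Rightarrow>
    (('x, 'h) l2 \<Rightarrow>\<^sub>L ('x, 'h) l2) \<Rightarrow> (('x, 'h) l2 \<Rightarrow>\<^sub>L ('x, 'h) l2)" where
  "schur_map A \<phi> = (SOME F. completely_bounded (min_tensor compact_ops A) F \<and>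
    (\<forall>T\<in>hs_ops A. F T = schur_map_hs A \<phi> T))"

lemma bounded_linear_delta_vec: "bounded_linear (delta_vec x :: 'h \<Rightarrow> ('x, 'h::chilbert_space) l2)"
proof (rule bounded_linear_intro [where K = 1])
  fix h g :: 'h and r :: real
  show "delta_vec x (h + g) = delta_vec x h + delta_vec x g" by transfer auto
  show "delta_vec x (r *\<^sub>R h) = r *\<^sub>R delta_vec x h" by transfer auto
  have "(norm (delta_vec x h))\<^sup>2 = (\<Sum>\<^sub>\<infinity>z\<in>{x}. (norm h)\<^sup>2)"
    unfolding norm_l2_eq by (rule infsum_cong_neutral) (auto simp: delta_vec.rep_eq)
  then show "norm (delta_vec x h) \<le> norm h * 1"
    by (simp add: power2_eq_iff_nonneg)
qed

lemma bounded_linear_Rep_l2: "bounded_linear (\<lambda>\<xi> :: ('x, 'h::chilbert_space) l2. Rep_l2 \<xi> x)"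
proof (rule bounded_linear_intro [where K = 1])
  fix \<xi> :: "('x, 'h) l2"
  show "norm (Rep_l2 \<xi> x) \<le> norm \<xi> * 1"
    using norm_l2_sum_le [of "{x}" \<xi>] by (simp add: power2_le_iff_abs_le)
qed (simp_all add: plus_l2.rep_eq scaleR_l2.rep_eq)

lift_definition matrix_entry :: "(('x, 'h::chilbert_space) l2 \<Rightarrow>\<^sub>L ('x, 'h) l2) \<Rightarrow> 'x \<Rightarrow> 'x \<Rightarrow> ('h \<Rightarrow>\<^sub>L 'h)"
  is "\<lambda>T x y h. Rep_l2 (T (delta_vec y h)) x"
  by (intro bounded_linear_compose [OF bounded_linear_Rep_l2]
      bounded_linear_compose [OF _ bounded_linear_delta_vec])

definition canonical_extension :: "('x \<Rightarrow> 'x \<Rightarrow> ('h::chilbert_space \<Rightarrow>\<^sub>L 'h) \<Rightarrow> ('h \<Rightarrow>\<^sub>L 'h)) \<Rightarrow>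
    (('x, 'h) l2 \<Rightarrow>\<^sub>L ('x, 'h) l2) \<Rightarrow> (('x, 'h) l2 \<Rightarrow>\<^sub>L ('x, 'h) l2)" where
  "canonical_extension \<phi> T =
    (THE S. S \<in> bops \<and> (\<forall>x y. matrix_entry S x y = \<phi> x y (matrix_entry T x y)))"

definition positive_type :: "('h::chilbert_space \<Rightarrow>\<^sub>L 'h) set \<Rightarrow>
    ('x \<Rightarrow> 'x \<Rightarrow> ('h \<Rightarrow>\<^sub>L 'h) \<Rightarrow> ('h \<Rightarrow>\<^sub>L 'h)) \<Rightarrow> bool" where
  "positive_type A \<phi> \<longleftrightarrow> (\<forall>m (x :: nat \<Rightarrow> 'x). \<forall>a\<in>mats m A.
    mat_pos m a \<longrightarrow> mat_pos m (\<lambda>p q. \<phi> (x p) (x q) (a p q)))"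


section \<open>Representations\<close>

text \<open>
  A Hilbert space that has to be quantified over inside a formula is given as a closed subspace
  \<open>K\<close> of a Hilbert space type. Then \<open>B(K)\<close> consists of the operators of the ambient space
  that map into \<open>K\<close> and vanish on the orthogonal complement of \<open>K\<close>; products, adjoints
  and norms in \<open>B(K)\<close> are those of the ambient space.
\<close>

definition bops_on :: "'k::chilbert_space set \<Rightarrow> ('k \<Rightarrow>\<^sub>L 'k) set" where
  "bops_on K = {T \<in> bops. range (blinfun_apply T) \<subseteq> K \<and>
    (\<forall>u. (\<forall>v\<in>K. cinner u v = 0) \<longrightarrow> blinfun_apply T u = 0)}"

definition nondegenerate_rep :: "('h::chilbert_space \<Rightarrow>\<^sub>L 'h) set \<Rightarrow> 'k::chilbert_space set \<Rightarrow>
    (('h \<Rightarrow>\<^sub>L 'h) \<Rightarrow> ('k \<Rightarrow>\<^sub>L 'k)) \<Rightarrow> bool" where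
  "nondegenerate_rep A K \<rho> \<longleftrightarrow> clinear_on A \<rho> \<and> \<rho> ` A \<subseteq> bops_on K \<and>
    (\<forall>a\<in>A. \<forall>b\<in>A. \<rho> (a o\<^sub>L b) = \<rho> a o\<^sub>L \<rho> b) \<and>
    (\<forall>a\<in>A. \<rho> (adj a) = adj (\<rho> a)) \<and>
    closure (cspan {blinfun_apply (\<rho> a) u | a u. a \<in> A \<and> u \<in> K}) = K"

text \<open>The data \<open>(K, \<rho>, V)\<close> with \<open>\<phi>(x, y)(a) = V(x)\<^sup>* \<rho>(a) V(y)\<close>.\<close>

definition dilation :: "('h::chilbert_space \<Rightarrow>\<^sub>L 'h) set \<Rightarrow>
    ('x \<Rightarrow> 'x \<Rightarrow> ('h \<Rightarrow>\<^sub>L 'h) \<Rightarrow> ('h \<Rightarrow>\<^sub>L 'h)) \<Rightarrow> 'k::chilbert_space set \<Rightarrow>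
    (('h \<Rightarrow>\<^sub>L 'h) \<Rightarrow> ('k \<Rightarrow>\<^sub>L 'k)) \<Rightarrow> ('x \<Rightarrow> ('h \<Rightarrow>\<^sub>L 'k)) \<Rightarrow> bool" where
  "dilation A \<phi> K \<rho> V \<longleftrightarrow> csubspace K \<and> closed K \<and> nondegenerate_rep A K \<rho> \<and>
    (\<forall>x. V x \<in> bops \<and> range (blinfun_apply (V x)) \<subseteq> K) \<and> bounded (range V) \<and>
    (\<forall>x y. \<forall>a\<in>A. \<phi> x y a = adj (V x) o\<^sub>L \<rho> a o\<^sub>L V y)"

text \<open>
  The type of \<open>\<ell>\<^sup>2(B(H) \<times> X \<times> H)\<close>: the space \<open>K\<close> generated by the vectors
  \<open>\<rho>(a) V(x) h\<close> embeds isometrically into it.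
\<close>

type_synonym ('x, 'h) dilation_space = "(('h \<Rightarrow>\<^sub>L 'h) \<times> 'x \<times> 'h, complex) l2"

end

theory Submission
  imports Defs
begin

text \<open>
  The heart of the matter is a Stinespring construction for kernels. Given \<open>\<phi>\<close> of positive type,
  the function \<open>((a, x, h), (b, y, g)) \<mapsto> \<langle>\<phi>(y, x)(b\<^sup>* a) h, g\<rangle>\<close> is a positive definite kernel on
  \<open>B(H) \<times> X \<times> H\<close>, since \<open>(b\<^sub>p\<^sup>* b\<^sub>q)\<close> is a positive matrix over \<open>A\<close>. Its Kolmogorov decomposition
  (\<open>kolmogorov_decomposition\<close>) gives vectors \<open>v(a, x, h)\<close> that span the space \<open>K\<close>. Left
  multiplication defines \<open>\<rho>(a) v(b, x, h) = v(a b, x, h)\<close>, and \<open>V(x)\<close> is the adjoint of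
  \<open>v(a, y, h) \<mapsto> \<phi>(x, y)(a) h\<close>. An approximate unit of \<open>A\<close> (\<open>approximate_unit\<close>) takes the place of the
  identity; it gives nondegeneracy and the sharp estimate that \<open>\<parallel>V(x)\<parallel>\<^sup>2\<close> is at most the norm of
  \<open>\<phi>(x, x)\<close> (\<open>positive_type_imp_dilation\<close>).

  Conversely, a \<open>*\<close>-representation of \<open>A\<close>, applied entrywise, preserves positivity and norm bounds of
  matrices (\<open>star_rep_psd\<close>, \<open>star_rep_form_bound\<close>). This rests on the fact that a positive element is,
  up to a small multiple of the identity, a square inside the algebra with scalars adjoined
  (\<open>star_rep_positive\<close>). So \<open>V(x)\<^sup>* \<rho>(a) V(y)\<close> is of positive type
  (\<open>dilation_imp_positive_type\<close>), and on finite matrices it is bounded by \<open>sup \<parallel>V(x)\<parallel>\<^sup>2\<close>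
  (\<open>dilation_imp_schur_bound\<close>).

  Schur multipliers enter through finite matrices. An operator on \<open>\<ell>\<^sup>2(X, H)\<close> is given by a matrix whose
  finite submatrices are uniformly bounded (\<open>op_from_matrix\<close>), and an \<open>n \<times> n\<close> matrix of such operators
  is a matrix over \<open>B(H)\<close> indexed by pairs. Hence a uniform bound on finite matrices yields the
  canonical extension with its completely bounded norm, positive type makes it completely positive,
  and on \<open>K \<otimes> A\<close> it coincides with \<open>S\<^sub>\<phi>\<close>, because Hilbert--Schmidt kernels are dense there
  (\<open>min_tensor_subset_closure_hs_ops\<close>). The diagonal corners \<open>E\<^sub>x\<^sub>x \<otimes> A\<close> show that the norm is not
  smaller than that of any \<open>\<phi>(x, x)\<close>, and the dilation shows that it is not larger than their
  supremum. Finally, applying \<open>S\<^sub>\<phi>\<close> to the matrix units \<open>E\<^sub>x\<^sub>y \<otimes> a\<close> recovers positive type from complete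
  positivity (\<open>completely_positive_imp_positive_type\<close>).
\<close>


section \<open>Orthogonality in complex Hilbert spaces\<close>

instance chilbert_space \<subseteq> banach ..

lemma cinner_add_right: "cinner x (y + z) = cinner x y + cinner x z"
  by (metis cinner_add_left cinner_commute complex_cnj_add)

lemma cinner_scaleC_right: "cinner x (c *\<^sub>C y) = cnj c * cinner x y"
  by (metis cinner_commute cinner_scaleC_left complex_cnj_mult)

lemma bounded_bilinear_cinner: "bounded_bilinear (cinner :: 'h::chilbert_space \<Rightarrow> 'h \<Rightarrow> complex)"
proof
  show "\<exists>K. \<forall>a b :: 'h. norm (cinner a b) \<le> norm a * norm b * K"
    by (rule exI [where x = 1]) (simp add: norm_cinner_le)
qed (simp_all add: cinner_add_left cinner_add_right scaleR_scaleC cinner_scaleC_left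
    cinner_scaleC_right scaleC_complex_def)

interpretation cinner: bounded_bilinear "cinner :: 'h::chilbert_space \<Rightarrow> 'h \<Rightarrow> complex"
  by (rule bounded_bilinear_cinner)

lemmas cinner_simps = cinner_add_left cinner_add_right cinner.diff_left cinner.diff_right
  cinner.minus_left cinner.minus_right cinner_scaleC_left cinner_scaleC_right

lemma cinner_eqI:
  assumes "\<And>z. cinner x z = cinner y z"
  shows "x = y"
proof -
  have "cinner (x - y) (x - y) = 0"
    using assms by (simp add: cinner.diff_left)
  then show ?thesis by (simp add: cinner_self)
qed

lemma cinner_eqI_right:
  assumes "\<And>z. cinner z x = cinner z y"
  shows "x = y"
  by (rule cinner_eqI) (simp only: cinner_commute [of x] cinner_commute [of y] assms)

lemma cmod_cinner_commute: "cmod (cinner x y) = cmod (cinner y x)"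
  by (subst cinner_commute) simp

lemma cinner_eq_0_commute: "cinner x y = 0 \<longleftrightarrow> cinner y x = 0"
  by (metis cinner_commute complex_cnj_zero)

lemma norm_sq_eq_cinner: "(norm x)\<^sup>2 = Re (cinner x x)"
  by (simp add: cinner_self)

lemma norm_diff_sq: "(norm (x - y))\<^sup>2 = (norm x)\<^sup>2 - 2 * Re (cinner x y) + (norm y)\<^sup>2"
  unfolding power2_norm_eq_inner inner_eq_Re_cinner [symmetric]
  by (simp add: inner_diff_left inner_diff_right inner_commute)

lemma norm_le_if_cinner_le:
  assumes "\<And>y. cmod (cinner x y) \<le> M * norm y" "0 \<le> M"
  shows "norm x \<le> M"
proof (cases "x = 0")
  case False
  have "norm x * norm x \<le> M * norm x"
    using assms(1) [of x] by (simp add: cinner_self norm_mult power2_eq_square)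
  then show ?thesis using False by simp
qed (use assms in auto)

lemma scaleC_minus_one: "(- 1) *\<^sub>C x = - x"
  using complex_vector.scale_minus_left [of 1 x] by (simp add: scaleC_one)

lemma csubspace_diff: "csubspace E \<Longrightarrow> x \<in> E \<Longrightarrow> y \<in> E \<Longrightarrow> x - y \<in> E"
  by (rule complex_vector.subspace_diff)

lemma csubspace_sum: "csubspace E \<Longrightarrow> (\<And>i. i \<in> J \<Longrightarrow> f i \<in> E) \<Longrightarrow> (\<Sum>i\<in>J. f i) \<in> E"
  by (rule complex_vector.subspace_sum)

lemma tendsto_scaleC:
  fixes u :: "_ \<Rightarrow> 'a::complex_normed_vector"
  shows "(u \<longlongrightarrow> x) F \<Longrightarrow> ((\<lambda>n. c *\<^sub>C u n) \<longlongrightarrow> c *\<^sub>C x) F"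
  by (rule bounded_linear.tendsto [OF bounded_linear_scaleC])

lemma csubspace_closure:
  fixes E :: "'a::complex_normed_vector set"
  assumes "csubspace E"
  shows "csubspace (closure E)"
proof (rule complex_vector.subspaceI)
  show "0 \<in> closure E"
    using complex_vector.subspace_0 [OF assms] closure_subset by blast
next
  fix x y assume "x \<in> closure E" "y \<in> closure E"
  then obtain f g where fg: "\<And>n::nat. f n \<in> E" "f \<longlonglongrightarrow> x" "\<And>n::nat. g n \<in> E" "g \<longlonglongrightarrow> y"
    by (auto simp: closure_sequential)
  then have "(\<lambda>n. f n + g n) \<longlonglongrightarrow> x + y" "\<And>n. f n + g n \<in> E"
    using complex_vector.subspace_add [OF assms] by (auto intro: tendsto_add)
  then show "x + y \<in> closure E"
    unfolding closure_sequential by (intro exI [where x = "\<lambda>n. f n + g n"]) auto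
next
  fix c x assume "x \<in> closure E"
  then obtain f where f: "\<And>n::nat. f n \<in> E" "f \<longlonglongrightarrow> x"
    by (auto simp: closure_sequential)
  then have "(\<lambda>n. c *\<^sub>C f n) \<longlonglongrightarrow> c *\<^sub>C x" "\<And>n. c *\<^sub>C f n \<in> E"
    using complex_vector.subspace_scale [OF assms] by (auto intro: tendsto_scaleC)
  then show "c *\<^sub>C x \<in> closure E"
    unfolding closure_sequential by (intro exI [where x = "\<lambda>n. c *\<^sub>C f n"]) auto
qed

lemma cinner_zero_on_closure_cspan:
  assumes "\<And>v. v \<in> B \<Longrightarrow> cinner u v = 0" "w \<in> closure (cspan B)"
  shows "cinner u w = 0"
proof -
  have "csubspace {v. cinner u v = 0}"
    by (rule complex_vector.subspaceI) (auto simp: cinner_simps cinner.zero_right)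
  then have "cspan B \<subseteq> {v. cinner u v = 0}"
    using assms(1) by (intro complex_vector.span_minimal) auto
  moreover have "closed {v. cinner u v = 0}"
    by (intro closed_Collect_eq continuous_intros linear_continuous_on
        cinner.bounded_linear_right)
  ultimately show ?thesis using closure_minimal assms(2) by blast
qed

text \<open>A minimising sequence for the distance to \<open>K\<close> is Cauchy by the parallelogram law;
  minimality of the limit gives orthogonality.\<close>

lemma orthogonal_projection_exists:
  fixes K :: "'h::chilbert_space set"
  assumes K: "csubspace K" "closed K"
  obtains p where "p \<in> K" "\<And>v. v \<in> K \<Longrightarrow> cinner (x - p) v = 0"
proof -
  have ne: "K \<noteq> {}" using complex_vector.subspace_0 [OF K(1)] by auto
  define d where "d = infdist x K"
  have d_le: "d \<le> norm (x - v)" if "v \<in> K" for v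
    using infdist_le [OF that, of x] by (simp add: d_def dist_norm)
  have d0: "0 \<le> d" by (simp add: d_def infdist_nonneg)
  have "\<exists>v\<in>K. norm (x - v) < d + 1 / Suc n" for n
    using cInf_lessD [of "(\<lambda>v. dist x v) ` K" "d + 1 / Suc n"] ne
    by (auto simp: d_def infdist_notempty dist_norm)
  then obtain v where vK: "\<And>n. v n \<in> K" and v: "\<And>n. norm (x - v n) < d + 1 / Suc n"
    by metis
  have par: "(norm (a - b))\<^sup>2 = 2 * (norm a)\<^sup>2 + 2 * (norm b)\<^sup>2 - (norm (a + b))\<^sup>2" for a b :: 'h
    by (simp add: power2_norm_eq_inner inner_simps inner_commute)
  have key: "(norm (v m - v n))\<^sup>2 \<le> 4 * (2 * d + 1) / Suc N" if "m \<ge> N" "n \<ge> N" for m n N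
  proof -
    define \<epsilon> where "\<epsilon> = 1 / real (Suc N)"
    have \<epsilon>: "0 \<le> \<epsilon>" "\<epsilon> \<le> 1" by (auto simp: \<epsilon>_def)
    have le: "(norm (x - v k))\<^sup>2 \<le> (d + \<epsilon>)\<^sup>2" if "k \<ge> N" for k
    proof (rule power_mono)
      have "1 / real (Suc k) \<le> \<epsilon>" unfolding \<epsilon>_def using that by (intro divide_left_mono) auto
      then show "norm (x - v k) \<le> d + \<epsilon>" using v [of k] by linarith
    qed simp
    have mid: "(1/2) *\<^sub>R (v m + v n) \<in> K"
      using vK K(1) by (simp add: scaleR_scaleC complex_vector.subspace_scale
          complex_vector.subspace_add)
    have "(x - v n) + (x - v m) = 2 *\<^sub>R (x - (1/2) *\<^sub>R (v m + v n))"
      by (simp add: algebra_simps scaleR_2)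
    then have "norm ((x - v n) + (x - v m)) \<ge> 2 * d"
      using d_le [OF mid] by simp
    then have "(norm ((x - v n) + (x - v m)))\<^sup>2 \<ge> (2 * d)\<^sup>2"
      using d0 by (intro power_mono) auto
    moreover have "(norm (v m - v n))\<^sup>2 = 2 * (norm (x - v n))\<^sup>2 + 2 * (norm (x - v m))\<^sup>2
        - (norm ((x - v n) + (x - v m)))\<^sup>2"
      using par [of "x - v n" "x - v m"] by simp
    ultimately have "(norm (v m - v n))\<^sup>2 \<le> 4 * (d + \<epsilon>)\<^sup>2 - 4 * d\<^sup>2"
      using le [OF that(1)] le [OF that(2)] by (simp add: power_mult_distrib)
    also have "\<dots> = 4 * (2 * d + \<epsilon>) * \<epsilon>" by (simp add: power2_eq_square algebra_simps)
    also have "\<dots> \<le> 4 * (2 * d + 1) * \<epsilon>" using \<epsilon> by (intro mult_right_mono) auto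
    finally show ?thesis by (simp add: \<epsilon>_def)
  qed
  have "Cauchy v"
  proof (rule metric_CauchyI)
    fix e :: real assume e: "0 < e"
    have "(\<lambda>N. 4 * (2 * d + 1) / real (Suc N)) \<longlonglongrightarrow> 0"
      by (rule tendsto_divide_0 [OF tendsto_const])
        (intro filterlim_at_top_imp_at_infinity filterlim_compose [OF filterlim_real_sequentially]
          filterlim_Suc)
    from order_tendstoD(2) [OF this, of "e\<^sup>2"] e obtain N
      where N: "4 * (2 * d + 1) / real (Suc N) < e\<^sup>2"
      by (auto simp: eventually_sequentially)
    have "dist (v m) (v n) < e" if "m \<ge> N" "n \<ge> N" for m n
      using key [OF that] N e by (auto simp: dist_norm intro: power2_less_imp_less)
    then show "\<exists>M. \<forall>m\<ge>M. \<forall>n\<ge>M. dist (v m) (v n) < e" by blast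
  qed
  then obtain p where p: "v \<longlonglongrightarrow> p" by (auto simp: Cauchy_convergent_iff convergent_def)
  have pK: "p \<in> K" using closed_sequentially [OF K(2)] vK p by blast
  have "norm (x - p) \<le> d"
  proof (rule tendsto_le)
    show "(\<lambda>n. d + 1 / real (Suc n)) \<longlonglongrightarrow> d"
      using tendsto_add [OF tendsto_const LIMSEQ_inverse_real_of_nat, of d]
      by (simp add: inverse_eq_divide)
    show "(\<lambda>n. norm (x - v n)) \<longlonglongrightarrow> norm (x - p)" by (intro tendsto_intros p)
    show "\<forall>\<^sub>F n in sequentially. norm (x - v n) \<le> d + 1 / real (Suc n)"
      by (intro always_eventually allI less_imp_le v)
  qed simp
  then have min: "norm (x - p) \<le> norm (x - w)" if "w \<in> K" for w
    using d_le [OF that] by linarith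
  have "cinner (x - p) w = 0" if w: "w \<in> K" for w
  proof -
    \<comment> \<open>Otherwise moving \<open>p\<close> a little in the direction \<open>\<langle>x - p, w\<rangle> w\<close> would come closer to \<open>x\<close>.\<close>
    define z where "z = cinner (x - p) w"
    have "2 * t * (cmod z)\<^sup>2 \<le> t\<^sup>2 * (cmod z)\<^sup>2 * (norm w)\<^sup>2" for t :: real
    proof -
      have "p + (of_real t * z) *\<^sub>C w \<in> K"
        using K(1) pK w by (simp add: complex_vector.subspace_scale complex_vector.subspace_add)
      from min [OF this] have "(norm (x - p))\<^sup>2 \<le> (norm (x - p - (of_real t * z) *\<^sub>C w))\<^sup>2"
        by (simp add: diff_diff_add)
      also have "\<dots> = (norm (x - p))\<^sup>2 - 2 * t * (cmod z)\<^sup>2 + t\<^sup>2 * (cmod z)\<^sup>2 * (norm w)\<^sup>2"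
      proof -
        have "cinner (x - p) ((of_real t * z) *\<^sub>C w) = of_real (t * (cmod z)\<^sup>2)"
          using complex_norm_square [of z]
          by (simp add: cinner_scaleC_right z_def [symmetric] mult.commute [of "cnj z"])
        then have "Re (cinner (x - p) ((of_real t * z) *\<^sub>C w)) = t * (cmod z)\<^sup>2"
          by (simp only: Re_complex_of_real)
        then show ?thesis
          by (simp only: norm_diff_sq) (simp add: norm_scaleC norm_mult power_mult_distrib)
      qed
      finally show ?thesis by simp
    qed
    from this [of "1 / ((norm w)\<^sup>2 + 1)"] have "z = 0"
    proof (rule contrapos_pp)
      assume "z \<noteq> 0"
      define W where "W = (norm w)\<^sup>2"
      have W: "W \<ge> 0" by (simp add: W_def)
      have "(1 / (W+1))\<^sup>2 * (cmod z)\<^sup>2 * W \<le> (1 / (W+1)) * (cmod z)\<^sup>2"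
        using W by (simp add: power2_eq_square divide_simps)
          (simp add: mult_left_mono algebra_simps)
      moreover have "0 < (1 / (W+1)) * (cmod z)\<^sup>2"
        using W \<open>z \<noteq> 0\<close> by simp
      ultimately show "\<not> 2 * (1 / ((norm w)\<^sup>2 + 1)) * (cmod z)\<^sup>2 \<le>
          (1 / ((norm w)\<^sup>2 + 1))\<^sup>2 * (cmod z)\<^sup>2 * (norm w)\<^sup>2"
        unfolding W_def by linarith
    qed
    then show ?thesis by (simp add: z_def)
  qed
  with pK show ?thesis using that by blast
qed

lemma double_orthogonal_complement:
  fixes K :: "'h::chilbert_space set"
  assumes K: "csubspace K" "closed K" and x: "\<And>u. (\<And>v. v \<in> K \<Longrightarrow> cinner u v = 0) \<Longrightarrow> cinner u x = 0"
  shows "x \<in> K"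
proof -
  obtain p where p: "p \<in> K" "\<And>v. v \<in> K \<Longrightarrow> cinner (x - p) v = 0"
    using orthogonal_projection_exists [OF K] by blast
  have "cinner (x - p) (x - p) = 0"
    using x [OF p(2)] p by (simp add: cinner.diff_right)
  then have "x - p = 0" by (simp add: cinner_self)
  with p show ?thesis by simp
qed

section \<open>Operators given on a generating family, and adjoints\<close>

lemma bops_apply_scaleC: "T \<in> bops \<Longrightarrow> blinfun_apply T (c *\<^sub>C x) = c *\<^sub>C blinfun_apply T x"
  by (simp add: bops_def)

lemma bopsI: "(\<And>c x. blinfun_apply T (c *\<^sub>C x) = c *\<^sub>C blinfun_apply T x) \<Longrightarrow> T \<in> bops"
  by (simp add: bops_def)

lemma csubspace_bops: "csubspace (bops :: ('a::chilbert_space \<Rightarrow>\<^sub>L 'b::chilbert_space) set)"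
  by (rule complex_vector.subspaceI)
    (auto simp: bops_def scaleC_add_right blinfun.add_left scaleC_blinfun.rep_eq
      complex_vector.scale_left_commute)

lemma bops_compose: "S \<in> bops \<Longrightarrow> T \<in> bops \<Longrightarrow> S o\<^sub>L T \<in> bops"
  by (simp add: bops_def)

lemma id_bops: "id_blinfun \<in> bops"
  by (simp add: bops_def)

lemma scaleC_apply [simp]: "blinfun_apply (c *\<^sub>C T) x = c *\<^sub>C blinfun_apply T x"
  by (simp add: scaleC_blinfun.rep_eq)

lemma compose_scaleC_right: "S \<in> bops \<Longrightarrow> S o\<^sub>L (c *\<^sub>C T) = c *\<^sub>C (S o\<^sub>L T)"
  by (rule blinfun_eqI) (simp add: bops_apply_scaleC)

lemma compose_scaleC_left: "(c *\<^sub>C S) o\<^sub>L T = c *\<^sub>C (S o\<^sub>L T)"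
  by (rule blinfun_eqI) simp

lemmas compose_add_left = bounded_bilinear.add_left [OF bounded_bilinear_blinfun_compose]
lemmas compose_add_right = bounded_bilinear.add_right [OF bounded_bilinear_blinfun_compose]
lemmas compose_diff_left = bounded_bilinear.diff_left [OF bounded_bilinear_blinfun_compose]
lemmas compose_diff_right = bounded_bilinear.diff_right [OF bounded_bilinear_blinfun_compose]

lemma closed_bops: "closed (bops :: ('a::chilbert_space \<Rightarrow>\<^sub>L 'b::chilbert_space) set)"
proof -
  have eq: "bops = (\<Inter>c. \<Inter>x. {T :: 'a \<Rightarrow>\<^sub>L 'b. blinfun_apply T (c *\<^sub>C x) = c *\<^sub>C blinfun_apply T x})"
    by (auto simp: bops_def)
  show ?thesis
    unfolding eq
    by (intro closed_INT ballI closed_Collect_eq continuous_intros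
        bounded_linear.continuous_on [OF bounded_linear_scaleC])
qed

text \<open>The map extends by uniform continuity to the closure, and by \<open>0\<close>
  to the orthogonal complement.\<close>

lemma bounded_extension:
  fixes f :: "'g::chilbert_space \<Rightarrow> 'k::chilbert_space"
  assumes E: "csubspace E" and f: "clinear_on E f"
    and M: "0 \<le> M" "\<And>u. u \<in> E \<Longrightarrow> norm (f u) \<le> M * norm u"
  obtains T where "T \<in> bops" "\<And>u. u \<in> E \<Longrightarrow> blinfun_apply T u = f u"
    "\<And>u. (\<And>v. v \<in> E \<Longrightarrow> cinner u v = 0) \<Longrightarrow> blinfun_apply T u = 0"
    "range (blinfun_apply T) \<subseteq> closure (f ` E)" "norm T \<le> M"
proof -
  have fdiff: "f u - f v = f (u - v)" if "u \<in> E" "v \<in> E" for u v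
  proof -
    have "f (u + (-1) *\<^sub>C v) = f u + (-1) *\<^sub>C f v"
      using f that complex_vector.subspace_scale [OF E that(2)] unfolding clinear_on_def by metis
    then show ?thesis unfolding scaleC_minus_one by simp
  qed
  have uc: "uniformly_continuous_on E f"
  unfolding uniformly_continuous_on_def
  proof (intro allI impI)
    fix e :: real assume e: "e > 0"
    have "dist (f u) (f v) < e" if "u \<in> E" "v \<in> E" "dist u v < e / (M + 1)" for u v
    proof -
      have "dist (f u) (f v) \<le> M * dist u v"
        using M(2) [OF csubspace_diff [OF E that(1,2)]] fdiff [OF that(1,2)]
        by (simp add: dist_norm)
      also have "\<dots> \<le> (M + 1) * dist u v" by (simp add: distrib_right)
      also have "\<dots> < e" using that(3) M(1) by (simp add: field_simps)
      finally show ?thesis .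
    qed
    then show "\<exists>d>0. \<forall>u\<in>E. \<forall>u'\<in>E. dist u' u < d \<longrightarrow> dist (f u') (f u) < e"
      using e M(1) by (intro exI [where x = "e / (M + 1)"]) auto
  qed
  obtain g where g: "uniformly_continuous_on (closure E) g" "\<And>x. x \<in> E \<Longrightarrow> f x = g x"
    by (rule uniformly_continuous_on_extension_on_closure [OF uc]) (rule that)
  have lim: "(\<lambda>n. f (u n)) \<longlonglongrightarrow> g x" if "\<And>n. u n \<in> E" "u \<longlonglongrightarrow> x" for u x
  proof -
    have "x \<in> closure E" using that by (auto simp: closure_sequential)
    moreover have "\<forall>\<^sub>F n in sequentially. u n \<in> closure E"
      using that(1) closure_subset by (auto intro!: always_eventually)
    ultimately have "(\<lambda>n. g (u n)) \<longlonglongrightarrow> g x"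
      using continuous_on_tendsto_compose [OF uniformly_continuous_imp_continuous [OF g(1)] that(2)]
      by blast
    then show ?thesis using g(2) that(1) by simp
  qed
  have approx: "\<exists>u. (\<forall>n. u n \<in> E) \<and> u \<longlonglongrightarrow> x" if "x \<in> closure E" for x
    using that by (simp add: closure_sequential)
  have cl: "csubspace (closure E)" by (rule csubspace_closure [OF E])
  have gadd: "g (x + y) = g x + g y" if x: "x \<in> closure E" and y: "y \<in> closure E" for x y
  proof -
    obtain u where u: "\<And>n. u n \<in> E" "u \<longlonglongrightarrow> x" using approx [OF x] by blast
    obtain v where v: "\<And>n. v n \<in> E" "v \<longlonglongrightarrow> y" using approx [OF y] by blast
    note uv = u v
    have "(\<lambda>n. f (u n + v n)) \<longlonglongrightarrow> g (x + y)"
      using uv by (intro lim tendsto_add complex_vector.subspace_add [OF E])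
    moreover have "(\<lambda>n. f (u n + v n)) \<longlonglongrightarrow> g x + g y"
      using f uv tendsto_add [OF lim [OF uv(1,2)] lim [OF uv(3,4)]] by (simp add: clinear_on_def)
    ultimately show ?thesis by (rule LIMSEQ_unique)
  qed
  have gscale: "g (c *\<^sub>C x) = c *\<^sub>C g x" if x: "x \<in> closure E" for c x
  proof -
    obtain u where u: "\<And>n. u n \<in> E" "u \<longlonglongrightarrow> x" using approx [OF x] by blast
    have "(\<lambda>n. f (c *\<^sub>C u n)) \<longlonglongrightarrow> g (c *\<^sub>C x)"
      using u by (intro lim tendsto_scaleC complex_vector.subspace_scale [OF E])
    moreover have "(\<lambda>n. f (c *\<^sub>C u n)) \<longlonglongrightarrow> c *\<^sub>C g x"
      using f u tendsto_scaleC [OF lim [OF u]] by (simp add: clinear_on_def)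
    ultimately show ?thesis by (rule LIMSEQ_unique)
  qed
  have gnorm: "norm (g x) \<le> M * norm x" if x: "x \<in> closure E" for x
  proof -
    obtain u where u: "\<And>n. u n \<in> E" "u \<longlonglongrightarrow> x" using approx [OF x] by blast
    show ?thesis
    proof (rule tendsto_le)
      show "(\<lambda>n. norm (f (u n))) \<longlonglongrightarrow> norm (g x)" by (intro tendsto_norm lim u)
      show "(\<lambda>n. M * norm (u n)) \<longlonglongrightarrow> M * norm x" by (intro tendsto_intros u)
    qed (use u M in auto)
  qed
  have "\<exists>p. p \<in> closure E \<and> (\<forall>v\<in>closure E. cinner (x - p) v = 0)" for x
    by (rule orthogonal_projection_exists [OF cl closed_closure, of x]) blast
  then obtain P where P: "\<And>x. P x \<in> closure E" "\<And>x v. v \<in> closure E \<Longrightarrow> cinner (x - P x) v = 0"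
    by metis
  \<comment> \<open>The projection onto the closure is characterised by orthogonality, hence linear.\<close>
  have Puniq: "P x = p" if p: "p \<in> closure E" "\<And>v. v \<in> closure E \<Longrightarrow> cinner (x - p) v = 0" for x p
  proof -
    have d: "P x - p \<in> closure E" using csubspace_diff [OF cl] P p by blast
    have "cinner (P x - p) (P x - p) = cinner (x - p) (P x - p) - cinner (x - P x) (P x - p)"
      by (simp add: cinner.diff_left [symmetric])
    also have "\<dots> = 0" using P(2) [OF d] p(2) [OF d] by simp
    finally show ?thesis by (simp add: cinner_self)
  qed
  have Padd: "P (x + y) = P x + P y" for x y
  proof (rule Puniq)
    fix v assume v: "v \<in> closure E"
    have "cinner (x + y - (P x + P y)) v = cinner (x - P x) v + cinner (y - P y) v"
      by (simp add: cinner_simps)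
    then show "cinner (x + y - (P x + P y)) v = 0" using P(2) [OF v] by simp
  qed (intro complex_vector.subspace_add [OF cl] P)
  have Pscale: "P (c *\<^sub>C x) = c *\<^sub>C P x" for c x
  proof (rule Puniq)
    fix v assume v: "v \<in> closure E"
    have "cinner (c *\<^sub>C x - c *\<^sub>C P x) v = c * cinner (x - P x) v"
      by (simp add: cinner_simps algebra_simps)
    then show "cinner (c *\<^sub>C x - c *\<^sub>C P x) v = 0" using P(2) [OF v] by simp
  qed (intro complex_vector.subspace_scale [OF cl] P)
  have Pnorm: "norm (P x) \<le> norm x" for x
  proof -
    have "cinner (x - P x) (P x) = 0" by (rule P(2) [OF P(1)])
    then have "cmod (cinner (P x) (P x)) \<le> norm x * norm (P x)"
      using norm_cinner_le [of x "P x"] by (simp add: cinner.diff_left)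
    then show ?thesis by (cases "P x = 0") (auto simp: cinner_self norm_mult power2_eq_square)
  qed
  have bl: "bounded_linear (\<lambda>x. g (P x))"
  proof (rule bounded_linear_intro [where K = M])
    fix x y :: 'g and r :: real
    show "g (P (x + y)) = g (P x) + g (P y)" by (simp add: Padd gadd P)
    show "g (P (r *\<^sub>R x)) = r *\<^sub>R g (P x)" by (simp add: scaleR_scaleC Pscale gscale P)
    have "norm (g (P x)) \<le> M * norm (P x)" by (intro gnorm P)
    also have "\<dots> \<le> M * norm x" using Pnorm M(1) by (intro mult_left_mono)
    finally show "norm (g (P x)) \<le> norm x * M" by (simp add: mult.commute)
  qed
  define T where "T = Blinfun (\<lambda>x. g (P x))"
  have T: "blinfun_apply T x = g (P x)" for x
    by (simp add: T_def bounded_linear_Blinfun_apply [OF bl])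
  show ?thesis
  proof (rule that [of T])
    show "T \<in> bops" by (rule bopsI) (simp add: T Pscale gscale P)
    show "blinfun_apply T u = f u" if "u \<in> E" for u
    proof -
      have "P u = u" using that closure_subset by (intro Puniq) (auto simp: cinner.zero_left)
      then show ?thesis using g(2) that by (simp add: T)
    qed
    show "blinfun_apply T u = 0" if u: "\<And>v. v \<in> E \<Longrightarrow> cinner u v = 0" for u
    proof -
      have "P u = 0"
      proof (rule Puniq)
        show "0 \<in> closure E" by (rule complex_vector.subspace_0 [OF cl])
        fix v assume "v \<in> closure E"
        then show "cinner (u - 0) v = 0"
          using cinner_zero_on_closure_cspan [of E u v] u
          by (simp add: complex_vector.span_eq_iff [THEN iffD2, OF E])
      qed
      moreover have "g 0 = 0" using gscale [of 0 0] complex_vector.subspace_0 [OF cl] by simp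
      ultimately show ?thesis by (simp add: T)
    qed
    show "range (blinfun_apply T) \<subseteq> closure (f ` E)"
    proof clarify
      fix x
      obtain u where u: "\<And>n. u n \<in> E" "u \<longlonglongrightarrow> P x" using approx [OF P(1)] by blast
      from lim [OF u] u(1) show "blinfun_apply T x \<in> closure (f ` E)"
        unfolding closure_sequential T by (intro exI [where x = "\<lambda>n. f (u n)"]) auto
    qed
    show "norm T \<le> M"
    proof (rule norm_blinfun_bound [OF M(1)])
      fix x
      have "norm (g (P x)) \<le> M * norm (P x)" by (intro gnorm P)
      also have "\<dots> \<le> M * norm x" using Pnorm M(1) by (intro mult_left_mono)
      finally show "norm (blinfun_apply T x) \<le> M * norm x" by (simp add: T)
    qed
  qed
qed

text \<open>The norm condition makes \<open>\<Sum> c\<^sub>i u\<^sub>i \<mapsto> \<Sum> c\<^sub>i w\<^sub>i\<close> well defined.\<close>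

lemma bounded_family_extension:
  fixes u :: "'i \<Rightarrow> 'g::chilbert_space" and w :: "'i \<Rightarrow> 'k::chilbert_space"
  assumes M: "0 \<le> M" "\<And>J c. finite J \<Longrightarrow> J \<subseteq> I \<Longrightarrow>
      norm (\<Sum>i\<in>J. c i *\<^sub>C w i) \<le> M * norm (\<Sum>i\<in>J. c i *\<^sub>C u i)"
  obtains T where "T \<in> bops" "\<And>i. i \<in> I \<Longrightarrow> blinfun_apply T (u i) = w i"
    "\<And>z. (\<And>i. i \<in> I \<Longrightarrow> cinner z (u i) = 0) \<Longrightarrow> blinfun_apply T z = 0"
    "range (blinfun_apply T) \<subseteq> closure (cspan (w ` I))" "norm T \<le> M"
proof -
  define R where "R z y \<longleftrightarrow> (\<exists>J c. finite J \<and> J \<subseteq> I \<and> (\<forall>i. i \<notin> J \<longrightarrow> c i = 0) \<and>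
    z = (\<Sum>i\<in>J. c i *\<^sub>C u i) \<and> y = (\<Sum>i\<in>J. c i *\<^sub>C w i))" for z y
  have Radd: "R (z + z') (y + y')" if R: "R z y" "R z' y'" for z y z' y'
  proof -
    obtain J c where J: "finite J" "J \<subseteq> I" "\<forall>i. i \<notin> J \<longrightarrow> c i = 0"
        "z = (\<Sum>i\<in>J. c i *\<^sub>C u i)" "y = (\<Sum>i\<in>J. c i *\<^sub>C w i)"
      using R(1) unfolding R_def by blast
    obtain J' c' where J': "finite J'" "J' \<subseteq> I" "\<forall>i. i \<notin> J' \<longrightarrow> c' i = 0"
        "z' = (\<Sum>i\<in>J'. c' i *\<^sub>C u i)" "y' = (\<Sum>i\<in>J'. c' i *\<^sub>C w i)"
      using R(2) unfolding R_def by blast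
    have "z = (\<Sum>i\<in>J \<union> J'. c i *\<^sub>C u i)" "y = (\<Sum>i\<in>J \<union> J'. c i *\<^sub>C w i)"
      unfolding J using J J'(1) by (auto intro!: sum.mono_neutral_left)
    moreover have "z' = (\<Sum>i\<in>J \<union> J'. c' i *\<^sub>C u i)" "y' = (\<Sum>i\<in>J \<union> J'. c' i *\<^sub>C w i)"
      unfolding J' using J' J(1) by (auto intro!: sum.mono_neutral_left)
    ultimately show ?thesis unfolding R_def using J J'
      by (intro exI [where x = "J \<union> J'"] exI [where x = "\<lambda>i. c i + c' i"])
        (auto simp: scaleC_add_left sum.distrib)
  qed
  have Rscale: "R (a *\<^sub>C z) (a *\<^sub>C y)" if R: "R z y" for a z y
  proof -
    obtain J c where J: "finite J" "J \<subseteq> I" "\<forall>i. i \<notin> J \<longrightarrow> c i = 0"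
        "z = (\<Sum>i\<in>J. c i *\<^sub>C u i)" "y = (\<Sum>i\<in>J. c i *\<^sub>C w i)"
      using R unfolding R_def by blast
    then show ?thesis unfolding R_def
      by (intro exI [where x = J] exI [where x = "\<lambda>i. a * c i"])
        (auto simp: complex_vector.scale_sum_right scaleC_scaleC)
  qed
  have Rnorm: "norm y \<le> M * norm z" if "R z y" for z y
    using that M(2) unfolding R_def by blast
  have Rfun: "y = y'" if "R z y" "R z y'" for z y y'
    using Rnorm [OF Radd [OF that(1) Rscale [OF that(2), of "- 1"]]] by (simp add: scaleC_minus_one)
  have Rgen: "R (u i) (w i)" if "i \<in> I" for i
    unfolding R_def using that
    by (intro exI [where x = "{i}"] exI [where x = "\<lambda>j. if j = i then 1 else 0"])
      (auto simp: scaleC_one)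
  have R0: "R 0 0" unfolding R_def by (intro exI [where x = "{}"] exI [where x = "\<lambda>_. 0"]) auto
  define E where "E = {z. \<exists>y. R z y}"
  define f where "f z = (THE y. R z y)" for z
  have fR: "f z = y" if "R z y" for z y
    unfolding f_def using that Rfun by blast
  have E: "csubspace E"
    unfolding E_def by (rule complex_vector.subspaceI) (use R0 Radd Rscale in blast)+
  have f: "clinear_on E f"
    unfolding clinear_on_def
  proof (intro conjI ballI allI)
    fix z z' c assume "z \<in> E" "z' \<in> E"
    then obtain y y' where y: "R z y" "R z' y'" by (auto simp: E_def)
    show "f (z + z') = f z + f z'"
      by (simp only: fR [OF y(1)] fR [OF y(2)] fR [OF Radd [OF y]])
  next
    fix z c assume "z \<in> E"
    then obtain y where y: "R z y" by (auto simp: E_def)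
    show "f (c *\<^sub>C z) = c *\<^sub>C f z"
      by (simp only: fR [OF y] fR [OF Rscale [OF y]])
  qed
  have fM: "norm (f z) \<le> M * norm z" if z: "z \<in> E" for z
  proof -
    obtain y where y: "R z y" using z by (auto simp: E_def)
    show ?thesis using Rnorm [OF y] by (simp only: fR [OF y])
  qed
  obtain T where T: "T \<in> bops" "\<And>z. z \<in> E \<Longrightarrow> blinfun_apply T z = f z"
    "\<And>z. (\<And>v. v \<in> E \<Longrightarrow> cinner z v = 0) \<Longrightarrow> blinfun_apply T z = 0"
    "range (blinfun_apply T) \<subseteq> closure (f ` E)" "norm T \<le> M"
    by (rule bounded_extension [OF E f M(1)]) (erule fM, (rule that; blast))
  show ?thesis
  proof (rule that [OF T(1)])
    show "blinfun_apply T (u i) = w i" if "i \<in> I" for i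
      using T(2) [of "u i"] Rgen [OF that] fR [OF Rgen [OF that]] by (auto simp: E_def)
    show "blinfun_apply T z = 0" if "\<And>i. i \<in> I \<Longrightarrow> cinner z (u i) = 0" for z
    proof (rule T(3))
      fix v assume "v \<in> E"
      then obtain J c where "J \<subseteq> I" "v = (\<Sum>i\<in>J. c i *\<^sub>C u i)" by (auto simp: E_def R_def)
      then show "cinner z v = 0"
        using that by (auto simp: cinner.sum_right cinner_scaleC_right intro!: sum.neutral)
    qed
    have "f ` E \<subseteq> cspan (w ` I)"
    proof clarify
      fix z assume "z \<in> E"
      then obtain y where y: "R z y" by (auto simp: E_def)
      then show "f z \<in> cspan (w ` I)"
        unfolding fR [OF y] unfolding R_def
        by (auto intro!: complex_vector.span_sum complex_vector.span_scale
            intro: complex_vector.span_base)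
    qed
    then show "range (blinfun_apply T) \<subseteq> closure (cspan (w ` I))"
      using T(4) closure_mono by blast
    show "norm T \<le> M" by (rule T(5))
  qed
qed

text \<open>If \<open>e\<close> is orthogonal to the kernel and \<open>f(e) \<noteq> 0\<close>, then \<open>f(e) x - f(x) e\<close> lies in the kernel,
  hence is orthogonal to \<open>e\<close>.\<close>

lemma riesz_representation:
  fixes f :: "'h::chilbert_space \<Rightarrow>\<^sub>L complex"
  assumes f: "f \<in> bops"
  obtains w where "\<And>x. blinfun_apply f x = cinner x w"
proof (cases "\<forall>x. blinfun_apply f x = 0")
  case True
  then show ?thesis using that [of 0] by (simp add: cinner.zero_right)
next
  case False
  then obtain x0 where x0: "blinfun_apply f x0 \<noteq> 0" by blast
  define K where "K = {x. blinfun_apply f x = 0}"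
  have K: "csubspace K" "closed K"
    unfolding K_def using bops_apply_scaleC [OF f]
    by (auto intro!: complex_vector.subspaceI closed_Collect_eq continuous_intros
        simp: blinfun.add_right blinfun.zero_right)
  obtain p where p: "p \<in> K" "\<And>v. v \<in> K \<Longrightarrow> cinner (x0 - p) v = 0"
    by (rule orthogonal_projection_exists [OF K, of x0]) (rule that)
  define e where "e = x0 - p"
  have fe: "blinfun_apply f e \<noteq> 0" using x0 p(1) by (simp add: e_def K_def blinfun.diff_right)
  then have ne: "cinner e e \<noteq> 0" by (auto simp: cinner_self blinfun.zero_right)
  define w where "w = cnj (blinfun_apply f e / cinner e e) *\<^sub>C e"
  have "blinfun_apply f x = cinner x w" for x
  proof -
    have "blinfun_apply f e *\<^sub>C x - blinfun_apply f x *\<^sub>C e \<in> K"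
      by (simp add: K_def blinfun.diff_right bops_apply_scaleC [OF f] scaleC_complex_def mult.commute)
    from p(2) [OF this] have "cinner (blinfun_apply f e *\<^sub>C x - blinfun_apply f x *\<^sub>C e) e = 0"
      unfolding e_def [symmetric] by (simp add: cinner_eq_0_commute)
    then have "blinfun_apply f e * cinner x e = blinfun_apply f x * cinner e e"
      by (simp add: cinner_simps)
    then show ?thesis using ne by (simp add: w_def cinner_scaleC_right field_simps)
  qed
  then show ?thesis by (rule that)
qed

lemma adj_exists:
  fixes T :: "'a::chilbert_space \<Rightarrow>\<^sub>L 'b::chilbert_space"
  assumes T: "T \<in> bops"
  shows "\<exists>!S. \<forall>x y. cinner (blinfun_apply T x) y = cinner x (blinfun_apply S y)"
proof (rule ex_ex1I)
  have "\<exists>w. \<forall>x. cinner (blinfun_apply T x) y = cinner x w" for y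
  proof -
    have bl: "bounded_linear (\<lambda>x. cinner (blinfun_apply T x) y)"
      by (rule bounded_linear_compose [OF cinner.bounded_linear_left blinfun.bounded_linear_right])
    have "Blinfun (\<lambda>x. cinner (blinfun_apply T x) y) \<in> bops"
      by (rule bopsI) (simp add: bounded_linear_Blinfun_apply [OF bl] bops_apply_scaleC [OF T]
          cinner_scaleC_left scaleC_complex_def)
    then obtain w where "\<And>x. blinfun_apply (Blinfun (\<lambda>x. cinner (blinfun_apply T x) y)) x = cinner x w"
      by (rule riesz_representation) (rule that)
    then have "\<forall>x. cinner (blinfun_apply T x) y = cinner x w"
      unfolding bounded_linear_Blinfun_apply [OF bl] by blast
    then show ?thesis ..
  qed
  then obtain s where s: "\<And>x y. cinner (blinfun_apply T x) y = cinner x (s y)" by metis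
  have bl: "bounded_linear s"
  proof (rule bounded_linear_intro [where K = "norm T"])
    show "s (x + y) = s x + s y" for x y
      by (rule cinner_eqI_right) (simp add: s [symmetric] cinner_add_right)
    show "s (r *\<^sub>R x) = r *\<^sub>R s x" for r x
      by (rule cinner_eqI_right) (simp add: s [symmetric] scaleR_scaleC cinner_scaleC_right)
    show "norm (s y) \<le> norm y * norm T" for y
    proof (rule norm_le_if_cinner_le)
      fix x
      have "cmod (cinner (s y) x) = cmod (cinner (blinfun_apply T x) y)"
        by (simp add: s cmod_cinner_commute)
      also have "\<dots> \<le> norm (blinfun_apply T x) * norm y" by (rule norm_cinner_le)
      also have "\<dots> \<le> norm T * norm x * norm y"
        by (intro mult_right_mono norm_blinfun) simp
      finally show "cmod (cinner (s y) x) \<le> norm y * norm T * norm x" by (simp add: mult_ac)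
    qed simp
  qed
  show "\<exists>S. \<forall>x y. cinner (blinfun_apply T x) y = cinner x (blinfun_apply S y)"
  proof (intro exI allI)
    show "cinner (blinfun_apply T x) y = cinner x (blinfun_apply (Blinfun s) y)" for x y
      unfolding bounded_linear_Blinfun_apply [OF bl] by (rule s)
  qed
  show "S = S'" if "\<forall>x y. cinner (blinfun_apply T x) y = cinner x (blinfun_apply S y)"
    "\<forall>x y. cinner (blinfun_apply T x) y = cinner x (blinfun_apply S' y)" for S S'
  proof (rule blinfun_eqI, rule cinner_eqI_right)
    show "cinner z (blinfun_apply S y) = cinner z (blinfun_apply S' y)" for y z
      using that(1) [rule_format, of z y] that(2) [rule_format, of z y] by simp
  qed
qed

lemma cinner_adj:
  assumes "T \<in> bops"
  shows "cinner (blinfun_apply T x) y = cinner x (blinfun_apply (adj T) y)"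
  unfolding adj_def by (rule theI' [OF adj_exists [OF assms], rule_format])

lemma cinner_adj_left:
  assumes "T \<in> bops"
  shows "cinner (blinfun_apply (adj T) y) x = cinner y (blinfun_apply T x)"
  using cinner_commute [of "blinfun_apply (adj T) y" x] cinner_commute [of y "blinfun_apply T x"]
  by (simp add: cinner_adj assms)

lemma adj_eqI:
  assumes "T \<in> bops" "\<And>x y. cinner (blinfun_apply T x) y = cinner x (blinfun_apply S y)"
  shows "adj T = S"
  unfolding adj_def using assms(2) by (intro the1_equality adj_exists [OF assms(1)]) blast

lemma adj_bops: "T \<in> bops \<Longrightarrow> adj T \<in> bops"
  by (rule bopsI, rule cinner_eqI) (simp add: cinner_adj_left cinner_scaleC_left)

lemma adj_adj: "T \<in> bops \<Longrightarrow> adj (adj T) = T"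
  by (rule adj_eqI) (simp_all add: adj_bops cinner_adj_left)

lemma adj_compose: "S \<in> bops \<Longrightarrow> T \<in> bops \<Longrightarrow> adj (S o\<^sub>L T) = adj T o\<^sub>L adj S"
  by (rule adj_eqI) (simp_all add: bops_compose cinner_adj)

lemma adj_add: "S \<in> bops \<Longrightarrow> T \<in> bops \<Longrightarrow> adj (S + T) = adj S + adj T"
  by (rule adj_eqI)
    (simp_all add: complex_vector.subspace_add [OF csubspace_bops] blinfun.add_left cinner_simps
      cinner_adj)

lemma adj_diff: "S \<in> bops \<Longrightarrow> T \<in> bops \<Longrightarrow> adj (S - T) = adj S - adj T"
  by (rule adj_eqI)
    (simp_all add: csubspace_diff [OF csubspace_bops] blinfun.diff_left cinner_simps cinner_adj)

lemma adj_scaleC: "T \<in> bops \<Longrightarrow> adj (c *\<^sub>C T) = cnj c *\<^sub>C adj T"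
  by (rule adj_eqI)
    (simp_all add: complex_vector.subspace_scale [OF csubspace_bops] cinner_simps cinner_adj)

lemma adj_zero: "adj 0 = 0"
  by (rule adj_eqI) (simp_all add: bops_def cinner.zero_left cinner.zero_right)

lemma adj_sum:
  "(\<And>i. i \<in> J \<Longrightarrow> T i \<in> bops) \<Longrightarrow> adj (\<Sum>i\<in>J. T i) = (\<Sum>i\<in>J. adj (T i))"
  by (induction J rule: infinite_finite_induct)
    (auto simp: adj_zero adj_add csubspace_sum [OF csubspace_bops])

lemma norm_adj_le:
  assumes "T \<in> bops"
  shows "norm (adj T) \<le> norm T"
proof (rule norm_blinfun_bound, simp, rule norm_le_if_cinner_le)
  fix x y
  have "cmod (cinner (blinfun_apply (adj T) x) y) = cmod (cinner x (blinfun_apply T y))"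
    by (simp add: cinner_adj_left assms)
  also have "\<dots> \<le> norm x * (norm T * norm y)"
    by (intro order_trans [OF norm_cinner_le] mult_left_mono norm_blinfun) simp
  finally show "cmod (cinner (blinfun_apply (adj T) x) y) \<le> norm T * norm x * norm y"
    by (simp add: mult_ac)
qed auto

lemma norm_adj: "T \<in> bops \<Longrightarrow> norm (adj T) = norm T"
  using norm_adj_le [of T] norm_adj_le [OF adj_bops, of T] by (simp only: adj_adj order_antisym)

lemma norm_adj_compose_self:
  assumes "T \<in> bops"
  shows "norm (adj T o\<^sub>L T) \<le> (norm T)\<^sup>2"
  using norm_blinfun_compose [of "adj T" T] norm_adj [OF assms] by (simp add: power2_eq_square)

section \<open>Positive operators, approximate units, and representations\<close>

definition positive_op :: "('h::chilbert_space \<Rightarrow>\<^sub>L 'h) \<Rightarrow> bool" where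
  "positive_op T \<longleftrightarrow> T \<in> bops \<and> (\<forall>x. cinner (blinfun_apply T x) x \<in> \<real>\<^sub>\<ge>\<^sub>0)"

lemma positive_op_Re: "positive_op T \<Longrightarrow> 0 \<le> Re (cinner (blinfun_apply T x) x)"
  by (simp add: positive_op_def complex_nonneg_Reals_iff)

lemma positive_op_bops: "positive_op T \<Longrightarrow> T \<in> bops"
  by (simp add: positive_op_def)

text \<open>Polarisation: the form is real at \<open>x + y\<close> and at \<open>x + \<i> y\<close>.\<close>

lemma positive_op_hermitian:
  assumes T: "positive_op T"
  shows "cinner (blinfun_apply T x) y = cinner x (blinfun_apply T y)"
proof -
  have Tb: "T \<in> bops" using T by (simp add: positive_op_def)
  have im: "Im (cinner (blinfun_apply T z) z) = 0" for z
    using T by (simp add: positive_op_def complex_nonneg_Reals_iff)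
  have "cinner (blinfun_apply T x) y = cnj (cinner (blinfun_apply T y) x)"
  proof (rule complex_eqI)
    show "Im (cinner (blinfun_apply T x) y) = Im (cnj (cinner (blinfun_apply T y) x))"
      using im [of "x + y"] im [of x] im [of y] by (simp add: blinfun.add_right cinner_simps)
    show "Re (cinner (blinfun_apply T x) y) = Re (cnj (cinner (blinfun_apply T y) x))"
      using im [of "x + \<i> *\<^sub>C y"] im [of x] im [of y]
      by (simp add: blinfun.add_right bops_apply_scaleC [OF Tb] cinner_simps)
  qed
  then show ?thesis by (simp add: cinner_commute [of x])
qed

lemma positive_op_adj: "positive_op T \<Longrightarrow> adj T = T"
  by (rule adj_eqI) (simp_all add: positive_op_hermitian positive_op_bops)

text \<open>The form in which positivity of operators and of kernels yields Cauchy--Schwarz inequalities: the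
  minimum over multiples \<open>c\<close> of \<open>cnj z\<close> is taken at \<open>c = - cnj z / \<beta>\<close> if \<open>\<beta> > 0\<close>,
  and for \<open>\<beta> = 0\<close> the linear term has to vanish.\<close>

lemma discriminant_le:
  assumes nonneg: "\<And>c :: complex. 0 \<le> \<alpha> + 2 * Re (c * z) + (cmod c)\<^sup>2 * \<beta>" and \<beta>: "0 \<le> \<beta>"
  shows "(cmod z)\<^sup>2 \<le> \<alpha> * \<beta>"
proof -
  have q: "0 \<le> \<alpha> - 2 * t * (cmod z)\<^sup>2 + t\<^sup>2 * (cmod z)\<^sup>2 * \<beta>" for t :: real
  proof -
    have "(- of_real t * cnj z) * z = of_real (- t * (cmod z)\<^sup>2)"
      using complex_norm_square [of z] by (simp add: mult.commute [of "cnj z"])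
    then have "Re ((- of_real t * cnj z) * z) = - t * (cmod z)\<^sup>2" by (simp only: Re_complex_of_real)
    moreover have "(cmod (- of_real t * cnj z))\<^sup>2 = t\<^sup>2 * (cmod z)\<^sup>2"
      by (simp add: norm_mult power_mult_distrib)
    ultimately show ?thesis using nonneg [of "- of_real t * cnj z"] by simp
  qed
  show ?thesis
  proof (cases "\<beta> = 0")
    case True
    have "z = 0"
    proof (rule ccontr)
      assume "z \<noteq> 0"
      then show False using q [of "(\<alpha> + 1) / (2 * (cmod z)\<^sup>2)"] True by simp
    qed
    then show ?thesis using True by simp
  next
    case False
    then have b: "\<beta> > 0" using \<beta> by simp
    have "(1 / \<beta>)\<^sup>2 * (cmod z)\<^sup>2 * \<beta> = (1 / \<beta>) * (cmod z)\<^sup>2"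
      using b by (simp add: power2_eq_square)
    then have "0 \<le> \<alpha> - (1 / \<beta>) * (cmod z)\<^sup>2" using q [of "1 / \<beta>"] by simp
    then show ?thesis using b by (simp add: field_simps)
  qed
qed

lemma positive_op_cauchy_schwarz:
  assumes T: "positive_op T"
  shows "(cmod (cinner (blinfun_apply T x) y))\<^sup>2
    \<le> Re (cinner (blinfun_apply T x) x) * Re (cinner (blinfun_apply T y) y)"
proof (rule discriminant_le)
  fix c
  have Tb: "T \<in> bops" using T by (simp add: positive_op_def)
  have "cinner (blinfun_apply T (cnj c *\<^sub>C y)) x = cnj (cinner (blinfun_apply T x) (cnj c *\<^sub>C y))"
    by (subst positive_op_hermitian [OF T]) (rule cinner_commute)
  moreover have "cinner (blinfun_apply T x) (cnj c *\<^sub>C y) = c * cinner (blinfun_apply T x) y"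
    by (simp add: cinner_scaleC_right)
  moreover have "cinner (blinfun_apply T (cnj c *\<^sub>C y)) (cnj c *\<^sub>C y)
      = (cmod c)\<^sup>2 * cinner (blinfun_apply T y) y"
    using complex_norm_square [of c]
    by (simp add: cinner_scaleC_right bops_apply_scaleC [OF Tb] cinner_scaleC_left mult_ac)
  ultimately have "Re (cinner (blinfun_apply T (x + cnj c *\<^sub>C y)) (x + cnj c *\<^sub>C y))
      = Re (cinner (blinfun_apply T x) x) + 2 * Re (c * cinner (blinfun_apply T x) y)
        + (cmod c)\<^sup>2 * Re (cinner (blinfun_apply T y) y)"
    by (simp add: blinfun.add_right cinner_add_left cinner_add_right flip: of_real_power)
  then show "0 \<le> Re (cinner (blinfun_apply T x) x) + 2 * Re (c * cinner (blinfun_apply T x) y)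
        + (cmod c)\<^sup>2 * Re (cinner (blinfun_apply T y) y)"
    using positive_op_Re [OF T] by metis
qed (rule positive_op_Re [OF T])

lemma positive_op_apply_norm_sq_le:
  assumes T: "positive_op T" and M: "\<And>x. Re (cinner (blinfun_apply T x) x) \<le> M * (norm x)\<^sup>2" 
  shows "(norm (blinfun_apply T x))\<^sup>2 \<le> M * Re (cinner (blinfun_apply T x) x)"
proof (cases "blinfun_apply T x = 0")
  case False
  define y where "y = blinfun_apply T x"
  have "(norm y)\<^sup>2 * (norm y)\<^sup>2 = (cmod (cinner (blinfun_apply T x) y))\<^sup>2"
    by (simp add: y_def cinner_self norm_mult power2_eq_square)
  also have "\<dots> \<le> Re (cinner (blinfun_apply T x) x) * Re (cinner (blinfun_apply T y) y)"
    by (rule positive_op_cauchy_schwarz [OF T])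
  also have "\<dots> \<le> Re (cinner (blinfun_apply T x) x) * (M * (norm y)\<^sup>2)"
    by (intro mult_left_mono M positive_op_Re [OF T])
  also have "\<dots> = M * Re (cinner (blinfun_apply T x) x) * (norm y)\<^sup>2" by simp
  finally show ?thesis
    unfolding y_def by (rule mult_right_le_imp_le) (use False in simp)
qed (simp add: cinner.zero_left)

lemma positive_op_norm_le:
  assumes T: "positive_op T" and M: "\<And>x. Re (cinner (blinfun_apply T x) x) \<le> M * (norm x)\<^sup>2" "0 \<le> M"
  shows "norm T \<le> M"
proof (rule norm_blinfun_bound [OF M(2)])
  fix x
  have "(norm (blinfun_apply T x))\<^sup>2 \<le> M * (M * (norm x)\<^sup>2)"
    using positive_op_apply_norm_sq_le [OF T M(1), of x] mult_left_mono [OF M(1) M(2), of x] by linarith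
  then have "(norm (blinfun_apply T x))\<^sup>2 \<le> (M * norm x)\<^sup>2"
    by (simp add: power2_eq_square mult_ac)
  then show "norm (blinfun_apply T x) \<le> M * norm x"
    using M(2) by (simp add: power2_le_iff_abs_le)
qed

lemma Re_cinner_apply_le: "Re (cinner (blinfun_apply T x) x) \<le> norm T * (norm x)\<^sup>2"
proof -
  have "Re (cinner (blinfun_apply T x) x) \<le> norm (blinfun_apply T x) * norm x"
    using complex_Re_le_cmod norm_cinner_le order_trans by blast
  also have "\<dots> \<le> norm T * norm x * norm x"
    by (intro mult_right_mono norm_blinfun) simp
  finally show ?thesis by (simp add: power2_eq_square)
qed

lemma cstar_subalgebraD:
  assumes "cstar_subalgebra A"
  shows "A \<subseteq> bops" "csubspace A" "closed A" "\<And>a b. a \<in> A \<Longrightarrow> b \<in> A \<Longrightarrow> a o\<^sub>L b \<in> A"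
    "\<And>a. a \<in> A \<Longrightarrow> adj a \<in> A"
  using assms by (auto simp: cstar_subalgebra_def)

text \<open>Let \<open>c = M\<^sup>-\<^sup>1 \<Sum> a\<^sub>i a\<^sub>i\<^sup>*\<close> with \<open>0 \<le> c \<le> 1\<close>, and let \<open>R = (1 - c)\<^sup>n\<close>. The numbers
  \<open>\<langle>c (1 - c)\<^sup>k x, (1 - c)\<^sup>k x\<rangle>\<close> decrease in \<open>k\<close>, and they sum to at most \<open>\<parallel>x\<parallel>\<^sup>2\<close>, being
  bounded by the differences of the \<open>\<parallel>(1 - c)\<^sup>k x\<parallel>\<^sup>2\<close>. Hence
  \<open>\<parallel>a\<^sub>i\<^sup>* R\<parallel>\<^sup>2 \<le> M / n\<close>. So \<open>1 - R\<^sup>2\<close>, a polynomial in \<open>c\<close> without constant term, is an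
  approximate unit.\<close>

lemma approximate_unit:
  assumes A: "cstar_subalgebra A" and J: "finite J" "\<And>i. i \<in> J \<Longrightarrow> a i \<in> A" and \<epsilon>: "\<epsilon> > 0"
  obtains e where "e \<in> A" "adj e = e" "norm e \<le> 1" "\<And>i. i \<in> J \<Longrightarrow> norm (a i - (e o\<^sub>L a i)) \<le> \<epsilon>"
proof -
  note A' = cstar_subalgebraD [OF A]
  have ab: "a i \<in> bops" if "i \<in> J" for i using A'(1) J(2) that by blast
  define b where "b = (\<Sum>i\<in>J. a i o\<^sub>L adj (a i))"
  have bA: "b \<in> A" unfolding b_def using A' J by (intro csubspace_sum) auto
  have bx: "cinner (blinfun_apply b x) x = of_real (\<Sum>i\<in>J. (norm (blinfun_apply (adj (a i)) x))\<^sup>2)" for x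
  proof -
    have "cinner (blinfun_apply b x) x = (\<Sum>i\<in>J. cinner (blinfun_apply (a i) (blinfun_apply (adj (a i)) x)) x)"
      by (simp add: b_def blinfun.sum_left cinner.sum_left)
    also have "\<dots> = (\<Sum>i\<in>J. of_real ((norm (blinfun_apply (adj (a i)) x))\<^sup>2))"
      by (intro sum.cong refl) (simp add: cinner_adj [OF ab] cinner_self)
    finally show ?thesis by simp
  qed
  \<comment> \<open>Adding \<open>1\<close> keeps \<open>M\<close> positive when all \<open>a\<^sub>i\<close> vanish.\<close>
  define M where "M = norm b + 1"
  have M: "0 < M" by (simp add: M_def add_nonneg_pos)
  define c where "c = (1 / M) *\<^sub>R b"
  have cA: "c \<in> A" unfolding c_def scaleR_scaleC by (intro complex_vector.subspace_scale A' bA)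
  have cb: "c \<in> bops" using cA A' by blast
  have cx: "cinner (blinfun_apply c x) x = of_real (1 / M * (\<Sum>i\<in>J. (norm (blinfun_apply (adj (a i)) x))\<^sup>2))" for x
    by (simp add: c_def blinfun.scaleR_left cinner.scaleR_left bx scaleR_conv_of_real)
  have cpos: "positive_op c"
    unfolding positive_op_def complex_nonneg_Reals_iff using cb M
    by (auto simp only: cx Re_complex_of_real Im_complex_of_real intro!: mult_nonneg_nonneg sum_nonneg)
       auto
  have c1: "Re (cinner (blinfun_apply c x) x) \<le> 1 * (norm x)\<^sup>2" for x
  proof -
    have "Re (cinner (blinfun_apply c x) x) = 1 / M * Re (cinner (blinfun_apply b x) x)"
      by (simp only: cx bx Re_complex_of_real)
    also have "\<dots> \<le> 1 / M * (M * (norm x)\<^sup>2)"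
    proof (intro mult_left_mono)
      have "Re (cinner (blinfun_apply b x) x) \<le> norm b * (norm x)\<^sup>2" by (rule Re_cinner_apply_le)
      also have "\<dots> \<le> M * (norm x)\<^sup>2" by (simp add: M_def distrib_right)
      finally show "Re (cinner (blinfun_apply b x) x) \<le> M * (norm x)\<^sup>2" .
    qed (use M in simp)
    finally show ?thesis using M by simp
  qed
  have csq: "(norm (blinfun_apply c x))\<^sup>2 \<le> Re (cinner (blinfun_apply c x) x)" for x
    using positive_op_apply_norm_sq_le [OF cpos c1, of x] by simp
  define T where "T = id_blinfun - c"
  have Tx: "blinfun_apply T x = x - blinfun_apply c x" for x by (simp add: T_def blinfun.diff_left)
  have Tsq: "(norm (blinfun_apply T x))\<^sup>2 \<le> (norm x)\<^sup>2 - Re (cinner (blinfun_apply c x) x)" for x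
    using csq [of x] positive_op_hermitian [OF cpos, of x x] by (simp add: Tx norm_diff_sq)
  have Tdec: "Re (cinner (blinfun_apply c (blinfun_apply T x)) (blinfun_apply T x))
      \<le> Re (cinner (blinfun_apply c x) x)" for x
  proof -
    define y where "y = blinfun_apply c x"
    have "cinner (blinfun_apply c y) x = cinner y y"
      by (simp add: y_def positive_op_hermitian [OF cpos])
    then have "Re (cinner (blinfun_apply c (blinfun_apply T x)) (blinfun_apply T x))
        = Re (cinner (blinfun_apply c x) x) - 2 * (norm y)\<^sup>2 + Re (cinner (blinfun_apply c y) y)"
      by (simp add: Tx blinfun.diff_right cinner_simps y_def [symmetric] cinner_self)
    then show ?thesis using c1 [of y] zero_le_power2 [of "norm y"] by linarith
  qed
  \<comment> \<open>\<open>e n = 1 - (1 - c)\<^sup>n\<close>, by a recursion that stays inside \<open>A\<close>.\<close>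
  define e where "e = rec_nat (0 :: 'a \<Rightarrow>\<^sub>L 'a) (\<lambda>_ r. r + c - (c o\<^sub>L r))"
  have e0: "e 0 = 0" and eS: "\<And>n. e (Suc n) = e n + c - (c o\<^sub>L e n)" by (simp_all add: e_def)
  have eA: "e n \<in> A" for n
    by (induction n)
      (auto simp: e0 eS complex_vector.subspace_0 [OF A'(2)] cA
        intro!: csubspace_diff [OF A'(2)] complex_vector.subspace_add [OF A'(2)] A'(4))
  define R where "R n = id_blinfun - e n" for n
  have RS: "R (Suc n) = T o\<^sub>L R n" for n
    by (rule blinfun_eqI) (simp add: R_def eS Tx blinfun.bilinear_simps algebra_simps)
  have Rcomm: "c o\<^sub>L R n = R n o\<^sub>L c" for n
  proof (induction n)
    case 0
    show ?case by (rule blinfun_eqI) (simp add: R_def e0 blinfun.bilinear_simps)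
  next
    case (Suc n)
    then have "blinfun_apply c (blinfun_apply (R n) x) = blinfun_apply (R n) (blinfun_apply c x)" for x
      by (metis blinfun_apply_blinfun_compose)
    then show ?case
      by (intro blinfun_eqI) (simp add: RS Tx blinfun.bilinear_simps)
  qed
  have eb: "e n \<in> bops" for n using eA A'(1) by blast
  have cadj: "adj c = c" by (rule positive_op_adj [OF cpos])
  have eadj: "adj (e n) = e n" for n
  proof (induction n)
    case (Suc n)
    have "c o\<^sub>L e n = e n o\<^sub>L c"
      using Rcomm [of n] by (simp add: R_def compose_diff_left compose_diff_right)
        (metis (no_types, lifting) blinfun_apply_blinfun_compose blinfun_apply_id_blinfun blinfun_eqI
          diff_left_imp_eq id_apply)
    then show ?case
      using Suc eb cb by (simp add: eS adj_diff adj_add adj_compose cadj bops_compose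
        complex_vector.subspace_add [OF csubspace_bops])
  qed (simp add: e0 adj_zero)
  have Rb: "R n \<in> bops" for n unfolding R_def by (intro csubspace_diff csubspace_bops id_bops eb)
  have id_adj: "adj (id_blinfun :: 'a \<Rightarrow>\<^sub>L 'a) = id_blinfun" by (rule adj_eqI) (simp_all add: id_bops)
  have Radj: "adj (R n) = R n" for n
    by (simp add: R_def adj_diff id_bops eb eadj id_adj)
  have rate: "real n * Re (cinner (blinfun_apply c (blinfun_apply (R n) x)) (blinfun_apply (R n) x))
      \<le> (norm x)\<^sup>2 - (norm (blinfun_apply (R n) x))\<^sup>2" for n x
  proof (induction n)
    case 0
    show ?case by (simp add: R_def e0)
  next
    case (Suc n)
    define y where "y = blinfun_apply (R n) x"
    define \<delta> where "\<delta> = Re (cinner (blinfun_apply c y) y)"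
    have "real (Suc n) * Re (cinner (blinfun_apply c (blinfun_apply T y)) (blinfun_apply T y))
        \<le> real (Suc n) * \<delta>"
      unfolding \<delta>_def by (intro mult_left_mono Tdec) simp
    also have "\<dots> = real n * \<delta> + \<delta>" by (simp add: algebra_simps)
    also have "\<dots> \<le> (norm x)\<^sup>2 - (norm y)\<^sup>2 + \<delta>" using Suc by (simp add: y_def \<delta>_def)
    also have "\<dots> \<le> (norm x)\<^sup>2 - (norm (blinfun_apply T y))\<^sup>2" using Tsq [of y] by (simp add: \<delta>_def)
    finally show ?case by (simp only: RS blinfun_apply_blinfun_compose y_def)
  qed
  have Rcontr: "norm (blinfun_apply (R n) x) \<le> norm x" for n x
  proof -
    have "0 \<le> real n * Re (cinner (blinfun_apply c (blinfun_apply (R n) x)) (blinfun_apply (R n) x))"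
      by (intro mult_nonneg_nonneg positive_op_Re [OF cpos]) simp
    then have "(norm (blinfun_apply (R n) x))\<^sup>2 \<le> (norm x)\<^sup>2" using rate [of n x] by linarith
    then show ?thesis by (rule power2_le_imp_le) simp
  qed
  obtain n :: nat where n: "M / \<epsilon>\<^sup>2 < real n" "0 < n"
  proof -
    obtain n0 :: nat where "M / \<epsilon>\<^sup>2 < real n0" using reals_Archimedean2 by blast
    then show thesis using that [of "Suc n0"] by simp
  qed
  \<comment> \<open>\<open>u = 1 - (R n)\<^sup>2\<close>; the square gives \<open>\<langle>x - u x, x\<rangle> = \<parallel>R n x\<parallel>\<^sup>2\<close>, whence \<open>\<parallel>u\<parallel> \<le> 1\<close>.\<close>
  define u where "u = e n + (R n o\<^sub>L e n)"
  have ux: "blinfun_apply u x = x - blinfun_apply (R n) (blinfun_apply (R n) x)" for x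
    by (simp add: u_def R_def blinfun.bilinear_simps)
  have u_alt: "u = e n + (e n - (e n o\<^sub>L e n))"
    by (rule blinfun_eqI) (simp add: u_def R_def blinfun.bilinear_simps)
  show ?thesis
  proof (rule that [of u])
    show "u \<in> A" unfolding u_alt
      by (intro complex_vector.subspace_add [OF A'(2)] csubspace_diff [OF A'(2)] eA A'(4))
    show "adj u = u" unfolding u_alt using eb
      by (simp add: adj_add adj_diff adj_compose eadj bops_compose csubspace_diff [OF csubspace_bops])
    show "norm u \<le> 1"
    proof (rule norm_blinfun_bound)
      fix x
      let ?y = "blinfun_apply (R n) x"
      have "cinner x (blinfun_apply (R n) ?y) = cinner ?y ?y"
        using cinner_adj [OF Rb, of n x ?y] by (simp add: Radj)
      then have "(norm (blinfun_apply u x))\<^sup>2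
          = (norm x)\<^sup>2 - 2 * (norm ?y)\<^sup>2 + (norm (blinfun_apply (R n) ?y))\<^sup>2"
        by (simp add: ux norm_diff_sq cinner_self)
      also have "\<dots> \<le> (norm x)\<^sup>2"
        using power_mono [OF Rcontr [of n ?y] norm_ge_zero, of 2] zero_le_power2 [of "norm ?y"]
        by linarith
      finally show "norm (blinfun_apply u x) \<le> 1 * norm x"
        using power2_le_imp_le by fastforce
    qed simp
    fix i assume i: "i \<in> J"
    have "norm (adj (a i) o\<^sub>L R n) \<le> \<epsilon>"
    proof (rule norm_blinfun_bound)
      fix x
      let ?y = "blinfun_apply (R n) x"
      have "(norm (blinfun_apply (adj (a i)) ?y))\<^sup>2 \<le> (\<Sum>i\<in>J. (norm (blinfun_apply (adj (a i)) ?y))\<^sup>2)"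
        using J(1) i by (intro member_le_sum) auto
      also have "\<dots> = M * Re (cinner (blinfun_apply c ?y) ?y)"
        using M by (simp only: cx Re_complex_of_real) simp
      also have "\<dots> \<le> M * ((norm x)\<^sup>2 / real n)"
      proof (intro mult_left_mono)
        have "real n * Re (cinner (blinfun_apply c ?y) ?y) \<le> (norm x)\<^sup>2"
          using rate [of n x] zero_le_power2 [of "norm ?y"] by linarith
        then show "Re (cinner (blinfun_apply c ?y) ?y) \<le> (norm x)\<^sup>2 / real n"
          using n(2) by (simp add: field_simps)
      qed (use M in simp)
      also have "\<dots> = (M / real n) * (norm x)\<^sup>2" by simp
      also have "\<dots> \<le> \<epsilon>\<^sup>2 * (norm x)\<^sup>2"
        using n \<epsilon> by (intro mult_right_mono) (simp_all add: field_simps)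
      finally have "(norm (blinfun_apply (adj (a i)) ?y))\<^sup>2 \<le> (\<epsilon> * norm x)\<^sup>2"
        by (simp add: power_mult_distrib)
      then show "norm (blinfun_apply (adj (a i) o\<^sub>L R n) x) \<le> \<epsilon> * norm x"
        using \<epsilon> by (simp add: power2_le_iff_abs_le)
    qed (use \<epsilon> in simp)
    moreover have "adj (adj (a i) o\<^sub>L R n) = R n o\<^sub>L a i"
      using ab [OF i] Rb by (simp add: adj_compose adj_bops adj_adj Radj)
    moreover have "adj (a i) o\<^sub>L R n \<in> bops"
      using ab [OF i] Rb by (simp add: bops_compose adj_bops)
    ultimately have Ra: "norm (R n o\<^sub>L a i) \<le> \<epsilon>" using norm_adj by metis
    show "norm (a i - (u o\<^sub>L a i)) \<le> \<epsilon>"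
    proof (rule norm_blinfun_bound)
      fix x
      have "norm (blinfun_apply (a i - (u o\<^sub>L a i)) x)
          = norm (blinfun_apply (R n) (blinfun_apply (R n o\<^sub>L a i) x))"
        by (simp add: ux blinfun.diff_left)
      also have "\<dots> \<le> norm (blinfun_apply (R n o\<^sub>L a i) x)" by (rule Rcontr)
      also have "\<dots> \<le> norm (R n o\<^sub>L a i) * norm x" by (rule norm_blinfun)
      also have "\<dots> \<le> \<epsilon> * norm x" using Ra by (intro mult_right_mono) auto
      finally show "norm (blinfun_apply (a i - (u o\<^sub>L a i)) x) \<le> \<epsilon> * norm x" .
    qed (use \<epsilon> in simp)
  qed
qed


definition star_rep :: "('g::chilbert_space \<Rightarrow>\<^sub>L 'g) set \<Rightarrow>
    (('g \<Rightarrow>\<^sub>L 'g) \<Rightarrow> ('k::chilbert_space \<Rightarrow>\<^sub>L 'k)) \<Rightarrow> bool" where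
  "star_rep B \<pi> \<longleftrightarrow> clinear_on B \<pi> \<and> \<pi> ` B \<subseteq> bops \<and>
    (\<forall>a\<in>B. \<forall>b\<in>B. \<pi> (a o\<^sub>L b) = \<pi> a o\<^sub>L \<pi> b) \<and> (\<forall>a\<in>B. \<pi> (adj a) = adj (\<pi> a))"

lemma clinear_onD:
  assumes "clinear_on S F"
  shows "\<And>a b. a \<in> S \<Longrightarrow> b \<in> S \<Longrightarrow> F (a + b) = F a + F b" "\<And>c a. a \<in> S \<Longrightarrow> F (c *\<^sub>C a) = c *\<^sub>C F a"
    "\<And>r a. a \<in> S \<Longrightarrow> F (r *\<^sub>R a) = r *\<^sub>R F a"
  using assms by (auto simp: clinear_on_def scaleR_scaleC)

lemma clinear_on_diff:
  assumes "clinear_on S F" "csubspace S" "a \<in> S" "b \<in> S"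
  shows "F (a - b) = F a - F b"
  using clinear_onD(1) [OF assms(1,3) complex_vector.subspace_scale [OF assms(2,4)], of "- 1"]
    clinear_onD(2) [OF assms(1,4), of "- 1"] by (simp add: scaleC_minus_one)

lemma csubspace_scaleR: "csubspace S \<Longrightarrow> a \<in> S \<Longrightarrow> r *\<^sub>R a \<in> S"
  by (simp add: scaleR_scaleC complex_vector.subspace_scale)

text \<open>\<open>t\<close> is the smaller solution of \<open>t = (\<mu> + t\<^sup>2) / 2\<close>.\<close>

lemma fixed_point_quadratic:
  fixes \<mu> :: real
  assumes "0 \<le> \<mu>" "\<mu> \<le> 1"
  defines "t \<equiv> 1 - sqrt (1 - \<mu>)"
  shows "0 \<le> t" "t\<^sup>2 = 2 * t - \<mu>"
  using assms by (auto simp: power2_eq_square algebra_simps)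

text \<open>A square root inside \<open>B\<close>, up to scalars, explains why positivity of \<open>l + a\<close> is preserved. For \<open>M\<close>
  large, \<open>d = (M - l - a) / (M + \<epsilon>)\<close> is positive of norm less than \<open>1\<close>, so the contraction
  \<open>r \<mapsto> (d + r\<^sup>2) / 2\<close> has a selfadjoint fixed point \<open>r\<close>, and \<open>1 - d = (1 - r)\<^sup>2\<close>. The iteration
  stays inside the affine space \<open>t + B\<close>, where \<open>t\<close> is the fixed point for the scalar part of
  \<open>d\<close>; hence \<open>\<pi>\<close> can be applied to \<open>r - t\<close>, which writes \<open>\<epsilon> + l + \<pi>(a)\<close> as a positive
  multiple of the square of a selfadjoint operator.\<close>

lemma star_rep_positive:
  fixes \<pi> :: "('g::chilbert_space \<Rightarrow>\<^sub>L 'g) \<Rightarrow> ('k::chilbert_space \<Rightarrow>\<^sub>L 'k)"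
  assumes B: "cstar_subalgebra B" and \<pi>: "star_rep B \<pi>"
    and a: "a \<in> B" and l: "0 \<le> l" and pos: "positive_op (l *\<^sub>R id_blinfun + a)"
  shows "positive_op (l *\<^sub>R id_blinfun + \<pi> a)"
proof -
  note B' = cstar_subalgebraD [OF B]
  have \<pi>_lin: "clinear_on B \<pi>" and \<pi>_bops: "\<And>a. a \<in> B \<Longrightarrow> \<pi> a \<in> bops"
    and \<pi>_mult: "\<And>a b. a \<in> B \<Longrightarrow> b \<in> B \<Longrightarrow> \<pi> (a o\<^sub>L b) = \<pi> a o\<^sub>L \<pi> b"
    and \<pi>_adj: "\<And>a. a \<in> B \<Longrightarrow> \<pi> (adj a) = adj (\<pi> a)"
    using \<pi> by (auto simp: star_rep_def)
  have B_mem: "\<And>x y. x \<in> B \<Longrightarrow> y \<in> B \<Longrightarrow> x + y \<in> B" "\<And>x y. x \<in> B \<Longrightarrow> y \<in> B \<Longrightarrow> x - y \<in> B"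
    "\<And>r x. x \<in> B \<Longrightarrow> r *\<^sub>R x \<in> B"
    by (auto intro: complex_vector.subspace_add [OF B'(2)] csubspace_diff [OF B'(2)]
        csubspace_scaleR [OF B'(2)])
  have bops_mem: "\<And>x y :: 'g \<Rightarrow>\<^sub>L 'g. x \<in> bops \<Longrightarrow> y \<in> bops \<Longrightarrow> x + y \<in> bops"
    "\<And>x y :: 'g \<Rightarrow>\<^sub>L 'g. x \<in> bops \<Longrightarrow> y \<in> bops \<Longrightarrow> x - y \<in> bops"
    "\<And>r (x :: 'g \<Rightarrow>\<^sub>L 'g). x \<in> bops \<Longrightarrow> r *\<^sub>R x \<in> bops"
    by (auto intro: complex_vector.subspace_add [OF csubspace_bops] csubspace_diff [OF csubspace_bops]
        csubspace_scaleR [OF csubspace_bops])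
  have sa_scaleR: "adj (r *\<^sub>R x) = r *\<^sub>R x" if "adj x = x" "x \<in> bops" for r and x :: "'g \<Rightarrow>\<^sub>L 'g"
    using that by (simp add: scaleR_scaleC adj_scaleC)
  define M where "M = l + norm a + 1"
  have M: "0 < M" "l \<le> M" using l by (auto simp: M_def intro: add_nonneg_pos)
  have ab: "a \<in> bops" using a B'(1) by blast
  have la: "cinner (blinfun_apply (l *\<^sub>R id_blinfun + a) x) y = of_real l * cinner x y + cinner (blinfun_apply a x) y"
    for x y by (simp add: blinfun.bilinear_simps cinner_add_left cinner.scaleR_left scaleR_conv_of_real)
  have asa: "adj a = a"
  proof (rule adj_eqI [OF ab])
    fix x y
    have "of_real l * cinner x y + cinner (blinfun_apply a x) y
        = cinner x (blinfun_apply (l *\<^sub>R id_blinfun + a) y)"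
      using positive_op_hermitian [OF pos] la by simp
    also have "\<dots> = of_real l * cinner x y + cinner x (blinfun_apply a y)"
      by (simp add: blinfun.bilinear_simps cinner_add_right cinner.scaleR_right scaleR_conv_of_real)
    finally show "cinner (blinfun_apply a x) y = cinner x (blinfun_apply a y)" by simp
  qed
  have main: "0 \<le> (l + \<epsilon>) * (norm u)\<^sup>2 + Re (cinner (blinfun_apply (\<pi> a) u) u)
      \<and> Im (cinner (blinfun_apply (\<pi> a) u) u) = 0" if \<epsilon>: "\<epsilon> > 0" for \<epsilon> u
  proof -
    define N where "N = M + \<epsilon>"
    have N: "0 < N" "M < N" using M \<epsilon> by (auto simp: N_def)
    define \<mu> where "\<mu> = (M - l) / N"
    define \<beta> where "\<beta> = M / N"
    have \<mu>: "0 \<le> \<mu>" "\<mu> \<le> \<beta>" using M N l by (auto simp: \<mu>_def \<beta>_def divide_right_mono)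
    have \<beta>: "0 \<le> \<beta>" "\<beta> < 1" using M N by (auto simp: \<beta>_def)
    define t where "t = 1 - sqrt (1 - \<mu>)"
    define q where "q = 1 - sqrt (1 - \<beta>)"
    have tq: "0 \<le> t" "t\<^sup>2 = 2 * t - \<mu>" "0 \<le> q" "q\<^sup>2 = 2 * q - \<beta>" "t \<le> q" "q < 1"
      using fixed_point_quadratic [of \<mu>] fixed_point_quadratic [of \<beta>] \<mu> \<beta> by (auto simp: t_def q_def)
    define d where "d = \<mu> *\<^sub>R id_blinfun - (1 / N) *\<^sub>R a"
    have db: "d \<in> bops" unfolding d_def by (intro bops_mem id_bops ab)
    have dx: "blinfun_apply d x = \<beta> *\<^sub>R x - (1 / N) *\<^sub>R blinfun_apply (l *\<^sub>R id_blinfun + a) x" for x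
      by (simp add: d_def \<mu>_def \<beta>_def blinfun.bilinear_simps diff_divide_distrib scaleR_diff_left
          scaleR_add_right)
    have dq: "cinner (blinfun_apply d x) x = of_real (\<beta> * (norm x)\<^sup>2)
        - of_real (1 / N) * cinner (blinfun_apply (l *\<^sub>R id_blinfun + a) x) x" for x
      by (simp add: dx cinner.diff_left cinner.scaleR_left scaleR_conv_of_real cinner_self)
    have la_real: "Im (cinner (blinfun_apply (l *\<^sub>R id_blinfun + a) x) x) = 0" for x
      using pos by (simp add: positive_op_def complex_nonneg_Reals_iff)
    have la_le: "Re (cinner (blinfun_apply (l *\<^sub>R id_blinfun + a) x) x) \<le> M * (norm x)\<^sup>2" for x
    proof -
      have "Re (cinner (blinfun_apply (l *\<^sub>R id_blinfun + a) x) x)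
          = l * (norm x)\<^sup>2 + Re (cinner (blinfun_apply a x) x)"
        by (simp add: la cinner_self)
      also have "\<dots> \<le> l * (norm x)\<^sup>2 + norm a * (norm x)\<^sup>2" using Re_cinner_apply_le [of a x] by simp
      also have "\<dots> \<le> M * (norm x)\<^sup>2" by (simp add: M_def distrib_right)
      finally show ?thesis .
    qed
    have dRe: "Re (cinner (blinfun_apply d x) x) = \<beta> * (norm x)\<^sup>2
        - (1 / N) * Re (cinner (blinfun_apply (l *\<^sub>R id_blinfun + a) x) x)" for x
      unfolding dq by simp
    have dpos: "positive_op d"
      unfolding positive_op_def complex_nonneg_Reals_iff
    proof (intro conjI allI db)
      fix x
      have "(1 / N) * Re (cinner (blinfun_apply (l *\<^sub>R id_blinfun + a) x) x) \<le> (1 / N) * (M * (norm x)\<^sup>2)"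
        using N by (intro mult_left_mono la_le) auto
      then show "0 \<le> Re (cinner (blinfun_apply d x) x)" unfolding dRe by (simp add: \<beta>_def)
      show "Im (cinner (blinfun_apply d x) x) = 0" unfolding dq using la_real by simp
    qed
    have dnorm: "norm d \<le> \<beta>"
    proof (rule positive_op_norm_le [OF dpos _ \<beta>(1)])
      fix x show "Re (cinner (blinfun_apply d x) x) \<le> \<beta> * (norm x)\<^sup>2"
        unfolding dRe using N positive_op_Re [OF pos, of x] by simp
    qed
    define C where "C = {b \<in> B. \<forall>x y. cinner (blinfun_apply b x) y = cinner x (blinfun_apply b y)}"
    have C_iff: "b \<in> C \<longleftrightarrow> b \<in> B \<and> adj b = b" for b
      unfolding C_def using B'(1) adj_eqI [of b b] cinner_adj [of b] by (auto 4 3)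
    define S where "S = (+) (t *\<^sub>R id_blinfun) ` C \<inter> cball 0 q"
    define f where "f r = (1/2) *\<^sub>R (d + (r o\<^sub>L r))" for r :: "'g \<Rightarrow>\<^sub>L 'g"
    have C_eq: "C = B \<inter> (\<Inter>x. \<Inter>y. {b. cinner (blinfun_apply b x) y = cinner x (blinfun_apply b y)})"
      by (auto simp: C_def)
    have closed_C: "closed C"
      unfolding C_eq
      by (intro closed_Int B'(3) closed_INT ballI closed_Collect_eq cinner.continuous_on continuous_intros)
    have "closed S"
      unfolding S_def by (intro closed_Int closed_translation closed_C closed_cball)
    then have "complete S" by (simp add: complete_eq_closed)
    moreover have "t *\<^sub>R id_blinfun \<in> S"
    proof -
      have "0 \<in> C" by (simp add: C_iff adj_zero complex_vector.subspace_0 [OF B'(2)])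
      moreover have "norm (t *\<^sub>R (id_blinfun :: 'g \<Rightarrow>\<^sub>L 'g)) \<le> q"
      proof (rule norm_blinfun_bound [OF tq(3)])
        show "norm (blinfun_apply (t *\<^sub>R id_blinfun) x) \<le> q * norm x" for x :: 'g
          using tq by (simp add: blinfun.scaleR_left mult_right_mono)
      qed
      ultimately show ?thesis unfolding S_def by (auto intro!: image_eqI [where x = 0])
    qed
    moreover have "f ` S \<subseteq> S"
    proof clarify
      fix r assume "r \<in> S"
      then obtain b where b: "b \<in> C" "r = t *\<^sub>R id_blinfun + b" and rq: "norm r \<le> q"
        by (auto simp: S_def)
      have bB: "b \<in> B" "adj b = b" "b \<in> bops" using b(1) B'(1) by (auto simp: C_iff)
      define b' where "b' = (1/2) *\<^sub>R ((2 * t) *\<^sub>R b + (b o\<^sub>L b) - (1/N) *\<^sub>R a)"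
      have "f r = ((\<mu> + t\<^sup>2) / 2) *\<^sub>R id_blinfun + b'"
      proof (rule blinfun_eqI)
        fix x
        have half: "(t / 2) *\<^sub>R v + ((t / 2) *\<^sub>R v + w) = t *\<^sub>R v + w" for v w :: 'g
          by (simp flip: scaleR_add_left add.assoc)
        show "blinfun_apply (f r) x = blinfun_apply (((\<mu> + t\<^sup>2) / 2) *\<^sub>R id_blinfun + b') x"
          by (simp add: f_def b(2) b'_def d_def blinfun.bilinear_simps algebra_simps add_divide_distrib
              power2_eq_square half)
      qed
      then have "f r = t *\<^sub>R id_blinfun + b'" by (simp add: tq(2))
      moreover have "b' \<in> C"
        unfolding C_iff b'_def using bB a asa ab
        by (auto intro!: B_mem B'(4) simp: sa_scaleR adj_add adj_diff adj_compose bops_mem bops_compose)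
      moreover have "norm (f r) \<le> q"
      proof -
        have "norm (r o\<^sub>L r) \<le> q * q"
          by (rule order_trans [OF norm_blinfun_compose]) (intro mult_mono rq tq norm_ge_zero)
        then have "norm (d + (r o\<^sub>L r)) \<le> \<beta> + q\<^sup>2"
          using dnorm norm_triangle_ineq [of d "r o\<^sub>L r"] by (simp add: power2_eq_square)
        then show ?thesis by (simp add: f_def tq(4))
      qed
      ultimately show "f r \<in> S" by (auto simp: S_def)
    qed
    moreover have "\<forall>r\<in>S. \<forall>s\<in>S. dist (f r) (f s) \<le> q * dist r s"
    proof (intro ballI)
      fix r s assume "r \<in> S" "s \<in> S"
      then have rs: "norm r \<le> q" "norm s \<le> q" by (auto simp: S_def)
      have "f r - f s = (1/2) *\<^sub>R ((r o\<^sub>L (r - s)) + ((r - s) o\<^sub>L s))"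
        by (rule blinfun_eqI) (simp add: f_def blinfun.bilinear_simps algebra_simps)
      then have "norm (f r - f s) \<le> (1/2) * (norm (r o\<^sub>L (r - s)) + norm ((r - s) o\<^sub>L s))"
        by (simp add: norm_triangle_ineq)
      also have "\<dots> \<le> (1/2) * (q * norm (r - s) + norm (r - s) * q)"
        using rs tq(3)
        by (intro mult_left_mono add_mono order_trans [OF norm_blinfun_compose] mult_mono) auto
      finally show "dist (f r) (f s) \<le> q * dist r s" by (simp add: dist_norm)
    qed
    ultimately obtain r where r: "r \<in> S" "f r = r"
      using Banach_fix [of S q f] tq by blast
    then obtain b where b: "b \<in> B" "adj b = b" "r = t *\<^sub>R id_blinfun + b" by (auto simp: S_def C_iff)
    have rr: "2 *\<^sub>R r = d + (r o\<^sub>L r)" using arg_cong [OF r(2), of "scaleR 2"] by (simp add: f_def)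
    \<comment> \<open>The fixed point equation, with its scalar part removed, is an identity inside \<open>B\<close>.\<close>
    have bb: "(b o\<^sub>L b) - (2 * (1 - t)) *\<^sub>R b = (1/N) *\<^sub>R a"
    proof (rule blinfun_eqI)
      fix x
      have "2 *\<^sub>R (t *\<^sub>R x + blinfun_apply b x) = \<mu> *\<^sub>R x - (1/N) *\<^sub>R blinfun_apply a x
          + (t *\<^sub>R (t *\<^sub>R x + blinfun_apply b x) + t *\<^sub>R blinfun_apply b x + blinfun_apply b (blinfun_apply b x))"
        using arg_cong [OF rr, of "\<lambda>T. blinfun_apply T x"]
        by (simp add: b(3) d_def blinfun.bilinear_simps)
      moreover have "\<mu> = t * 2 - t * t" using tq(2) by (simp add: power2_eq_square)
      moreover have "(t * 2) *\<^sub>R blinfun_apply b x = t *\<^sub>R blinfun_apply b x + t *\<^sub>R blinfun_apply b x"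
        by (simp flip: scaleR_add_left)
      ultimately show "blinfun_apply ((b o\<^sub>L b) - (2 * (1 - t)) *\<^sub>R b) x = blinfun_apply ((1/N) *\<^sub>R a) x"
        by (simp add: blinfun.bilinear_simps algebra_simps)
    qed
    have "(\<pi> b o\<^sub>L \<pi> b) - (2 * (1 - t)) *\<^sub>R \<pi> b = (1/N) *\<^sub>R \<pi> a"
      using arg_cong [OF bb, of \<pi>] b(1) a
      by (simp add: clinear_on_diff [OF \<pi>_lin B'(2)] B_mem B'(4) clinear_onD [OF \<pi>_lin] \<pi>_mult)
    from arg_cong [OF this, of "\<lambda>T. blinfun_apply T u"]
    have pibb: "blinfun_apply (\<pi> b) (blinfun_apply (\<pi> b) u) - (2 * (1 - t)) *\<^sub>R blinfun_apply (\<pi> b) u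
        = (1/N) *\<^sub>R blinfun_apply (\<pi> a) u"
      by (simp add: blinfun.bilinear_simps)
    define y where "y = (1 - t) *\<^sub>R u - blinfun_apply (\<pi> b) u"
    have "cinner (blinfun_apply (\<pi> b) w) v = cinner w (blinfun_apply (\<pi> b) v)" for v w
      using cinner_adj [OF \<pi>_bops [OF b(1)]] \<pi>_adj [OF b(1)] b(2) by simp
    then have "cinner y y = cinner ((1 - t) *\<^sub>R y - blinfun_apply (\<pi> b) y) u"
      by (subst (2) y_def)
        (simp add: cinner.diff_left cinner.diff_right cinner.scaleR_left cinner.scaleR_right)
    also have "(1 - t) *\<^sub>R y - blinfun_apply (\<pi> b) y = (1 - t)\<^sup>2 *\<^sub>R u
        + (blinfun_apply (\<pi> b) (blinfun_apply (\<pi> b) u) - (2 * (1 - t)) *\<^sub>R blinfun_apply (\<pi> b) u)"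
    proof -
      have "(t * 2) *\<^sub>R v = t *\<^sub>R v + t *\<^sub>R v" for v :: 'k by (simp flip: scaleR_add_left)
      then show ?thesis
        by (simp add: y_def blinfun.bilinear_simps algebra_simps power2_eq_square scaleR_2)
    qed
    also have "\<dots> = (1 - \<mu>) *\<^sub>R u + (1/N) *\<^sub>R blinfun_apply (\<pi> a) u"
      using tq(2) by (simp only: pibb) (simp add: power2_diff)
    finally have "cinner (blinfun_apply (\<pi> a) u) u = of_real (N * (norm y)\<^sup>2 - N * (1 - \<mu>) * (norm u)\<^sup>2)"
      using N
      by (simp add: cinner_add_left cinner.diff_left cinner.scaleR_left scaleR_conv_of_real cinner_self
          field_simps)
    moreover have "N * (1 - \<mu>) = l + \<epsilon>" using N by (simp add: \<mu>_def N_def field_simps)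
    ultimately show ?thesis using N by simp
  qed
  have "0 \<le> l * (norm u)\<^sup>2 + Re (cinner (blinfun_apply (\<pi> a) u) u)" for u
  proof (rule field_le_epsilon)
    fix e :: real assume e: "0 < e"
    have "0 \<le> (l + e / ((norm u)\<^sup>2 + 1)) * (norm u)\<^sup>2 + Re (cinner (blinfun_apply (\<pi> a) u) u)"
      using main [of "e / ((norm u)\<^sup>2 + 1)" u] e by (simp add: add_nonneg_pos)
    moreover have "e / ((norm u)\<^sup>2 + 1) * (norm u)\<^sup>2 \<le> e"
      using e add_nonneg_pos [OF zero_le_power2 [of "norm u"] zero_less_one]
      by (simp add: pos_divide_le_eq algebra_simps)
    ultimately show "0 \<le> l * (norm u)\<^sup>2 + Re (cinner (blinfun_apply (\<pi> a) u) u) + e"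
      by (simp add: distrib_right)
  qed
  moreover have "Im (cinner (blinfun_apply (\<pi> a) u) u) = 0" for u using main [of 1 u] by simp
  moreover have "l *\<^sub>R id_blinfun + \<pi> a \<in> bops"
    by (intro complex_vector.subspace_add [OF csubspace_bops] csubspace_scaleR [OF csubspace_bops]
        id_bops \<pi>_bops a)
  ultimately show ?thesis
    by (simp add: positive_op_def complex_nonneg_Reals_iff blinfun.bilinear_simps cinner_add_left
        cinner.scaleR_left cinner_self)
qed

text \<open>The case \<open>l = \<parallel>a\<parallel>\<^sup>2\<close> of positivity, for the operator \<open>\<parallel>a\<parallel>\<^sup>2 - a\<^sup>* a\<close>.\<close>

lemma star_rep_norm_le:
  fixes \<pi> :: "('g::chilbert_space \<Rightarrow>\<^sub>L 'g) \<Rightarrow> ('k::chilbert_space \<Rightarrow>\<^sub>L 'k)"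
  assumes B: "cstar_subalgebra B" and \<pi>: "star_rep B \<pi>" and a: "a \<in> B"
  shows "norm (\<pi> a) \<le> norm a"
proof (rule norm_blinfun_bound)
  note B' = cstar_subalgebraD [OF B]
  have ab: "a \<in> bops" using a B' by blast
  define c where "c = (-1) *\<^sub>R (adj a o\<^sub>L a)"
  have cB: "c \<in> B" unfolding c_def by (intro csubspace_scaleR B' a)
  have quad: "cinner (blinfun_apply ((norm S)\<^sup>2 *\<^sub>R id_blinfun + (-1) *\<^sub>R (adj T o\<^sub>L T)) x) x
      = of_real ((norm S)\<^sup>2 * (norm x)\<^sup>2 - (norm (blinfun_apply T x))\<^sup>2)" if "T \<in> bops"
    for S :: "'g \<Rightarrow>\<^sub>L 'g" and T :: "'b::chilbert_space \<Rightarrow>\<^sub>L 'b" and x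
    by (simp add: blinfun.bilinear_simps cinner_simps cinner.scaleR_left cinner_adj_left [OF that]
        cinner_self scaleR_conv_of_real)
  have cb: "c \<in> bops" using cB B' by blast
  have "positive_op ((norm a)\<^sup>2 *\<^sub>R id_blinfun + c)"
    unfolding positive_op_def
  proof (intro conjI allI complex_vector.subspace_add [OF csubspace_bops]
      csubspace_scaleR [OF csubspace_bops] id_bops cb)
    fix x
    have "(norm (blinfun_apply a x))\<^sup>2 \<le> (norm a)\<^sup>2 * (norm x)\<^sup>2"
      unfolding power_mult_distrib [symmetric] by (intro power_mono norm_blinfun norm_ge_zero)
    then show "cinner (blinfun_apply ((norm a)\<^sup>2 *\<^sub>R id_blinfun + c) x) x \<in> \<real>\<^sub>\<ge>\<^sub>0"
      unfolding c_def quad [OF ab] nonneg_Reals_of_real_iff by simp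
  qed
  then have "positive_op ((norm a)\<^sup>2 *\<^sub>R id_blinfun + \<pi> c)"
    by (intro star_rep_positive [OF B \<pi> cB]) simp_all
  moreover have "\<pi> c = (-1) *\<^sub>R (adj (\<pi> a) o\<^sub>L \<pi> a)"
    using \<pi> a B'(4,5) unfolding star_rep_def c_def by (metis clinear_onD(3))
  moreover have "\<pi> a \<in> bops" using \<pi> a by (auto simp: star_rep_def)
  ultimately have "0 \<le> Re (of_real ((norm a)\<^sup>2 * (norm x)\<^sup>2 - (norm (blinfun_apply (\<pi> a) x))\<^sup>2) :: complex)"
    for x using positive_op_Re quad by metis
  then have "(norm (blinfun_apply (\<pi> a) x))\<^sup>2 \<le> (norm a * norm x)\<^sup>2" for x
    by (simp add: power_mult_distrib)
  then show "norm (blinfun_apply (\<pi> a) x) \<le> norm a * norm x" for x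
    by (rule power2_le_imp_le) simp
qed simp

section \<open>Operator matrices on \<open>\<ell>\<^sup>2(X, H)\<close>\<close>

definition emb :: "'x \<Rightarrow> ('h::chilbert_space \<Rightarrow>\<^sub>L ('x, 'h) l2)" where
  "emb x = Blinfun (delta_vec x)"

definition coord :: "'x \<Rightarrow> (('x, 'h::chilbert_space) l2 \<Rightarrow>\<^sub>L 'h)" where
  "coord x = Blinfun (\<lambda>\<xi>. Rep_l2 \<xi> x)"

lemma emb_apply: "blinfun_apply (emb x) h = delta_vec x h"
  by (simp add: emb_def bounded_linear_Blinfun_apply bounded_linear_delta_vec)

lemma coord_apply: "blinfun_apply (coord x) \<xi> = Rep_l2 \<xi> x"
  by (simp add: coord_def bounded_linear_Blinfun_apply bounded_linear_Rep_l2)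

lemma coord_emb: "blinfun_apply (coord x) (blinfun_apply (emb y) h) = (if x = y then h else 0)"
  by (simp add: emb_apply coord_apply delta_vec.rep_eq)

lemma emb_bops: "emb x \<in> bops"
  by (rule bopsI) (simp add: emb_apply, transfer, auto)

lemma coord_bops: "coord x \<in> bops"
  by (rule bopsI) (simp add: coord_apply scaleC_l2.rep_eq)

lemma l2_eqI: "(\<And>x. blinfun_apply (coord x) \<xi> = blinfun_apply (coord x) \<eta>) \<Longrightarrow> \<xi> = \<eta>"
  by (simp add: coord_apply Rep_l2_inject [symmetric] fun_eq_iff)

lemma cinner_emb: "cinner (blinfun_apply (emb x) h) \<xi> = cinner h (blinfun_apply (coord x) \<xi>)"
proof -
  have "cinner (blinfun_apply (emb x) h) \<xi> = (\<Sum>\<^sub>\<infinity>z\<in>{x}. cinner h (Rep_l2 \<xi> z))"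
    unfolding cinner_l2.rep_eq emb_apply delta_vec.rep_eq
    by (rule infsum_cong_neutral) (auto simp: cinner.zero_left)
  then show ?thesis by (simp add: coord_apply)
qed

lemma cinner_coord: "cinner (blinfun_apply (coord x) \<xi>) h = cinner \<xi> (blinfun_apply (emb x) h)"
  using cinner_emb [of x h \<xi>] by (metis cinner_commute)

lemma adj_emb: "adj (emb x) = coord x"
  by (rule adj_eqI) (simp_all add: emb_bops cinner_emb)

lemma adj_coord: "adj (coord x) = emb x"
  by (rule adj_eqI) (simp_all add: coord_bops cinner_coord)

lemma norm_emb: "norm (blinfun_apply (emb x) h) = norm h"
proof -
  have "(norm (blinfun_apply (emb x) h))\<^sup>2 = (norm h)\<^sup>2"
    by (simp add: norm_sq_eq_cinner cinner_emb coord_emb)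
  then show ?thesis by simp
qed

lemma norm_coord_le: "norm (blinfun_apply (coord x) \<xi>) \<le> norm \<xi>"
  using norm_l2_sum_le [of "{x}" \<xi>] by (simp add: coord_apply power2_le_iff_abs_le)

lemma matrix_entry_eq: "matrix_entry T x y = coord x o\<^sub>L T o\<^sub>L emb y"
  by (rule blinfun_eqI) (simp add: matrix_entry.rep_eq emb_apply coord_apply)

lemma matrix_entry_apply:
  "blinfun_apply (matrix_entry T x y) h = blinfun_apply (coord x) (blinfun_apply T (blinfun_apply (emb y) h))"
  by (simp add: matrix_entry_eq)

lemma matrix_entry_bops: "T \<in> bops \<Longrightarrow> matrix_entry T x y \<in> bops"
  unfolding matrix_entry_eq by (intro bops_compose coord_bops emb_bops)

lemma bounded_linear_matrix_entry:
  "bounded_linear (\<lambda>T :: ('x, 'h::chilbert_space) l2 \<Rightarrow>\<^sub>L ('x, 'h) l2. matrix_entry T x y)"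
  unfolding matrix_entry_eq
  by (rule bounded_linear_compose [OF
        bounded_bilinear.bounded_linear_left [OF bounded_bilinear_blinfun_compose]
        bounded_bilinear.bounded_linear_right [OF bounded_bilinear_blinfun_compose]])

lemma matrix_entry_add: "matrix_entry (S + T) x y = matrix_entry S x y + matrix_entry T x y"
  and matrix_entry_scaleC: "matrix_entry (c *\<^sub>C T) x y = c *\<^sub>C matrix_entry T x y"
  by (rule blinfun_eqI; simp add: matrix_entry_apply blinfun.bilinear_simps bops_apply_scaleC [OF coord_bops]
      blinfun.sum_left blinfun.sum_right)+


definition finite_vec :: "'x set \<Rightarrow> ('x \<Rightarrow> 'h::chilbert_space) \<Rightarrow> ('x, 'h) l2" where
  "finite_vec F \<xi> = (\<Sum>x\<in>F. blinfun_apply (emb x) (\<xi> x))"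

lemma coord_finite_vec: "finite F \<Longrightarrow> blinfun_apply (coord x) (finite_vec F \<xi>) = (if x \<in> F then \<xi> x else 0)"
  by (simp add: finite_vec_def blinfun.sum_right coord_emb)

lemma norm_finite_vec:
  assumes "finite F"
  shows "norm (finite_vec F \<xi>) = L2_set (\<lambda>x. norm (\<xi> x)) F"
proof -
  have "(norm (finite_vec F \<xi>))\<^sup>2 = (\<Sum>x\<in>F. (norm (\<xi> x))\<^sup>2)"
    unfolding norm_sq_eq_cinner
    by (subst (1) finite_vec_def)
      (simp add: cinner.sum_left cinner_emb coord_finite_vec [OF assms] norm_sq_eq_cinner)
  then show ?thesis by (simp add: L2_set_def real_sqrt_unique)
qed

lemma L2_set_coord_le: "L2_set (\<lambda>x. norm (blinfun_apply (coord x) \<xi>)) F \<le> norm \<xi>"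
proof (cases "finite F")
  case True
  then show ?thesis
    using norm_l2_sum_le [OF True, of \<xi>] by (simp add: L2_set_def coord_apply real_le_lsqrt)
qed simp

text \<open>By Pythagoras the squared distance is a tail of the convergent sum \<open>\<Sum> \<parallel>\<xi>\<^sub>x\<parallel>\<^sup>2\<close>.\<close>

lemma finite_vec_coord_tendsto:
  "((\<lambda>F. finite_vec F (\<lambda>x. blinfun_apply (coord x) \<xi>)) \<longlongrightarrow> \<xi>) (finite_subsets_at_top UNIV)"
proof -
  let ?P = "\<lambda>F. finite_vec F (\<lambda>x. blinfun_apply (coord x) \<xi>)"
  let ?s = "\<lambda>x. (norm (blinfun_apply (coord x) \<xi>))\<^sup>2"
  have dist_sq: "(norm (\<xi> - ?P F))\<^sup>2 = (norm \<xi>)\<^sup>2 - sum ?s F" if F: "finite F" for F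
  proof -
    have "cinner \<xi> (?P F) = of_real (sum ?s F)"
      by (simp add: finite_vec_def cinner.sum_right cinner_coord [symmetric] cinner_self)
    moreover have "(norm (?P F))\<^sup>2 = sum ?s F"
      by (simp add: norm_finite_vec [OF F] L2_set_def sum_nonneg)
    ultimately show ?thesis by (simp add: norm_diff_sq)
  qed
  have "(?s has_sum (norm \<xi>)\<^sup>2) UNIV"
    unfolding norm_l2_eq coord_apply using Rep_l2 [of \<xi>] by (auto intro: has_sum_infsum)
  then have "((\<lambda>F. (norm \<xi>)\<^sup>2 - sum ?s F) \<longlongrightarrow> (norm \<xi>)\<^sup>2 - (norm \<xi>)\<^sup>2) (finite_subsets_at_top UNIV)"
    unfolding has_sum_def by (intro tendsto_intros)
  then have "((\<lambda>F. (norm \<xi>)\<^sup>2 - sum ?s F) \<longlongrightarrow> 0) (finite_subsets_at_top UNIV)" by simp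
  then have "((\<lambda>F. (norm (\<xi> - ?P F))\<^sup>2) \<longlongrightarrow> 0) (finite_subsets_at_top UNIV)"
    by (rule Lim_transform_eventually)
      (rule eventually_finite_subsets_at_top_weakI, simp add: dist_sq)
  then have "((\<lambda>F. sqrt ((norm (\<xi> - ?P F))\<^sup>2)) \<longlongrightarrow> sqrt 0) (finite_subsets_at_top UNIV)"
    by (rule tendsto_real_sqrt)
  then have "((\<lambda>F. norm (?P F - \<xi>)) \<longlongrightarrow> 0) (finite_subsets_at_top UNIV)"
    by (simp add: norm_minus_commute)
  then show ?thesis by (simp add: tendsto_norm_zero_iff LIM_zero_iff)
qed

lemma blinfun_eq_if_matrix_entry_eq:
  fixes S T :: "('x, 'h::chilbert_space) l2 \<Rightarrow>\<^sub>L ('x, 'h) l2"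
  assumes "\<And>x y. matrix_entry S x y = matrix_entry T x y"
  shows "S = T"
proof (rule blinfun_eqI)
  fix \<xi> :: "('x, 'h) l2"
  let ?P = "\<lambda>F. finite_vec F (\<lambda>x. blinfun_apply (coord x) \<xi>)"
  have emb: "blinfun_apply S (blinfun_apply (emb y) h) = blinfun_apply T (blinfun_apply (emb y) h)" for y h
    using assms by (intro l2_eqI) (simp add: matrix_entry_apply [symmetric])
  have "((\<lambda>F. blinfun_apply S (?P F)) \<longlongrightarrow> blinfun_apply S \<xi>) (finite_subsets_at_top UNIV)"
    by (intro tendsto_intros finite_vec_coord_tendsto)
  moreover have "((\<lambda>F. blinfun_apply T (?P F)) \<longlongrightarrow> blinfun_apply T \<xi>) (finite_subsets_at_top UNIV)"
    by (intro tendsto_intros finite_vec_coord_tendsto)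
  moreover have "(\<lambda>F. blinfun_apply S (?P F)) = (\<lambda>F. blinfun_apply T (?P F))"
    by (simp add: finite_vec_def blinfun.sum_right emb)
  ultimately show "blinfun_apply S \<xi> = blinfun_apply T \<xi>"
    using tendsto_unique [OF finite_subsets_at_top_neq_bot] by metis
qed

text \<open>Positivity and norm bounds of operator matrices are expressed through the sesquilinear form, over
  an arbitrary finite index set. So index sets such as \<open>{..<n} \<times> F\<close>, which arise from matrices over
  operators on \<open>\<ell>\<^sup>2(X, H)\<close>, need not be enumerated.\<close>

definition matrix_form ::
    "'i set \<Rightarrow> ('i \<Rightarrow> 'i \<Rightarrow> ('h::chilbert_space \<Rightarrow>\<^sub>L 'h)) \<Rightarrow> ('i \<Rightarrow> 'h) \<Rightarrow> ('i \<Rightarrow> 'h) \<Rightarrow> complex" where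
  "matrix_form J a \<xi> \<eta> = (\<Sum>i\<in>J. \<Sum>j\<in>J. cinner (blinfun_apply (a i j) (\<xi> j)) (\<eta> i))"

definition psd :: "'i set \<Rightarrow> ('i \<Rightarrow> 'i \<Rightarrow> ('h::chilbert_space \<Rightarrow>\<^sub>L 'h)) \<Rightarrow> bool" where
  "psd J a \<longleftrightarrow> (\<forall>\<xi>. matrix_form J a \<xi> \<xi> \<in> \<real>\<^sub>\<ge>\<^sub>0)"

definition form_bound :: "'i set \<Rightarrow> ('i \<Rightarrow> 'i \<Rightarrow> ('h::chilbert_space \<Rightarrow>\<^sub>L 'h)) \<Rightarrow> real \<Rightarrow> bool" where
  "form_bound J a M \<longleftrightarrow> (\<forall>\<xi> \<eta>. cmod (matrix_form J a \<xi> \<eta>)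
    \<le> M * L2_set (\<lambda>j. norm (\<xi> j)) J * L2_set (\<lambda>i. norm (\<eta> i)) J)"

lemma matrix_form_cong:
  assumes "\<And>i j. i \<in> J \<Longrightarrow> j \<in> J \<Longrightarrow> a i j = b i j" "\<And>i. i \<in> J \<Longrightarrow> \<xi> i = \<xi>' i" "\<And>i. i \<in> J \<Longrightarrow> \<eta> i = \<eta>' i"
  shows "matrix_form J a \<xi> \<eta> = matrix_form J b \<xi>' \<eta>'"
  unfolding matrix_form_def using assms by (intro sum.cong refl) auto

lemma psd_cong:
  assumes "\<And>i j. i \<in> J \<Longrightarrow> j \<in> J \<Longrightarrow> a i j = b i j"
  shows "psd J a = psd J b"
  unfolding psd_def using matrix_form_cong [of J a b, OF assms] by auto

lemma form_bound_cong:
  assumes "\<And>i j. i \<in> J \<Longrightarrow> j \<in> J \<Longrightarrow> a i j = b i j"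
  shows "form_bound J a M = form_bound J b M"
  unfolding form_bound_def using matrix_form_cong [of J a b, OF assms] by auto

text \<open>Matrices over a finite \<open>J\<close> are realised as operators on \<open>\<ell>\<^sup>2(I, H)\<close> supported on \<open>J\<close>; thereby
  results on \<open>*\<close>-algebras of operators on one Hilbert space apply to matrix algebras.\<close>

definition op_of :: "'i set \<Rightarrow> ('i \<Rightarrow> 'i \<Rightarrow> ('h::chilbert_space \<Rightarrow>\<^sub>L 'h)) \<Rightarrow> (('i, 'h) l2 \<Rightarrow>\<^sub>L ('i, 'h) l2)" where
  "op_of J a = (\<Sum>i\<in>J. \<Sum>j\<in>J. emb i o\<^sub>L a i j o\<^sub>L coord j)"

lemma op_of_cong: "(\<And>i j. i \<in> J \<Longrightarrow> j \<in> J \<Longrightarrow> a i j = b i j) \<Longrightarrow> op_of J a = op_of J b"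
  unfolding op_of_def by (intro sum.cong refl) auto

lemma op_of_apply: "blinfun_apply (op_of J a) \<xi>
    = (\<Sum>i\<in>J. \<Sum>j\<in>J. blinfun_apply (emb i) (blinfun_apply (a i j) (blinfun_apply (coord j) \<xi>)))"
  by (simp add: op_of_def blinfun.sum_left)

lemma matrix_entry_op_of:
  assumes "finite J"
  shows "matrix_entry (op_of J a) x y = (if x \<in> J \<and> y \<in> J then a x y else 0)"
proof (rule blinfun_eqI)
  fix h
  have "blinfun_apply (matrix_entry (op_of J a) x y) h
      = (\<Sum>i\<in>J. \<Sum>j\<in>J. if j = y then if i = x then blinfun_apply (a i y) h else 0 else 0)"
    unfolding matrix_entry_apply op_of_apply blinfun.sum_right coord_emb
    by (intro sum.cong refl) (auto simp: blinfun.zero_right)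
  also have "\<dots> = blinfun_apply (if x \<in> J \<and> y \<in> J then a x y else 0) h"
    using assms by (cases "x \<in> J"; cases "y \<in> J") (auto simp: sum.delta intro!: sum.neutral)
  finally show "blinfun_apply (matrix_entry (op_of J a) x y) h
      = blinfun_apply (if x \<in> J \<and> y \<in> J then a x y else 0) h" .
qed

lemma op_of_bops: "(\<And>i j. i \<in> J \<Longrightarrow> j \<in> J \<Longrightarrow> a i j \<in> bops) \<Longrightarrow> op_of J a \<in> bops"
  unfolding op_of_def by (intro csubspace_sum csubspace_bops bops_compose emb_bops coord_bops) auto

lemma cinner_op_of: "cinner (blinfun_apply (op_of J a) \<xi>) \<eta>
    = matrix_form J a (\<lambda>j. blinfun_apply (coord j) \<xi>) (\<lambda>i. blinfun_apply (coord i) \<eta>)"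
  by (simp add: op_of_apply matrix_form_def cinner.sum_left cinner_emb)

lemma matrix_form_eq_cinner:
  "finite J \<Longrightarrow> matrix_form J a \<xi> \<eta> = cinner (blinfun_apply (op_of J a) (finite_vec J \<xi>)) (finite_vec J \<eta>)"
  unfolding cinner_op_of by (intro matrix_form_cong) (auto simp: coord_finite_vec)

lemma positive_op_of_iff:
  assumes "finite J" "\<And>i j. i \<in> J \<Longrightarrow> j \<in> J \<Longrightarrow> a i j \<in> bops"
  shows "positive_op (op_of J a) \<longleftrightarrow> psd J a"
proof
  assume "positive_op (op_of J a)"
  then show "psd J a"
    by (auto simp: positive_op_def psd_def matrix_form_eq_cinner [OF assms(1)])
next
  assume "psd J a"
  then show "positive_op (op_of J a)"
    using op_of_bops [OF assms(2)] by (auto simp: positive_op_def psd_def cinner_op_of)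
qed

lemma norm_op_of_le_iff:
  fixes a :: "'i \<Rightarrow> 'i \<Rightarrow> ('h::chilbert_space \<Rightarrow>\<^sub>L 'h)"
  assumes J: "finite J" and M: "0 \<le> M"
  shows "norm (op_of J a) \<le> M \<longleftrightarrow> form_bound J a M"
proof
  assume le: "norm (op_of J a) \<le> M"
  have "cmod (matrix_form J a \<xi> \<eta>) \<le> M * L2_set (\<lambda>j. norm (\<xi> j)) J * L2_set (\<lambda>i. norm (\<eta> i)) J" for \<xi> \<eta>
  proof -
    have "cmod (matrix_form J a \<xi> \<eta>) \<le> norm (blinfun_apply (op_of J a) (finite_vec J \<xi>)) * norm (finite_vec J \<eta>)"
      unfolding matrix_form_eq_cinner [OF J] by (rule norm_cinner_le)
    also have "\<dots> \<le> (M * norm (finite_vec J \<xi>)) * norm (finite_vec J \<eta>)"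
      using order_trans [OF norm_blinfun mult_right_mono [OF le norm_ge_zero]]
      by (intro mult_right_mono) auto
    finally show ?thesis by (simp add: norm_finite_vec [OF J])
  qed
  then show "form_bound J a M" by (simp add: form_bound_def)
next
  assume fb: "form_bound J a M"
  show "norm (op_of J a) \<le> M"
  proof (rule norm_blinfun_bound [OF M], rule norm_le_if_cinner_le)
    fix \<xi> \<eta> :: "('i, 'h) l2"
    let ?x = "L2_set (\<lambda>j. norm (blinfun_apply (coord j) \<xi>)) J"
    let ?y = "L2_set (\<lambda>j. norm (blinfun_apply (coord j) \<eta>)) J"
    have "cmod (cinner (blinfun_apply (op_of J a) \<xi>) \<eta>) \<le> M * ?x * ?y"
      using fb unfolding cinner_op_of form_bound_def by blast
    also have "\<dots> \<le> M * norm \<xi> * norm \<eta>"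
      using M by (intro mult_mono mult_left_mono L2_set_coord_le) auto
    finally show "cmod (cinner (blinfun_apply (op_of J a) \<xi>) \<eta>) \<le> M * norm \<xi> * norm \<eta>" .
  qed (use M in simp)
qed

lemma op_of_compose:
  assumes "finite J"
  shows "op_of J a o\<^sub>L op_of J b = op_of J (\<lambda>i j. \<Sum>k\<in>J. a i k o\<^sub>L b k j)"
proof (rule blinfun_eqI)
  fix \<xi>
  have "blinfun_apply (coord k) (blinfun_apply (op_of J b) \<xi>)
      = (\<Sum>j\<in>J. blinfun_apply (b k j) (blinfun_apply (coord j) \<xi>))" if "k \<in> J" for k
  proof -
    have "blinfun_apply (coord k) (blinfun_apply (op_of J b) \<xi>)
      = (\<Sum>i\<in>J. if i = k then (\<Sum>j\<in>J. blinfun_apply (b i j) (blinfun_apply (coord j) \<xi>)) else 0)"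
      unfolding op_of_apply blinfun.sum_right coord_emb by (intro sum.cong refl) auto
    then show ?thesis using assms that by (simp add: sum.delta)
  qed
  then have "blinfun_apply (op_of J a o\<^sub>L op_of J b) \<xi> = (\<Sum>i\<in>J. \<Sum>k\<in>J. \<Sum>j\<in>J.
      blinfun_apply (emb i) (blinfun_apply (a i k) (blinfun_apply (b k j) (blinfun_apply (coord j) \<xi>))))"
    by (simp add: op_of_apply [of J a] blinfun.sum_right)
  also have "\<dots> = (\<Sum>i\<in>J. \<Sum>j\<in>J. \<Sum>k\<in>J.
      blinfun_apply (emb i) (blinfun_apply (a i k) (blinfun_apply (b k j) (blinfun_apply (coord j) \<xi>))))"
    by (intro sum.cong refl sum.swap)
  finally show "blinfun_apply (op_of J a o\<^sub>L op_of J b) \<xi>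
      = blinfun_apply (op_of J (\<lambda>i j. \<Sum>k\<in>J. a i k o\<^sub>L b k j)) \<xi>"
    by (simp add: op_of_apply blinfun.sum_left blinfun.sum_right)
qed

lemma adj_op_of:
  assumes "\<And>i j. i \<in> J \<Longrightarrow> j \<in> J \<Longrightarrow> a i j \<in> bops"
  shows "adj (op_of J a) = op_of J (\<lambda>i j. adj (a j i))"
proof -
  have "adj (op_of J a) = (\<Sum>i\<in>J. \<Sum>j\<in>J. adj (emb i o\<^sub>L a i j o\<^sub>L coord j))"
    unfolding op_of_def using assms
    by (subst adj_sum adj_sum [OF bops_compose];
        auto intro!: csubspace_sum csubspace_bops bops_compose emb_bops coord_bops sum.cong adj_sum)
  also have "\<dots> = (\<Sum>i\<in>J. \<Sum>j\<in>J. emb j o\<^sub>L adj (a i j) o\<^sub>L coord i)"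
    using assms by (intro sum.cong refl)
      (simp add: adj_compose bops_compose emb_bops coord_bops adj_emb adj_coord blinfun_eqI)
  also have "\<dots> = op_of J (\<lambda>i j. adj (a j i))" unfolding op_of_def by (rule sum.swap)
  finally show ?thesis .
qed

lemma op_of_add: "op_of J a + op_of J b = op_of J (\<lambda>i j. a i j + b i j)"
  by (rule blinfun_eqI) (simp add: op_of_apply blinfun.bilinear_simps sum.distrib)

lemma op_of_scaleC: "c *\<^sub>C op_of J a = op_of J (\<lambda>i j. c *\<^sub>C a i j)"
  by (rule blinfun_eqI)
    (simp add: op_of_apply bops_apply_scaleC [OF emb_bops] complex_vector.scale_sum_right)

definition matrix_algebra ::
    "'i set \<Rightarrow> ('h::chilbert_space \<Rightarrow>\<^sub>L 'h) set \<Rightarrow> (('i, 'h) l2 \<Rightarrow>\<^sub>L ('i, 'h) l2) set" where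
  "matrix_algebra J A = {T. op_of J (matrix_entry T) = T \<and> (\<forall>i\<in>J. \<forall>j\<in>J. matrix_entry T i j \<in> A)}"

lemma op_of_in_matrix_algebra:
  "finite J \<Longrightarrow> (\<And>i j. i \<in> J \<Longrightarrow> j \<in> J \<Longrightarrow> a i j \<in> A) \<Longrightarrow> op_of J a \<in> matrix_algebra J A"
  by (auto simp: matrix_algebra_def matrix_entry_op_of intro: op_of_cong)

lemma in_matrix_algebraE:
  assumes "T \<in> matrix_algebra J A"
  obtains a where "T = op_of J a" "\<And>i j. i \<in> J \<Longrightarrow> j \<in> J \<Longrightarrow> a i j \<in> A"
  using assms unfolding matrix_algebra_def by (metis (mono_tags, lifting) mem_Collect_eq)

lemma cstar_subalgebra_matrix_algebra:
  fixes A :: "('h::chilbert_space \<Rightarrow>\<^sub>L 'h) set" and J :: "'i set"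
  assumes A: "cstar_subalgebra A" and J: "finite J"
  shows "cstar_subalgebra (matrix_algebra J A)"
  unfolding cstar_subalgebra_def
proof (intro conjI ballI subsetI)
  note A' = cstar_subalgebraD [OF A]
  note mem = op_of_in_matrix_algebra [OF J]
  show "csubspace (matrix_algebra J A)"
  proof (rule complex_vector.subspaceI)
    have "op_of J (\<lambda>_ _. 0 :: 'h \<Rightarrow>\<^sub>L 'h) \<in> matrix_algebra J A"
      by (rule mem) (rule complex_vector.subspace_0 [OF A'(2)])
    moreover have "op_of J (\<lambda>_ _. 0 :: 'h \<Rightarrow>\<^sub>L 'h) = 0" by (rule blinfun_eqI) (simp add: op_of_apply)
    ultimately show "0 \<in> matrix_algebra J A" by simp
  next
    fix S T assume ST: "S \<in> matrix_algebra J A" "T \<in> matrix_algebra J A"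
    show "S + T \<in> matrix_algebra J A"
      using ST by (elim in_matrix_algebraE)
        (auto simp: op_of_add intro!: mem complex_vector.subspace_add [OF A'(2)])
  next
    fix c T assume "T \<in> matrix_algebra J A"
    then show "c *\<^sub>C T \<in> matrix_algebra J A"
      by (elim in_matrix_algebraE)
        (auto simp: op_of_scaleC intro!: mem complex_vector.subspace_scale [OF A'(2)])
  qed
  show "closed (matrix_algebra J A)"
  proof -
    have eq: "matrix_algebra J A = {T. op_of J (matrix_entry T) = T} \<inter>
        (\<Inter>i\<in>J. \<Inter>j\<in>J. (\<lambda>T. matrix_entry T i j) -` A)"
      by (auto simp: matrix_algebra_def)
    have ent: "continuous_on UNIV (\<lambda>T :: ('i, 'h) l2 \<Rightarrow>\<^sub>L ('i, 'h) l2. matrix_entry T i j)" for i j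
      by (rule linear_continuous_on [OF bounded_linear_matrix_entry])
    have "continuous_on UNIV (\<lambda>T :: ('i, 'h) l2 \<Rightarrow>\<^sub>L ('i, 'h) l2. op_of J (matrix_entry T))"
      unfolding op_of_def
      by (intro continuous_on_sum bounded_bilinear.continuous_on [OF bounded_bilinear_blinfun_compose]
          continuous_on_const ent)
    then show ?thesis
      unfolding eq
      by (intro closed_Int closed_INT ballI closed_Collect_eq closed_vimage A'(3) ent continuous_on_id)
  qed
next
  note A' = cstar_subalgebraD [OF A]
  note mem = op_of_in_matrix_algebra [OF J]
  fix S assume S: "S \<in> matrix_algebra J A"
  then obtain a where a: "S = op_of J a" "\<And>i j. i \<in> J \<Longrightarrow> j \<in> J \<Longrightarrow> a i j \<in> A"
    by (rule in_matrix_algebraE) (rule that)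
  have ab: "\<And>i j. i \<in> J \<Longrightarrow> j \<in> J \<Longrightarrow> a i j \<in> bops" using a A'(1) by blast
  show "S \<in> bops" unfolding a(1) by (rule op_of_bops [OF ab])
  have "adj S = op_of J (\<lambda>i j. adj (a j i))" unfolding a(1) by (rule adj_op_of [OF ab])
  then show "adj S \<in> matrix_algebra J A" using a A'(5) by (auto intro!: mem)
  fix T assume "T \<in> matrix_algebra J A"
  then obtain b where b: "T = op_of J b" "\<And>i j. i \<in> J \<Longrightarrow> j \<in> J \<Longrightarrow> b i j \<in> A"
    by (rule in_matrix_algebraE) (rule that)
  show "S o\<^sub>L T \<in> matrix_algebra J A"
    unfolding a(1) b(1) op_of_compose [OF J] using a(2) b(2)
    by (intro mem csubspace_sum A') auto
qed

text \<open>Entrywise application turns a representation of \<open>A\<close> into one of \<open>M\<^sub>J(A)\<close>. So positivity and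
  contractivity of representations hold at every matrix level.\<close>

lemma star_rep_matrix_algebra:
  fixes \<rho> :: "('h::chilbert_space \<Rightarrow>\<^sub>L 'h) \<Rightarrow> ('k::chilbert_space \<Rightarrow>\<^sub>L 'k)"
  assumes A: "cstar_subalgebra A" and \<rho>: "star_rep A \<rho>" and J: "finite (J :: 'i set)"
  shows "star_rep (matrix_algebra J A) (\<lambda>T. op_of J (\<lambda>i j. \<rho> (matrix_entry T i j)))"
proof -
  note A' = cstar_subalgebraD [OF A]
  have \<rho>_lin: "clinear_on A \<rho>" and \<rho>_bops: "\<And>a. a \<in> A \<Longrightarrow> \<rho> a \<in> bops"
    and \<rho>_mult: "\<And>a b. a \<in> A \<Longrightarrow> b \<in> A \<Longrightarrow> \<rho> (a o\<^sub>L b) = \<rho> a o\<^sub>L \<rho> b"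
    and \<rho>_adj: "\<And>a. a \<in> A \<Longrightarrow> \<rho> (adj a) = adj (\<rho> a)"
    using \<rho> by (auto simp: star_rep_def)
  have \<rho>_sum: "\<rho> (\<Sum>k\<in>K. f k) = (\<Sum>k\<in>K. \<rho> (f k))" if "\<And>k. k \<in> K \<Longrightarrow> f k \<in> A" for K :: "'i set" and f
    using that
  proof (induction K rule: infinite_finite_induct)
    case (insert k K)
    then show ?case by (simp add: clinear_onD(1) [OF \<rho>_lin] csubspace_sum [OF A'(2)])
  qed (use clinear_onD(2) [OF \<rho>_lin complex_vector.subspace_0 [OF A'(2)], of 0] in simp_all)
  define \<pi> where "\<pi> T = op_of J (\<lambda>i j. \<rho> (matrix_entry T i j))" for T :: "('i, 'h) l2 \<Rightarrow>\<^sub>L ('i, 'h) l2"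
  have \<pi>_op: "\<pi> (op_of J a) = op_of J (\<lambda>i j. \<rho> (a i j))" for a
    unfolding \<pi>_def by (rule op_of_cong) (simp add: matrix_entry_op_of [OF J])
  have "clinear_on (matrix_algebra J A) \<pi>"
    unfolding clinear_on_def
  proof (intro conjI ballI allI)
    fix S T assume "S \<in> matrix_algebra J A" "T \<in> matrix_algebra J A"
    then show "\<pi> (S + T) = \<pi> S + \<pi> T"
      by (elim in_matrix_algebraE)
        (auto simp: op_of_add \<pi>_op clinear_onD(1) [OF \<rho>_lin] intro!: op_of_cong)
  next
    fix c T assume "T \<in> matrix_algebra J A"
    then show "\<pi> (c *\<^sub>C T) = c *\<^sub>C \<pi> T"
      by (elim in_matrix_algebraE)
        (auto simp: op_of_scaleC \<pi>_op clinear_onD(2) [OF \<rho>_lin] intro!: op_of_cong)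
  qed
  moreover have "\<pi> T \<in> bops" if "T \<in> matrix_algebra J A" for T
    using that by (elim in_matrix_algebraE) (auto simp: \<pi>_op \<rho>_bops intro!: op_of_bops)
  moreover have "\<pi> (S o\<^sub>L T) = \<pi> S o\<^sub>L \<pi> T" if "S \<in> matrix_algebra J A" "T \<in> matrix_algebra J A" for S T
    using that
    by (elim in_matrix_algebraE)
      (auto simp: op_of_compose [OF J] \<pi>_op \<rho>_sum \<rho>_mult A'(4) intro!: op_of_cong)
  moreover have "\<pi> (adj T) = adj (\<pi> T)" if T: "T \<in> matrix_algebra J A" for T
  proof -
    obtain a where a: "T = op_of J a" "\<And>i j. i \<in> J \<Longrightarrow> j \<in> J \<Longrightarrow> a i j \<in> A"
      using T by (rule in_matrix_algebraE) (rule that)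
    have "adj (op_of J a) = op_of J (\<lambda>i j. adj (a j i))" using a(2) A'(1) by (intro adj_op_of) auto
    moreover have "adj (op_of J (\<lambda>i j. \<rho> (a i j))) = op_of J (\<lambda>i j. adj (\<rho> (a j i)))"
      using a(2) \<rho>_bops by (intro adj_op_of) auto
    ultimately show ?thesis using a(2) by (auto simp: a(1) \<pi>_op \<rho>_adj intro!: op_of_cong)
  qed
  ultimately show ?thesis unfolding star_rep_def \<pi>_def [symmetric] by blast
qed

lemma
  fixes \<rho> :: "('h::chilbert_space \<Rightarrow>\<^sub>L 'h) \<Rightarrow> ('k::chilbert_space \<Rightarrow>\<^sub>L 'k)"
  assumes A: "cstar_subalgebra A" and \<rho>: "star_rep A \<rho>" and J: "finite J"
    and a: "\<And>i j. i \<in> J \<Longrightarrow> j \<in> J \<Longrightarrow> a i j \<in> A"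
  shows star_rep_psd: "psd J a \<Longrightarrow> psd J (\<lambda>i j. \<rho> (a i j))"
    and star_rep_form_bound: "form_bound J a M \<Longrightarrow> 0 \<le> M \<Longrightarrow> form_bound J (\<lambda>i j. \<rho> (a i j)) M"
proof -
  note \<pi> = star_rep_matrix_algebra [OF A \<rho> J]
  note alg = cstar_subalgebra_matrix_algebra [OF A J]
  have mem: "op_of J a \<in> matrix_algebra J A" by (rule op_of_in_matrix_algebra [OF J a])
  have eq: "op_of J (\<lambda>i j. \<rho> (matrix_entry (op_of J a) i j)) = op_of J (\<lambda>i j. \<rho> (a i j))"
    by (rule op_of_cong) (simp add: matrix_entry_op_of [OF J])
  have ab: "\<And>i j. i \<in> J \<Longrightarrow> j \<in> J \<Longrightarrow> a i j \<in> bops" and \<rho>b: "\<And>i j. i \<in> J \<Longrightarrow> j \<in> J \<Longrightarrow> \<rho> (a i j) \<in> bops"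
    using a cstar_subalgebraD(1) [OF A] \<rho> by (auto simp: star_rep_def)
  show "psd J (\<lambda>i j. \<rho> (a i j))" if "psd J a"
    using star_rep_positive [OF alg \<pi> mem, where l = 0] that
    unfolding eq by (simp add: positive_op_of_iff [OF J ab] positive_op_of_iff [OF J \<rho>b])
  show "form_bound J (\<lambda>i j. \<rho> (a i j)) M" if "form_bound J a M" "0 \<le> M"
    using star_rep_norm_le [OF alg \<pi> mem] that
    unfolding eq norm_op_of_le_iff [OF J that(2), symmetric] by simp
qed

section \<open>Operators with a given matrix, and Hilbert--Schmidt kernels\<close>

lemma matrix_form_matrix_entry:
  "matrix_form F (matrix_entry T) \<xi> \<eta> = cinner (blinfun_apply T (finite_vec F \<xi>)) (finite_vec F \<eta>)"
proof -
  have "cinner (blinfun_apply T (finite_vec F \<xi>)) (finite_vec F \<eta>)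
      = (\<Sum>i\<in>F. cinner (\<Sum>j\<in>F. blinfun_apply (matrix_entry T i j) (\<xi> j)) (\<eta> i))"
    by (simp add: finite_vec_def cinner.sum_right cinner_coord [symmetric] matrix_entry_apply blinfun.sum_right)
  then show ?thesis by (simp add: matrix_form_def cinner.sum_left)
qed

lemma form_bound_matrix_entry:
  assumes "finite F" "norm T \<le> M"
  shows "form_bound F (matrix_entry T) M"
  unfolding form_bound_def matrix_form_matrix_entry
proof (intro allI)
  fix \<xi> \<eta>
  have "cmod (cinner (blinfun_apply T (finite_vec F \<xi>)) (finite_vec F \<eta>))
      \<le> norm (blinfun_apply T (finite_vec F \<xi>)) * norm (finite_vec F \<eta>)" by (rule norm_cinner_le)
  also have "\<dots> \<le> (M * norm (finite_vec F \<xi>)) * norm (finite_vec F \<eta>)"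
    using order_trans [OF norm_blinfun mult_right_mono [OF assms(2) norm_ge_zero]]
    by (intro mult_right_mono) auto
  finally show "cmod (cinner (blinfun_apply T (finite_vec F \<xi>)) (finite_vec F \<eta>))
      \<le> M * L2_set (\<lambda>j. norm (\<xi> j)) F * L2_set (\<lambda>i. norm (\<eta> i)) F"
    by (simp add: norm_finite_vec assms(1))
qed

lemma norm_l2_le:
  assumes "\<And>F. finite F \<Longrightarrow> L2_set (\<lambda>x. norm (blinfun_apply (coord x) \<xi>)) F \<le> B"
  shows "norm \<xi> \<le> B"
proof (rule tendsto_upperbound)
  show "((\<lambda>F. norm (finite_vec F (\<lambda>x. blinfun_apply (coord x) \<xi>))) \<longlongrightarrow> norm \<xi>) (finite_subsets_at_top UNIV)"
    by (intro tendsto_norm finite_vec_coord_tendsto)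
  show "\<forall>\<^sub>F F in finite_subsets_at_top UNIV. norm (finite_vec F (\<lambda>x. blinfun_apply (coord x) \<xi>)) \<le> B"
    by (rule eventually_finite_subsets_at_top_weakI) (simp add: norm_finite_vec assms)
qed simp

lemma coord_op_of:
  assumes "finite F" "x \<in> F"
  shows "blinfun_apply (coord x) (blinfun_apply (op_of F s) \<xi>)
    = (\<Sum>y\<in>F. blinfun_apply (s x y) (blinfun_apply (coord y) \<xi>))"
proof -
  have "blinfun_apply (coord x) (blinfun_apply (op_of F s) \<xi>)
    = (\<Sum>i\<in>F. if i = x then (\<Sum>j\<in>F. blinfun_apply (s i j) (blinfun_apply (coord j) \<xi>)) else 0)"
    unfolding op_of_apply blinfun.sum_right coord_emb by (intro sum.cong refl) auto
  then show ?thesis using assms by (simp add: sum.delta)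
qed

text \<open>The columns \<open>y, h \<mapsto> (s\<^sub>x\<^sub>y h)\<^sub>x\<close> are square summable and depend boundedly on \<open>\<delta>\<^sub>y h\<close>.\<close>

lemma op_from_matrix:
  fixes s :: "'x \<Rightarrow> 'x \<Rightarrow> ('h::chilbert_space \<Rightarrow>\<^sub>L 'h)"
  assumes s: "\<And>x y. s x y \<in> bops" and M: "0 \<le> M" and fb: "\<And>F. finite F \<Longrightarrow> form_bound F s M"
  shows "\<exists>S\<in>bops. (\<forall>x y. matrix_entry S x y = s x y) \<and> norm S \<le> M"
proof -
  have opM: "norm (op_of F s) \<le> M" if "finite F" for F
    using fb [OF that] norm_op_of_le_iff [OF that M] by blast
  have fin: "L2_set (\<lambda>x. norm (\<Sum>y\<in>G. blinfun_apply (s x y) (blinfun_apply (coord y) z))) F \<le> M * norm z"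
    if FG: "finite F" "finite G" and z: "\<And>y. y \<notin> G \<Longrightarrow> blinfun_apply (coord y) z = 0" for F G z
  proof -
    define F' where "F' = F \<union> G"
    have F': "finite F'" using FG by (simp add: F'_def)
    have c: "(\<Sum>y\<in>G. blinfun_apply (s x y) (blinfun_apply (coord y) z))
        = blinfun_apply (coord x) (blinfun_apply (op_of F' s) z)" if "x \<in> F'" for x
      unfolding coord_op_of [OF F' that] using F'
      by (intro sum.mono_neutral_left) (auto simp: F'_def z blinfun.zero_right)
    have "L2_set (\<lambda>x. norm (\<Sum>y\<in>G. blinfun_apply (s x y) (blinfun_apply (coord y) z))) F
        \<le> L2_set (\<lambda>x. norm (\<Sum>y\<in>G. blinfun_apply (s x y) (blinfun_apply (coord y) z))) F'"
      unfolding L2_set_def using F' by (intro real_sqrt_le_mono sum_mono2) (auto simp: F'_def)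
    also have "\<dots> = L2_set (\<lambda>x. norm (blinfun_apply (coord x) (blinfun_apply (op_of F' s) z))) F'"
      by (intro L2_set_cong) (simp_all add: c)
    also have "\<dots> \<le> norm (blinfun_apply (op_of F' s) z)" by (rule L2_set_coord_le)
    also have "\<dots> \<le> M * norm z"
      using order_trans [OF norm_blinfun mult_right_mono [OF opM [OF F'] norm_ge_zero]] .
    finally show ?thesis .
  qed
  have "(\<lambda>x. (norm (blinfun_apply (s x y) h))\<^sup>2) summable_on UNIV" for y h
  proof (rule nonneg_bdd_above_summable_on)
    show "bdd_above (sum (\<lambda>x. (norm (blinfun_apply (s x y) h))\<^sup>2) ` {F. F \<subseteq> UNIV \<and> finite F})"
    proof (rule bdd_aboveI, clarify)
      fix F :: "'x set" assume F: "finite F"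
      have "L2_set (\<lambda>x. norm (blinfun_apply (s x y) h)) F \<le> M * norm h"
        using fin [OF F, of "{y}" "blinfun_apply (emb y) h"] by (simp add: coord_emb norm_emb)
      then have "(L2_set (\<lambda>x. norm (blinfun_apply (s x y) h)) F)\<^sup>2 \<le> (M * norm h)\<^sup>2"
        by (intro power_mono) auto
      then show "(\<Sum>x\<in>F. (norm (blinfun_apply (s x y) h))\<^sup>2) \<le> (M * norm h)\<^sup>2"
        by (simp add: L2_set_def sum_nonneg)
    qed
  qed simp
  then have col: "Rep_l2 (Abs_l2 (\<lambda>x. blinfun_apply (s x y) h)) = (\<lambda>x. blinfun_apply (s x y) h)" for y h
    by (intro Abs_l2_inverse) simp
  define u where "u p = blinfun_apply (emb (fst p)) (snd p)" for p :: "'x \<times> 'h"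
  define w where "w p = Abs_l2 (\<lambda>x. blinfun_apply (s x (fst p)) (snd p))" for p
  have coord_w: "blinfun_apply (coord x) (w p) = blinfun_apply (s x (fst p)) (snd p)" for x p
    by (simp add: w_def coord_apply col)
  have *: "norm (\<Sum>p\<in>J. c p *\<^sub>C w p) \<le> M * norm (\<Sum>p\<in>J. c p *\<^sub>C u p)"
    if J: "finite J" "J \<subseteq> UNIV" for J c
  proof (rule norm_l2_le)
    fix F :: "'x set" assume F: "finite F"
    define z where "z = (\<Sum>p\<in>J. c p *\<^sub>C u p)"
    have cz: "blinfun_apply (coord y) z = (\<Sum>p\<in>J. c p *\<^sub>C (if y = fst p then snd p else 0))" for y
      by (simp add: z_def u_def blinfun.sum_right bops_apply_scaleC [OF coord_bops] coord_emb)
    have "blinfun_apply (coord x) (\<Sum>p\<in>J. c p *\<^sub>C w p)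
        = (\<Sum>y\<in>fst ` J. blinfun_apply (s x y) (blinfun_apply (coord y) z))" for x
    proof -
      have "(\<Sum>y\<in>fst ` J. blinfun_apply (s x y) (blinfun_apply (coord y) z))
          = (\<Sum>p\<in>J. \<Sum>y\<in>fst ` J. if y = fst p then c p *\<^sub>C blinfun_apply (s x y) (snd p) else 0)"
        unfolding cz blinfun.sum_right
        by (subst sum.swap, intro sum.cong refl)
          (auto simp: bops_apply_scaleC [OF s] blinfun.zero_right)
      also have "\<dots> = (\<Sum>p\<in>J. c p *\<^sub>C blinfun_apply (s x (fst p)) (snd p))"
        using J by (intro sum.cong refl) (simp add: sum.delta)
      finally show ?thesis
        by (simp add: blinfun.sum_right bops_apply_scaleC [OF coord_bops] coord_w)
    qed
    moreover have "blinfun_apply (coord y) z = 0" if "y \<notin> fst ` J" for y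
      unfolding cz using that by (intro sum.neutral) auto
    ultimately show "L2_set (\<lambda>x. norm (blinfun_apply (coord x) (\<Sum>p\<in>J. c p *\<^sub>C w p))) F
        \<le> M * norm (\<Sum>p\<in>J. c p *\<^sub>C u p)"
      using fin [OF F, of "fst ` J" z] J by (simp add: z_def)
  qed
  obtain S where S: "S \<in> bops" "\<And>p. blinfun_apply S (u p) = w p" "norm S \<le> M"
    by (rule bounded_family_extension [of M UNIV w u]) (rule M, erule (1) *, (rule that; simp))
  have "matrix_entry S x y = s x y" for x y
  proof (rule blinfun_eqI)
    show "blinfun_apply (matrix_entry S x y) h = blinfun_apply (s x y) h" for h
      using S(2) [of "(y, h)"] coord_w [of x "(y, h)"] by (simp add: matrix_entry_apply u_def)
  qed
  with S show ?thesis by blast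
qed

lemma norm_le_if_form_bounds:
  assumes "T \<in> bops" "0 \<le> M" "\<And>F. finite F \<Longrightarrow> form_bound F (matrix_entry T) M"
  shows "norm T \<le> M"
proof -
  obtain S where S: "\<And>x y. matrix_entry S x y = matrix_entry T x y" "norm S \<le> M"
    using op_from_matrix [of "matrix_entry T" M] matrix_entry_bops assms by metis
  have "S = T" by (rule blinfun_eq_if_matrix_entry_eq [OF S(1)])
  with S(2) show ?thesis by simp
qed

text \<open>The series that defines \<open>kernel_op\<close> converges to the coordinates of \<open>S \<xi>\<close>, because the truncations
  of \<open>\<xi>\<close> converge to \<open>\<xi>\<close>. In particular an operator is recovered from its matrix.\<close>

lemma kernel_op_eq:
  fixes S :: "('x, 'h::chilbert_space) l2 \<Rightarrow>\<^sub>L ('x, 'h) l2"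
  assumes "\<And>x y. matrix_entry S x y = k x y"
  shows "kernel_op k = S"
proof -
  have "Abs_l2 (\<lambda>x. \<Sum>\<^sub>\<infinity>y. blinfun_apply (k x y) (Rep_l2 \<xi> y)) = blinfun_apply S \<xi>" for \<xi>
  proof -
    have "(\<Sum>\<^sub>\<infinity>y. blinfun_apply (k x y) (Rep_l2 \<xi> y)) = Rep_l2 (blinfun_apply S \<xi>) x" for x
    proof (rule infsumI)
      have "blinfun_apply (coord x) (blinfun_apply S (finite_vec F (\<lambda>x. blinfun_apply (coord x) \<xi>)))
          = (\<Sum>y\<in>F. blinfun_apply (k x y) (Rep_l2 \<xi> y))" for F
        unfolding finite_vec_def blinfun.sum_right matrix_entry_apply [symmetric] assms
        unfolding coord_apply ..
      moreover have "((\<lambda>F. blinfun_apply (coord x) (blinfun_apply S (finite_vec F (\<lambda>x. blinfun_apply (coord x) \<xi>))))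
          \<longlongrightarrow> blinfun_apply (coord x) (blinfun_apply S \<xi>)) (finite_subsets_at_top UNIV)"
        by (intro tendsto_intros finite_vec_coord_tendsto)
      ultimately show "((\<lambda>y. blinfun_apply (k x y) (Rep_l2 \<xi> y)) has_sum Rep_l2 (blinfun_apply S \<xi>) x) UNIV"
        by (simp add: has_sum_def coord_apply [of x])
    qed
    then show ?thesis by (simp add: Rep_l2_inverse)
  qed
  then show ?thesis by (simp add: kernel_op_def blinfun_apply_inverse)
qed

text \<open>The Cauchy--Schwarz inequality over \<open>F \<times> F\<close>: the Hilbert--Schmidt norm dominates the operator norm.\<close>

lemma hs_form_bound:
  fixes k :: "'i \<Rightarrow> 'i \<Rightarrow> ('h::chilbert_space \<Rightarrow>\<^sub>L 'h)"
  assumes F: "finite F" and M: "(\<Sum>x\<in>F. \<Sum>y\<in>F. (norm (k x y))\<^sup>2) \<le> M\<^sup>2" "0 \<le> M"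
  shows "form_bound F k M"
  unfolding form_bound_def
proof (intro allI)
  fix \<xi> \<eta> :: "'i \<Rightarrow> 'h"
  let ?x = "\<lambda>j. norm (\<xi> j)" and ?y = "\<lambda>i. norm (\<eta> i)"
  have "cmod (matrix_form F k \<xi> \<eta>) \<le> (\<Sum>i\<in>F. \<Sum>j\<in>F. norm (k i j) * (?x j * ?y i))"
    unfolding matrix_form_def
  proof (intro order_trans [OF norm_sum] sum_mono)
    fix i j
    have "cmod (cinner (blinfun_apply (k i j) (\<xi> j)) (\<eta> i)) \<le> norm (blinfun_apply (k i j) (\<xi> j)) * ?y i"
      by (rule norm_cinner_le)
    also have "\<dots> \<le> norm (k i j) * ?x j * ?y i" by (intro mult_right_mono norm_blinfun) simp
    finally show "cmod (cinner (blinfun_apply (k i j) (\<xi> j)) (\<eta> i)) \<le> norm (k i j) * (?x j * ?y i)"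
      by (simp add: mult_ac)
  qed
  also have "\<dots> = (\<Sum>p\<in>F \<times> F. \<bar>norm (k (fst p) (snd p))\<bar> * \<bar>?x (snd p) * ?y (fst p)\<bar>)"
    by (simp add: sum.cartesian_product case_prod_beta' abs_mult)
  also have "\<dots> \<le> L2_set (\<lambda>p. norm (k (fst p) (snd p))) (F \<times> F) * L2_set (\<lambda>p. ?x (snd p) * ?y (fst p)) (F \<times> F)"
    by (rule L2_set_mult_ineq)
  also have "\<dots> \<le> M * (L2_set ?x F * L2_set ?y F)"
  proof (intro mult_mono)
    show "L2_set (\<lambda>p. norm (k (fst p) (snd p))) (F \<times> F) \<le> M"
      unfolding L2_set_def using M by (intro real_le_lsqrt)
        (simp_all add: sum.cartesian_product case_prod_beta' sum_nonneg)
    have "(\<Sum>p\<in>F \<times> F. (?x (snd p) * ?y (fst p))\<^sup>2) = (\<Sum>i\<in>F. (?y i)\<^sup>2) * (\<Sum>j\<in>F. (?x j)\<^sup>2)"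
      by (simp add: sum_product sum.cartesian_product case_prod_beta' power_mult_distrib mult.commute)
    then show "L2_set (\<lambda>p. ?x (snd p) * ?y (fst p)) (F \<times> F) \<le> L2_set ?x F * L2_set ?y F"
      by (simp add: L2_set_def real_sqrt_mult mult.commute)
  qed (use M in auto)
  finally show "cmod (matrix_form F k \<xi> \<eta>) \<le> M * L2_set ?x F * L2_set ?y F" by (simp add: mult.assoc)
qed

lemma l2_kernels_sum_le:
  assumes "k \<in> l2_kernels A" "finite P"
  shows "(\<Sum>p\<in>P. (norm (k (fst p) (snd p)))\<^sup>2) \<le> (\<Sum>\<^sub>\<infinity>p. (norm (k (fst p) (snd p)))\<^sup>2)"
  using assms by (intro finite_sum_le_infsum) (auto simp: l2_kernels_def case_prod_beta')

lemma kernel_op_l2_kernels: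
  fixes k :: "'x \<Rightarrow> 'x \<Rightarrow> ('h::chilbert_space \<Rightarrow>\<^sub>L 'h)"
  assumes k: "k \<in> l2_kernels A" and A: "A \<subseteq> bops"
  shows "kernel_op k \<in> bops" "matrix_entry (kernel_op k) = k"
proof -
  define M where "M = sqrt (\<Sum>\<^sub>\<infinity>p. (norm (k (fst p) (snd p)))\<^sup>2)"
  have M: "0 \<le> M" "M\<^sup>2 = (\<Sum>\<^sub>\<infinity>p. (norm (k (fst p) (snd p)))\<^sup>2)"
    by (simp_all add: M_def infsum_nonneg)
  have fb: "form_bound F k M" if "finite F" for F
    using l2_kernels_sum_le [OF k, of "F \<times> F"] that M
    by (intro hs_form_bound) (simp_all add: sum.cartesian_product case_prod_beta')
  have "k x y \<in> bops" for x y using k A by (auto simp: l2_kernels_def)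
  then obtain S where S: "S \<in> bops" "\<And>x y. matrix_entry S x y = k x y"
    using op_from_matrix [of k M] M(1) fb by metis
  have "kernel_op k = S" by (rule kernel_op_eq [OF S(2)])
  with S show "kernel_op k \<in> bops" "matrix_entry (kernel_op k) = k" by (auto simp: fun_eq_iff)
qed

lemma hs_ops_iff:
  assumes "A \<subseteq> bops"
  shows "T \<in> hs_ops A \<longleftrightarrow> T \<in> bops \<and> matrix_entry T \<in> l2_kernels A"
proof
  assume "T \<in> hs_ops A"
  then obtain k where k: "k \<in> l2_kernels A" "T = kernel_op k" by (auto simp: hs_ops_def)
  then show "T \<in> bops \<and> matrix_entry T \<in> l2_kernels A"
    using kernel_op_l2_kernels [OF k(1) assms] by simp
next
  assume T: "T \<in> bops \<and> matrix_entry T \<in> l2_kernels A"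
  have "kernel_op (matrix_entry T) = T" by (rule kernel_op_eq) simp
  with T show "T \<in> hs_ops A" by (metis hs_ops_def imageI)
qed

text \<open>The kernel chosen by \<open>inv_into\<close> is the matrix of \<open>T\<close>, as matrix entries determine kernels.\<close>

lemma schur_map_hs_eq:
  assumes A: "A \<subseteq> bops" and T: "T \<in> hs_ops A"
  shows "schur_map_hs A \<phi> T = kernel_op (\<lambda>x y. \<phi> x y (matrix_entry T x y))"
proof -
  define k where "k = inv_into (l2_kernels A) kernel_op T"
  have k: "k \<in> l2_kernels A" "kernel_op k = T"
    using inv_into_into f_inv_into_f T unfolding k_def hs_ops_def by metis+
  then have "matrix_entry T = k" using kernel_op_l2_kernels [OF k(1) A] by simp
  then show ?thesis by (simp add: schur_map_hs_def k_def Let_def)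
qed

lemma csubspace_hs_ops:
  assumes A: "A \<subseteq> bops" "csubspace A"
  shows "csubspace (hs_ops A :: (('x, 'h::chilbert_space) l2 \<Rightarrow>\<^sub>L ('x, 'h) l2) set)"
proof (rule complex_vector.subspaceI)
  have ent: "matrix_entry (0 :: ('x, 'h) l2 \<Rightarrow>\<^sub>L ('x, 'h) l2) x y = 0" for x y
    by (rule blinfun_eqI) (simp add: matrix_entry_apply)
  show "0 \<in> (hs_ops A :: (('x, 'h) l2 \<Rightarrow>\<^sub>L ('x, 'h) l2) set)"
    unfolding hs_ops_iff [OF A(1)] l2_kernels_def
    by (simp add: ent complex_vector.subspace_0 A csubspace_bops case_prod_beta')
next
  fix S T :: "('x, 'h) l2 \<Rightarrow>\<^sub>L ('x, 'h) l2" assume "S \<in> hs_ops A" "T \<in> hs_ops A"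
  then show "S + T \<in> hs_ops A"
    unfolding hs_ops_iff [OF A(1)] l2_kernels_def
    by (simp add: matrix_entry_add complex_vector.subspace_add A csubspace_bops case_prod_beta'
        square_summable_add)
next
  fix c and T :: "('x, 'h) l2 \<Rightarrow>\<^sub>L ('x, 'h) l2" assume "T \<in> hs_ops A"
  then show "c *\<^sub>C T \<in> hs_ops A"
    unfolding hs_ops_iff [OF A(1)] l2_kernels_def
    by (simp add: matrix_entry_scaleC complex_vector.subspace_scale A csubspace_bops case_prod_beta'
        square_summable_scale)
qed

lemma op_of_hs_ops:
  fixes a :: "'x \<Rightarrow> 'x \<Rightarrow> ('h::chilbert_space \<Rightarrow>\<^sub>L 'h)"
  assumes A: "A \<subseteq> bops" "csubspace A" and F: "finite F" and a: "\<And>x y. x \<in> F \<Longrightarrow> y \<in> F \<Longrightarrow> a x y \<in> A"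
  shows "op_of F a \<in> hs_ops A"
  unfolding hs_ops_iff [OF A(1)] l2_kernels_def
proof (intro conjI CollectI allI)
  show "op_of F a \<in> bops" using a A by (intro op_of_bops) auto
  show "matrix_entry (op_of F a) x y \<in> A" for x y
    using a complex_vector.subspace_0 [OF A(2)] by (simp add: matrix_entry_op_of F)
  have "{p. (case p of (x, y) \<Rightarrow> (norm (matrix_entry (op_of F a) x y))\<^sup>2) \<noteq> 0} \<subseteq> F \<times> F"
    by (auto simp: matrix_entry_op_of F split: if_splits)
  then show "(\<lambda>(x, y). (norm (matrix_entry (op_of F a) x y))\<^sup>2) summable_on UNIV"
    using F by (intro finite_nonzero_values_imp_summable_on) (auto intro: finite_subset)
qed

text \<open>The difference has a kernel supported off \<open>F \<times> F\<close>, whose Hilbert--Schmidt norm is a small tail.\<close>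

lemma hs_ops_finite_approximation:
  fixes T :: "('x, 'h::chilbert_space) l2 \<Rightarrow>\<^sub>L ('x, 'h) l2"
  assumes A: "A \<subseteq> bops" and T: "T \<in> hs_ops A" and \<epsilon>: "0 < \<epsilon>"
  obtains F where "finite F" "norm (T - op_of F (matrix_entry T)) \<le> \<epsilon>"
proof -
  let ?k = "\<lambda>p. (norm (matrix_entry T (fst p) (snd p)))\<^sup>2"
  have T': "T \<in> bops" "matrix_entry T \<in> l2_kernels A" using T hs_ops_iff [OF A] by auto
  have "?k summable_on UNIV" using T'(2) by (simp add: l2_kernels_def case_prod_beta')
  then have "(?k has_sum infsum ?k UNIV) UNIV" by simp
  then obtain P where P: "finite P" "dist (sum ?k P) (infsum ?k UNIV) \<le> \<epsilon>\<^sup>2"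
    using has_sum_finite_approximation [of ?k UNIV "infsum ?k UNIV" "\<epsilon>\<^sup>2"] \<epsilon> by auto
  define F where "F = fst ` P \<union> snd ` P"
  have F: "finite F" "P \<subseteq> F \<times> F" using P(1) by (force simp: F_def)+
  define D where "D = T - op_of F (matrix_entry T)"
  have D: "matrix_entry D x y = (if x \<in> F \<and> y \<in> F then 0 else matrix_entry T x y)" for x y
  proof -
    have "matrix_entry D x y = matrix_entry T x y - matrix_entry (op_of F (matrix_entry T)) x y"
      by (rule blinfun_eqI) (simp add: D_def matrix_entry_apply blinfun.bilinear_simps)
    then show ?thesis by (simp add: matrix_entry_op_of F)
  qed
  have "norm D \<le> \<epsilon>"
  proof (rule norm_le_if_form_bounds)
    show "D \<in> bops" unfolding D_def
      by (intro csubspace_diff csubspace_bops T' op_of_bops matrix_entry_bops)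
    fix G :: "'x set" assume G: "finite G"
    show "form_bound G (matrix_entry D) \<epsilon>"
    proof (rule hs_form_bound [OF G])
      have "(\<Sum>x\<in>G. \<Sum>y\<in>G. (norm (matrix_entry D x y))\<^sup>2)
          = (\<Sum>p\<in>G \<times> G. (norm (matrix_entry D (fst p) (snd p)))\<^sup>2)"
        by (simp add: sum.cartesian_product case_prod_beta')
      also have "\<dots> = sum ?k (G \<times> G - F \<times> F)"
        using G by (intro sum.mono_neutral_cong_right) (auto simp: D)
      also have "\<dots> = sum ?k (G \<times> G \<union> F \<times> F) - sum ?k (F \<times> F)"
        using G F by (simp add: sum_diff [symmetric] Un_Diff)
      also have "\<dots> \<le> infsum ?k UNIV - sum ?k P"
        using l2_kernels_sum_le [OF T'(2), of "G \<times> G \<union> F \<times> F"] G F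
        by (intro diff_mono sum_mono2) auto
      also have "\<dots> \<le> \<epsilon>\<^sup>2" using P(2) by (simp add: dist_real_def abs_le_iff)
      finally show "(\<Sum>x\<in>G. \<Sum>y\<in>G. (norm (matrix_entry D x y))\<^sup>2) \<le> \<epsilon>\<^sup>2" .
    qed (use \<epsilon> in simp)
  qed (use \<epsilon> in simp)
  then show ?thesis using that F(1) by (simp add: D_def)
qed

section \<open>Spatial tensor products\<close>

lemma cstar_subalgebra_bops: "cstar_subalgebra (bops :: ('h::chilbert_space \<Rightarrow>\<^sub>L 'h) set)"
  by (simp add: cstar_subalgebra_def csubspace_bops closed_bops bops_compose adj_bops)

text \<open>Scalar matrices act on \<open>\<ell>\<^sup>2(X, H)\<close> with the norm they have on \<open>\<ell>\<^sup>2(X)\<close>, since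
  \<open>c \<mapsto> c 1\<close> is a representation of the algebra of scalars.\<close>

lemma form_bound_scalar_amplification:
  fixes t :: "'i \<Rightarrow> 'i \<Rightarrow> (complex \<Rightarrow>\<^sub>L complex)" and a :: "'h::chilbert_space \<Rightarrow>\<^sub>L 'h"
  assumes F: "finite F" and t: "\<And>i j. i \<in> F \<Longrightarrow> j \<in> F \<Longrightarrow> t i j \<in> bops" and M: "form_bound F t M" "0 \<le> M"
  shows "form_bound F (\<lambda>i j. blinfun_apply (t i j) 1 *\<^sub>C a) (M * norm a)"
proof -
  define \<rho> where "\<rho> c = blinfun_apply c 1 *\<^sub>C (id_blinfun :: 'h \<Rightarrow>\<^sub>L 'h)" for c :: "complex \<Rightarrow>\<^sub>L complex"
  have lin: "blinfun_apply c z = z * blinfun_apply c 1" if "c \<in> bops" for c :: "complex \<Rightarrow>\<^sub>L complex" and z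
    using bops_apply_scaleC [OF that, of z 1] by (simp add: scaleC_complex_def)
  have "star_rep bops \<rho>"
    unfolding star_rep_def clinear_on_def
  proof (intro conjI ballI allI subsetI)
    fix c d :: "complex \<Rightarrow>\<^sub>L complex" and z :: complex assume c: "c \<in> bops" and d: "d \<in> bops"
    show "\<rho> (c + d) = \<rho> c + \<rho> d" by (simp add: \<rho>_def blinfun.add_left scaleC_add_left)
    show "\<rho> (z *\<^sub>C c) = z *\<^sub>C \<rho> c" by (simp add: \<rho>_def scaleC_complex_def scaleC_scaleC)
    show "\<rho> (c o\<^sub>L d) = \<rho> c o\<^sub>L \<rho> d"
      by (rule blinfun_eqI)
        (simp add: \<rho>_def lin [OF c, of "blinfun_apply d 1"] scaleC_scaleC mult.commute)
    have "blinfun_apply (adj c) 1 = cnj (blinfun_apply c 1)"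
      using cinner_adj [OF c, of 1 1] by (simp add: cinner_complex_def)
    then show "\<rho> (adj c) = adj (\<rho> c)"
      using adj_eqI [of "id_blinfun :: 'h \<Rightarrow>\<^sub>L 'h" id_blinfun]
      by (simp add: \<rho>_def adj_scaleC id_bops)
  next
    fix T assume "T \<in> \<rho> ` bops"
    then show "T \<in> bops" by (auto simp: \<rho>_def complex_vector.subspace_scale [OF csubspace_bops id_bops])
  qed
  from star_rep_form_bound [OF cstar_subalgebra_bops this F t M]
  have fb: "form_bound F (\<lambda>i j. \<rho> (t i j)) M" .
  show ?thesis
    unfolding form_bound_def
  proof (intro allI)
    fix \<xi> \<eta> :: "'i \<Rightarrow> 'h"
    have "cmod (matrix_form F (\<lambda>i j. blinfun_apply (t i j) 1 *\<^sub>C a) \<xi> \<eta>)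
        = cmod (matrix_form F (\<lambda>i j. \<rho> (t i j)) (\<lambda>j. blinfun_apply a (\<xi> j)) \<eta>)"
      by (simp add: matrix_form_def \<rho>_def)
    also have "\<dots> \<le> M * L2_set (\<lambda>j. norm (blinfun_apply a (\<xi> j))) F * L2_set (\<lambda>i. norm (\<eta> i)) F"
      using fb unfolding form_bound_def by blast
    also have "\<dots> \<le> M * L2_set (\<lambda>j. norm a * norm (\<xi> j)) F * L2_set (\<lambda>i. norm (\<eta> i)) F"
      using M(2) by (intro mult_right_mono mult_left_mono L2_set_mono norm_blinfun) auto
    also have "\<dots> = M * norm a * L2_set (\<lambda>j. norm (\<xi> j)) F * L2_set (\<lambda>i. norm (\<eta> i)) F"
      by (simp add: L2_set_right_distrib [symmetric])
    finally show "cmod (matrix_form F (\<lambda>i j. blinfun_apply (t i j) 1 *\<^sub>C a) \<xi> \<eta>)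
        \<le> M * norm a * L2_set (\<lambda>j. norm (\<xi> j)) F * L2_set (\<lambda>i. norm (\<eta> i)) F" .
  qed
qed

lemma emb_tensor_vec: "blinfun_apply (emb y) h = tensor_vec (blinfun_apply (emb y) 1) h"
  unfolding emb_apply by transfer (auto simp: scaleC_one)

lemma coord_tensor_vec: "blinfun_apply (coord x) (tensor_vec f h) = blinfun_apply (coord x) f *\<^sub>C h"
  by (simp add: coord_apply tensor_vec.rep_eq)

lemma matrix_entry_tensor:
  assumes "\<And>f h. blinfun_apply S (tensor_vec f h) = tensor_vec (blinfun_apply T f) (blinfun_apply a h)"
  shows "matrix_entry S x y = blinfun_apply (matrix_entry T x y) 1 *\<^sub>C a"
  by (rule blinfun_eqI)
    (simp add: matrix_entry_apply emb_tensor_vec [of y "_ :: 'b"] assms coord_tensor_vec)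

lemma matrix_entry_diff: "matrix_entry (S - T) x y = matrix_entry S x y - matrix_entry T x y"
  by (rule blinfun_eqI) (simp add: matrix_entry_apply blinfun.bilinear_simps)

text \<open>The operators with entries in \<open>A\<close> form a closed subspace containing the elementary tensors.\<close>

lemma min_tensor_entries:
  fixes A :: "('h::chilbert_space \<Rightarrow>\<^sub>L 'h) set" and T :: "('x, 'h) l2 \<Rightarrow>\<^sub>L ('x, 'h) l2"
  assumes A: "csubspace A" "closed A" and T: "T \<in> min_tensor B A"
  shows "T \<in> bops" "matrix_entry T x y \<in> A"
proof -
  define D where "D = {T :: ('x, 'h) l2 \<Rightarrow>\<^sub>L ('x, 'h) l2. T \<in> bops \<and> (\<forall>x y. matrix_entry T x y \<in> A)}"
  have "csubspace D"
    unfolding D_def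
  proof (rule complex_vector.subspaceI; safe)
    fix x y :: 'x
    have "matrix_entry (0 :: ('x, 'h) l2 \<Rightarrow>\<^sub>L ('x, 'h) l2) x y = 0"
      by (rule blinfun_eqI) (simp add: matrix_entry_apply)
    then show "matrix_entry (0 :: ('x, 'h) l2 \<Rightarrow>\<^sub>L ('x, 'h) l2) x y \<in> A"
      by (simp add: complex_vector.subspace_0 A)
  qed (simp_all add: matrix_entry_add matrix_entry_scaleC complex_vector.subspace_0
      complex_vector.subspace_add complex_vector.subspace_scale A csubspace_bops)
  moreover have "closed D"
  proof -
    have "D = bops \<inter> (\<Inter>x. \<Inter>y. (\<lambda>T. matrix_entry T x y) -` A)" by (auto simp: D_def)
    then show ?thesis
      using closed_bops A(2)
      by (auto intro!: closed_Int closed_INT closed_vimage linear_continuous_on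
          bounded_linear_matrix_entry)
  qed
  moreover have "elementary_tensors B A \<subseteq> D"
    using complex_vector.subspace_scale [OF A(1)]
    by (auto simp: D_def elementary_tensors_def matrix_entry_tensor)
  ultimately have "min_tensor B A \<subseteq> D"
    unfolding min_tensor_def by (intro closure_minimal complex_vector.span_minimal)
  with T show "T \<in> bops" "matrix_entry T x y \<in> A" by (auto simp: D_def)
qed

lemma csubspace_min_tensor: "csubspace (min_tensor B A)"
  unfolding min_tensor_def by (intro csubspace_closure complex_vector.subspace_span)

lemma elementary_op:
  fixes a :: "'h::chilbert_space \<Rightarrow>\<^sub>L 'h" and x y :: 'x
  assumes a: "a \<in> bops" "a \<in> A" and B: "emb x o\<^sub>L coord y \<in> B"
  shows "emb x o\<^sub>L a o\<^sub>L coord y \<in> elementary_tensors B A"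
  unfolding elementary_tensors_def
proof (intro CollectI conjI bexI allI)
  show "emb x o\<^sub>L a o\<^sub>L coord y \<in> bops" by (intro bops_compose emb_bops coord_bops a)
  show "blinfun_apply (emb x o\<^sub>L a o\<^sub>L coord y) (tensor_vec f h)
      = tensor_vec (blinfun_apply (emb x o\<^sub>L coord y) f) (blinfun_apply a h)" for f h
    by (rule l2_eqI) (simp add: coord_tensor_vec coord_emb bops_apply_scaleC [OF a(1)])
qed (use a B in auto)

lemma op_of_in_span_elementary:
  assumes "A \<subseteq> bops" "\<And>x y. x \<in> F \<Longrightarrow> y \<in> F \<Longrightarrow> a x y \<in> A"
    "\<And>x y. x \<in> F \<Longrightarrow> y \<in> F \<Longrightarrow> emb x o\<^sub>L coord y \<in> B"
  shows "op_of F a \<in> cspan (elementary_tensors B A)"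
  unfolding op_of_def using assms
  by (intro complex_vector.span_sum complex_vector.span_base elementary_op) auto

lemma matrix_unit_compact: "emb x o\<^sub>L coord y \<in> (compact_ops :: (('x, complex) l2 \<Rightarrow>\<^sub>L ('x, complex) l2) set)"
proof -
  let ?T = "emb x o\<^sub>L coord y :: ('x, complex) l2 \<Rightarrow>\<^sub>L ('x, complex) l2"
  have "compact (blinfun_apply (emb x) ` cball (0::complex) 1)"
    by (intro compact_continuous_image continuous_intros compact_cball)
  moreover have "blinfun_apply ?T ` cball 0 1 \<subseteq> blinfun_apply (emb x) ` cball (0::complex) 1"
    using norm_coord_le order_trans by fastforce
  ultimately have "compact (closure (blinfun_apply ?T ` cball 0 1))"
    by (metis closed_closure closure_minimal compact_Int_closed compact_imp_closed inf.absorb_iff2)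
  then show ?thesis by (simp add: compact_ops_def bops_compose emb_bops coord_bops)
qed

lemma hs_ops_subset_min_tensor:
  assumes A: "A \<subseteq> bops"
  shows "hs_ops A \<subseteq> (min_tensor compact_ops A :: (('x, 'h::chilbert_space) l2 \<Rightarrow>\<^sub>L ('x, 'h) l2) set)"
proof
  fix T :: "('x, 'h) l2 \<Rightarrow>\<^sub>L ('x, 'h) l2" assume T: "T \<in> hs_ops A"
  show "T \<in> min_tensor compact_ops A"
    unfolding min_tensor_def closure_approachable
  proof (intro allI impI)
    fix e :: real assume "0 < e"
    then obtain F where F: "finite F" "norm (T - op_of F (matrix_entry T)) \<le> e / 2"
      using hs_ops_finite_approximation [OF A T, of "e / 2"] by (metis half_gt_zero)
    have "matrix_entry T x y \<in> A" for x y
      using T unfolding hs_ops_iff [OF A] l2_kernels_def by blast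
    then have "op_of F (matrix_entry T) \<in> cspan (elementary_tensors compact_ops A)"
      by (intro op_of_in_span_elementary A matrix_unit_compact)
    moreover have "dist (op_of F (matrix_entry T)) T < e"
      using F(2) \<open>0 < e\<close> by (simp add: dist_norm norm_minus_commute)
    ultimately show "\<exists>y\<in>cspan (elementary_tensors compact_ops A). dist y T < e" by blast
  qed
qed

definition coord_proj :: "'x set \<Rightarrow> (('x, 'h::chilbert_space) l2 \<Rightarrow>\<^sub>L ('x, 'h) l2)" where
  "coord_proj F = (\<Sum>x\<in>F. emb x o\<^sub>L coord x)"

lemma coord_proj_apply:
  "blinfun_apply (coord_proj F) \<xi> = finite_vec F (\<lambda>x. blinfun_apply (coord x) \<xi>)"
  by (simp add: coord_proj_def finite_vec_def blinfun.sum_left)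

lemma coord_proj_bops: "coord_proj F \<in> bops"
  unfolding coord_proj_def by (intro csubspace_sum csubspace_bops bops_compose emb_bops coord_bops)

lemma norm_coord_proj_le: "finite F \<Longrightarrow> norm (blinfun_apply (coord_proj F) \<xi>) \<le> norm \<xi>"
  by (simp add: coord_proj_apply norm_finite_vec L2_set_coord_le)

lemma cinner_coord_proj:
  "cinner (blinfun_apply (coord_proj F) \<xi>) \<eta> = cinner \<xi> (blinfun_apply (coord_proj F) \<eta>)"
  by (simp add: coord_proj_apply finite_vec_def cinner.sum_left cinner.sum_right cinner_emb
      cinner_coord [symmetric])

lemma coord_proj_tendsto:
  "((\<lambda>F. blinfun_apply (coord_proj F) \<xi>) \<longlongrightarrow> \<xi>) (finite_subsets_at_top UNIV)"
  unfolding coord_proj_apply by (rule finite_vec_coord_tendsto)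

lemma ex_finite_coord_proj_close:
  assumes "finite K" "0 < (\<epsilon>::real)"
  shows "\<exists>F. finite F \<and> (\<forall>\<xi>\<in>K. norm (\<xi> - blinfun_apply (coord_proj F) \<xi>) < \<epsilon>)"
proof -
  have "\<forall>\<^sub>F F in finite_subsets_at_top UNIV. norm (\<xi> - blinfun_apply (coord_proj F) \<xi>) < \<epsilon>" for \<xi>
    using tendstoD [OF coord_proj_tendsto assms(2), of \<xi>] by (simp add: dist_norm norm_minus_commute)
  then have "\<forall>\<^sub>F F in finite_subsets_at_top UNIV. \<forall>\<xi>\<in>K. norm (\<xi> - blinfun_apply (coord_proj F) \<xi>) < \<epsilon>"
    by (intro eventually_ball_finite assms(1) ballI)
  then have "\<exists>X. finite X \<and> X \<subseteq> UNIV \<and> (\<forall>Y. finite Y \<and> X \<subseteq> Y \<and> Y \<subseteq> UNIV \<longrightarrow>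
      (\<forall>\<xi>\<in>K. norm (\<xi> - blinfun_apply (coord_proj Y) \<xi>) < \<epsilon>))"
    by (simp only: eventually_finite_subsets_at_top)
  then show ?thesis by (elim exE conjE) (rule exI, rule conjI, assumption, simp)
qed

text \<open>\<open>P\<^sub>G \<rightarrow> 1\<close> uniformly on the compact set \<open>T(ball)\<close>, and each of the finitely many rows of
  \<open>P\<^sub>G T\<close> is given by an \<open>\<ell>\<^sup>2\<close> vector.\<close>

lemma compact_op_finite_approximation:
  fixes T :: "('x, complex) l2 \<Rightarrow>\<^sub>L ('x, complex) l2"
  assumes T: "T \<in> compact_ops" and \<epsilon>: "0 < \<epsilon>"
  obtains R F where "finite F" "R \<in> bops" "norm (T - R) \<le> \<epsilon>"
    "\<And>x y. x \<notin> F \<or> y \<notin> F \<Longrightarrow> matrix_entry R x y = 0"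
proof -
  have Tb: "T \<in> bops" and Tc: "compact (closure (blinfun_apply T ` cball 0 1))"
    using T by (auto simp: compact_ops_def)
  obtain K where K: "finite K" "closure (blinfun_apply T ` cball 0 1) \<subseteq> (\<Union>k\<in>K. ball k (\<epsilon> / 6))"
    using Tc \<epsilon> unfolding compact_eq_totally_bounded by (metis divide_pos_pos zero_less_numeral)
  obtain G where G: "finite G" "\<And>k. k \<in> K \<Longrightarrow> norm (k - blinfun_apply (coord_proj G) k) < \<epsilon> / 6"
    using ex_finite_coord_proj_close [OF K(1), of "\<epsilon> / 6"] \<epsilon> by (metis divide_pos_pos zero_less_numeral)
  have ball: "norm (blinfun_apply T \<xi> - blinfun_apply (coord_proj G) (blinfun_apply T \<xi>)) \<le> \<epsilon> / 2"
    if "norm \<xi> \<le> 1" for \<xi>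
  proof -
    define z where "z = blinfun_apply T \<xi>"
    have "z \<in> closure (blinfun_apply T ` cball 0 1)"
      using that closure_subset unfolding z_def by fastforce
    then obtain k where k: "k \<in> K" "norm (k - z) < \<epsilon> / 6" using K(2) by (auto simp: dist_norm)
    have "z - blinfun_apply (coord_proj G) z = - (k - z) + (k - blinfun_apply (coord_proj G) k)
        + blinfun_apply (coord_proj G) (k - z)" by (simp add: blinfun.diff_right)
    moreover have "norm (a + b + c) \<le> norm a + norm b + norm c" for a b c :: "('x, complex) l2"
      by (intro norm_triangle_le add_right_mono norm_triangle_ineq)
    ultimately have "norm (z - blinfun_apply (coord_proj G) z) \<le> norm (- (k - z))
        + norm (k - blinfun_apply (coord_proj G) k) + norm (blinfun_apply (coord_proj G) (k - z))"
      by metis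
    also have "\<dots> \<le> \<epsilon> / 6 + \<epsilon> / 6 + \<epsilon> / 6"
      unfolding norm_minus_cancel
      using k G norm_coord_proj_le [OF G(1), of "k - z"] by (intro add_mono) (auto intro: less_imp_le)
    finally show ?thesis by (simp add: z_def)
  qed
  have TG: "norm (T - (coord_proj G o\<^sub>L T)) \<le> \<epsilon> / 2"
  proof (rule norm_blinfun_bound)
    fix \<xi>
    show "norm (blinfun_apply (T - (coord_proj G o\<^sub>L T)) \<xi>) \<le> \<epsilon> / 2 * norm \<xi>"
    proof (cases "\<xi> = 0")
      case False
      then have "norm (blinfun_apply (T - (coord_proj G o\<^sub>L T)) (inverse (norm \<xi>) *\<^sub>R \<xi>)) \<le> \<epsilon> / 2"
        using ball [of "inverse (norm \<xi>) *\<^sub>R \<xi>"] by (simp add: blinfun.diff_left)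
      then show ?thesis using False by (simp add: blinfun.scaleR_right field_simps)
    qed (simp add: blinfun.zero_right)
  qed (use \<epsilon> in simp)
  have "\<exists>w. \<forall>\<xi>. blinfun_apply (coord x) (blinfun_apply T \<xi>) = cinner \<xi> w" for x
    using cinner_adj [OF bops_compose [OF coord_bops Tb], of x _ 1]
    by (auto simp: cinner_complex_def)
  then obtain w where w: "\<And>x \<xi>. blinfun_apply (coord x) (blinfun_apply T \<xi>) = cinner \<xi> (w x)" by metis
  define \<delta> where "\<delta> = \<epsilon> / 2 / (real (card G) + 1)"
  have \<delta>: "0 < \<delta>" using \<epsilon> by (simp add: \<delta>_def add_nonneg_pos)
  obtain F where F: "finite F" "\<And>x. x \<in> G \<Longrightarrow> norm (w x - blinfun_apply (coord_proj F) (w x)) < \<delta>"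
    using ex_finite_coord_proj_close [OF finite_imageI [OF G(1), of w] \<delta>] by blast
  define R where "R = coord_proj G o\<^sub>L T o\<^sub>L coord_proj F"
  have GR: "norm ((coord_proj G o\<^sub>L T) - R) \<le> \<epsilon> / 2"
  proof (rule norm_blinfun_bound)
    fix \<xi> :: "('x, complex) l2"
    define \<zeta> where "\<zeta> = \<xi> - blinfun_apply (coord_proj F) \<xi>"
    have row: "norm (blinfun_apply (coord x) (blinfun_apply T \<zeta>)) \<le> \<delta> * norm \<xi>" if x: "x \<in> G" for x
    proof -
      have "blinfun_apply (coord x) (blinfun_apply T \<zeta>) = cinner \<xi> (w x - blinfun_apply (coord_proj F) (w x))"
        by (simp add: w \<zeta>_def cinner.diff_left cinner.diff_right cinner_coord_proj)
      then have "norm (blinfun_apply (coord x) (blinfun_apply T \<zeta>)) \<le> norm \<xi> * \<delta>"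
        using order_trans [OF norm_cinner_le mult_left_mono [OF less_imp_le [OF F(2) [OF x]] norm_ge_zero]]
        by simp
      then show ?thesis by (simp add: mult.commute)
    qed
    have "blinfun_apply ((coord_proj G o\<^sub>L T) - R) \<xi> = blinfun_apply (coord_proj G) (blinfun_apply T \<zeta>)"
      by (simp add: R_def \<zeta>_def blinfun.bilinear_simps)
    then have "norm (blinfun_apply ((coord_proj G o\<^sub>L T) - R) \<xi>)
        \<le> (\<Sum>x\<in>G. norm (blinfun_apply (emb x) (blinfun_apply (coord x) (blinfun_apply T \<zeta>))))"
      by (simp only: coord_proj_apply finite_vec_def norm_sum)
    also have "\<dots> \<le> (\<Sum>x\<in>G. \<delta> * norm \<xi>)" by (intro sum_mono) (simp only: norm_emb row)
    also have "\<dots> = (\<delta> * card G) * norm \<xi>" by simp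
    also have "\<dots> \<le> \<epsilon> / 2 * norm \<xi>"
      using \<epsilon> by (intro mult_right_mono) (simp_all add: \<delta>_def field_simps)
    finally show "norm (blinfun_apply ((coord_proj G o\<^sub>L T) - R) \<xi>) \<le> \<epsilon> / 2 * norm \<xi>" .
  qed (use \<epsilon> in simp)
  show ?thesis
  proof (rule that)
    show "finite (G \<union> F)" using G F by simp
    show "R \<in> bops" unfolding R_def by (intro bops_compose coord_proj_bops Tb)
    have "T - R = (T - (coord_proj G o\<^sub>L T)) + ((coord_proj G o\<^sub>L T) - R)" by simp
    then show "norm (T - R) \<le> \<epsilon>"
      using norm_triangle_ineq [of "T - (coord_proj G o\<^sub>L T)" "(coord_proj G o\<^sub>L T) - R"] TG GR by simp
    show "matrix_entry R x y = 0" if "x \<notin> G \<union> F \<or> y \<notin> G \<union> F" for x y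
    proof (rule blinfun_eqI)
      have "blinfun_apply (coord_proj F) (blinfun_apply (emb y) h) = 0" if "y \<notin> F" for h :: complex
        using that F(1) by (intro l2_eqI) (simp add: coord_proj_apply coord_finite_vec coord_emb blinfun.zero_right)
      then show "blinfun_apply (matrix_entry R x y) h = blinfun_apply 0 h" for h
        using that G(1) by (auto simp: matrix_entry_apply R_def coord_proj_apply [of G] coord_finite_vec
            blinfun.zero_right)
    qed
  qed
qed

text \<open>For compact \<open>T\<close> and a finite matrix \<open>R\<close> close to \<open>T\<close>, scalar amplification gives
  \<open>\<parallel>T \<otimes> a - R \<otimes> a\<parallel> \<le> \<parallel>T - R\<parallel> \<parallel>a\<parallel>\<close>, and \<open>R \<otimes> a\<close> has a finitely supported kernel.\<close>

lemma min_tensor_subset_closure_hs_ops: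
  fixes A :: "('h::chilbert_space \<Rightarrow>\<^sub>L 'h) set"
  assumes A: "A \<subseteq> bops" "csubspace A"
  shows "(min_tensor compact_ops A :: (('x, 'h) l2 \<Rightarrow>\<^sub>L ('x, 'h) l2) set) \<subseteq> closure (hs_ops A)"
  unfolding min_tensor_def
proof (intro closure_minimal complex_vector.span_minimal csubspace_closure csubspace_hs_ops A closed_closure subsetI)
  fix S :: "('x, 'h) l2 \<Rightarrow>\<^sub>L ('x, 'h) l2" assume "S \<in> elementary_tensors compact_ops A"
  then obtain T a where S: "S \<in> bops" "T \<in> compact_ops" "a \<in> A"
      "\<And>f h. blinfun_apply S (tensor_vec f h) = tensor_vec (blinfun_apply T f) (blinfun_apply a h)"
    by (auto simp: elementary_tensors_def)
  show "S \<in> closure (hs_ops A)"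
    unfolding closure_approachable
  proof (intro allI impI)
    fix e :: real assume e: "0 < e"
    define \<delta> where "\<delta> = e / (2 * (norm a + 1))"
    have \<delta>: "0 < \<delta>" using e by (simp add: \<delta>_def add_nonneg_pos)
    obtain R F where R: "finite F" "R \<in> bops" "norm (T - R) \<le> \<delta>"
        "\<And>x y. x \<notin> F \<or> y \<notin> F \<Longrightarrow> matrix_entry R x y = 0"
      using compact_op_finite_approximation [OF S(2) \<delta>] by metis
    have Tb: "T \<in> bops" using S(2) by (simp add: compact_ops_def)
    define S' where "S' = op_of F (\<lambda>x y. blinfun_apply (matrix_entry R x y) 1 *\<^sub>C a)"
    have S': "S' \<in> hs_ops A"
      unfolding S'_def by (intro op_of_hs_ops A R(1) complex_vector.subspace_scale S)
    have ent: "matrix_entry (S - S') x y = blinfun_apply (matrix_entry (T - R) x y) 1 *\<^sub>C a" for x y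
      using R(4) [of x y]
      by (auto simp: matrix_entry_diff S'_def matrix_entry_op_of R(1) matrix_entry_tensor [OF S(4)]
          blinfun.diff_left complex_vector.scale_left_diff_distrib)
    have "norm (S - S') \<le> \<delta> * norm a"
    proof (rule norm_le_if_form_bounds)
      show "S - S' \<in> bops"
        using S' hs_ops_iff [OF A(1)] by (intro csubspace_diff csubspace_bops S) auto
      show "0 \<le> \<delta> * norm a" using \<delta> by simp
      fix G :: "'x set" assume G: "finite G"
      have "form_bound G (\<lambda>x y. blinfun_apply (matrix_entry (T - R) x y) 1 *\<^sub>C a) (\<delta> * norm a)"
        using \<delta> by (intro form_bound_scalar_amplification G form_bound_matrix_entry R(3)
            matrix_entry_bops csubspace_diff csubspace_bops Tb R(2)) auto
      then show "form_bound G (matrix_entry (S - S')) (\<delta> * norm a)"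
        by (rule form_bound_cong [THEN iffD1, rotated]) (simp add: ent)
    qed
    also have "\<dots> < \<delta> * (2 * (norm a + 1))" using \<delta> by (intro mult_strict_left_mono) (simp_all add: add_nonneg_pos)
    also have "\<dots> = e" by (simp add: \<delta>_def add_nonneg_eq_0_iff)
    finally show "\<exists>y\<in>hs_ops A. dist y S < e" using S' by (auto simp: dist_norm norm_minus_commute)
  qed
qed

text \<open>The truncations \<open>P\<^sub>F S P\<^sub>F\<close> lie in the algebraic tensor product and converge to \<open>S\<close> in the weak*
  topology, by dominated convergence for the series that defines a normal functional.\<close>

lemma bops_in_weak_star_tensor:
  fixes S :: "('x, 'h::chilbert_space) l2 \<Rightarrow>\<^sub>L ('x, 'h) l2"
  assumes S: "S \<in> bops"
  shows "S \<in> weak_star_tensor bops bops"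
proof -
  define R where "R F = coord_proj F o\<^sub>L S o\<^sub>L coord_proj F" for F
  have Rb: "R F \<in> bops" for F unfolding R_def by (intro bops_compose coord_proj_bops S)
  have R_span: "R F \<in> cspan (elementary_tensors bops bops)" for F
  proof -
    have "R F = op_of F (matrix_entry S)"
      by (rule blinfun_eqI)
        (simp add: R_def op_of_apply coord_proj_apply finite_vec_def matrix_entry_apply blinfun.sum_right,
          rule sum.swap)
    then show ?thesis
      by (auto intro!: op_of_in_span_elementary matrix_entry_bops S bops_compose emb_bops coord_bops)
  qed
  have lim: "((\<lambda>F. \<omega> (R F)) \<longlongrightarrow> \<omega> S) (finite_subsets_at_top UNIV)" if "\<omega> \<in> normal_functionals" for \<omega>
  proof -
    obtain \<xi> \<eta> :: "nat \<Rightarrow> ('x, 'h) l2" where \<omega>: "\<omega> = (\<lambda>T. \<Sum>n. cinner (blinfun_apply T (\<xi> n)) (\<eta> n))"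
      and sm: "summable (\<lambda>n. (norm (\<xi> n))\<^sup>2)" "summable (\<lambda>n. (norm (\<eta> n))\<^sup>2)"
      using \<open>\<omega> \<in> normal_functionals\<close> by (auto simp: normal_functionals_def)
    have bound: "norm (cinner (blinfun_apply (R F) (\<xi> n)) (\<eta> n))
        \<le> norm S * ((norm (\<xi> n))\<^sup>2 + (norm (\<eta> n))\<^sup>2)" if F: "finite F" for n F
    proof -
      have "norm (blinfun_apply (R F) (\<xi> n)) \<le> norm (blinfun_apply S (blinfun_apply (coord_proj F) (\<xi> n)))"
        by (simp add: R_def norm_coord_proj_le [OF F])
      also have "\<dots> \<le> norm S * norm (blinfun_apply (coord_proj F) (\<xi> n))" by (rule norm_blinfun)
      also have "\<dots> \<le> norm S * norm (\<xi> n)" by (intro mult_left_mono norm_coord_proj_le F) simp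
      finally have "norm (cinner (blinfun_apply (R F) (\<xi> n)) (\<eta> n)) \<le> norm S * norm (\<xi> n) * norm (\<eta> n)"
        by (intro order_trans [OF norm_cinner_le] mult_right_mono) simp_all
      also have "\<dots> \<le> norm S * ((norm (\<xi> n))\<^sup>2 + (norm (\<eta> n))\<^sup>2)"
        unfolding mult.assoc
      proof (intro mult_left_mono)
        show "norm (\<xi> n) * norm (\<eta> n) \<le> (norm (\<xi> n))\<^sup>2 + (norm (\<eta> n))\<^sup>2"
          using sum_squares_bound [of "norm (\<xi> n)" "norm (\<eta> n)"]
            mult_nonneg_nonneg [OF norm_ge_zero norm_ge_zero, of "\<xi> n" "\<eta> n"]
          unfolding mult.assoc by linarith
      qed simp
      finally show ?thesis .
    qed
    have "((\<lambda>F. \<Sum>n. cinner (blinfun_apply (R F) (\<xi> n)) (\<eta> n))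
        \<longlongrightarrow> (\<Sum>n. cinner (blinfun_apply S (\<xi> n)) (\<eta> n))) (finite_subsets_at_top UNIV)"
    proof (rule tannerys_theorem [THEN conjunct2, THEN conjunct2])
      show "summable (\<lambda>n. norm S * ((norm (\<xi> n))\<^sup>2 + (norm (\<eta> n))\<^sup>2))"
        by (intro summable_mult summable_add sm)
      show "((\<lambda>F. cinner (blinfun_apply (R F) (\<xi> n)) (\<eta> n)) \<longlongrightarrow> cinner (blinfun_apply S (\<xi> n)) (\<eta> n))
          (finite_subsets_at_top UNIV)" for n
      proof -
        have "cinner (blinfun_apply (R F) (\<xi> n)) (\<eta> n)
            = cinner (blinfun_apply S (blinfun_apply (coord_proj F) (\<xi> n))) (blinfun_apply (coord_proj F) (\<eta> n))" for F
          by (simp add: R_def cinner_coord_proj)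
        then show ?thesis
          by (simp only:) (intro cinner.tendsto blinfun.tendsto tendsto_const coord_proj_tendsto)
      qed
      have "\<forall>\<^sub>F F in finite_subsets_at_top UNIV. \<forall>n. norm (cinner (blinfun_apply (R F) (\<xi> n)) (\<eta> n))
        \<le> norm S * ((norm (\<xi> n))\<^sup>2 + (norm (\<eta> n))\<^sup>2)"
        by (rule eventually_finite_subsets_at_top_weakI) (use bound in blast)
      then show "\<forall>\<^sub>F (n, F) in at_top \<times>\<^sub>F finite_subsets_at_top UNIV.
          norm (cinner (blinfun_apply (R F) (\<xi> n)) (\<eta> n)) \<le> norm S * ((norm (\<xi> n))\<^sup>2 + (norm (\<eta> n))\<^sup>2)"
        unfolding eventually_prod_filter
        by - (rule exI [where x = "\<lambda>_. True"], rule exI, rule conjI, simp, rule conjI, assumption, simp)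
    qed simp
    then show ?thesis by (simp add: \<omega>)
  qed
  define \<S> where "\<S> = {{T \<in> bops. \<omega> T \<in> U} | \<omega> U.
    \<omega> \<in> (normal_functionals :: ((('x, 'h) l2 \<Rightarrow>\<^sub>L ('x, 'h) l2) \<Rightarrow> complex) set) \<and> open U}"
  have ev: "S \<in> V \<Longrightarrow> \<forall>\<^sub>F F in finite_subsets_at_top UNIV. R F \<in> V" if "generate_topology_on \<S> V" for V
    using that
  proof induction
    case (Int a b)
    then show ?case by (auto intro: eventually_conj)
  next
    case (UN K)
    then obtain k where "k \<in> K" "S \<in> k" by blast
    with UN have "\<forall>\<^sub>F F in finite_subsets_at_top UNIV. R F \<in> k" by blast
    then show ?case by eventually_elim (use \<open>k \<in> K\<close> in blast)
  next
    case (Basis s)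
    then obtain \<omega> U where s: "s = {T \<in> bops. \<omega> T \<in> U}" "\<omega> \<in> normal_functionals" "open U"
      by (auto simp: \<S>_def)
    have "\<forall>\<^sub>F F in finite_subsets_at_top UNIV. \<omega> (R F) \<in> U"
      using topological_tendstoD [OF lim [OF s(2)] s(3)] Basis s(1) by blast
    then show ?case by eventually_elim (simp add: s(1) Rb)
  qed simp
  have "(\<lambda>T. \<Sum>n. cinner (blinfun_apply T 0) 0) \<in> (normal_functionals :: ((('x, 'h) l2 \<Rightarrow>\<^sub>L ('x, 'h) l2) \<Rightarrow> complex) set)"
    unfolding normal_functionals_def
    by (intro CollectI exI [where x = "\<lambda>_. 0"]) simp
  then have "{T \<in> bops. (\<Sum>n::nat. cinner (blinfun_apply T 0) (0 :: ('x, 'h) l2)) \<in> UNIV} \<in> \<S>"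
    unfolding \<S>_def by blast
  then have top: "S \<in> topspace weak_star_topology"
    unfolding weak_star_topology_def \<S>_def [symmetric] topology_generated_by_topspace using S by auto
  show ?thesis
    unfolding weak_star_tensor_def in_closure_of
  proof (intro conjI top allI impI)
    fix V assume "S \<in> V \<and> openin weak_star_topology V"
    then have "\<forall>\<^sub>F F in finite_subsets_at_top UNIV. R F \<in> V"
      using ev unfolding weak_star_topology_def \<S>_def [symmetric] openin_topology_generated_by_iff by blast
    then have "\<exists>F. R F \<in> V" using eventually_happens finite_subsets_at_top_neq_bot by blast
    then show "\<exists>y. y \<in> cspan (elementary_tensors bops bops) \<and> y \<in> V" using R_span by blast
  qed
qed

section \<open>Matrices of operators on \<open>\<ell>\<^sup>2(X, H)\<close> and the canonical extension\<close>

lemma mat_pos_iff_psd: "mat_pos n a \<longleftrightarrow> psd {..<n} a"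
  by (simp add: mat_pos_def psd_def matrix_form_def cinner.sum_left)

lemma form_bound_mono:
  assumes "form_bound J a M" "M \<le> M'"
  shows "form_bound J a M'"
  unfolding form_bound_def
proof (intro allI)
  fix \<xi> \<eta>
  have "cmod (matrix_form J a \<xi> \<eta>) \<le> M * L2_set (\<lambda>j. norm (\<xi> j)) J * L2_set (\<lambda>i. norm (\<eta> i)) J"
    using assms(1) by (simp add: form_bound_def)
  also have "\<dots> \<le> M' * L2_set (\<lambda>j. norm (\<xi> j)) J * L2_set (\<lambda>i. norm (\<eta> i)) J"
    using assms(2) by (intro mult_right_mono) auto
  finally show "cmod (matrix_form J a \<xi> \<eta>)
    \<le> M' * L2_set (\<lambda>j. norm (\<xi> j)) J * L2_set (\<lambda>i. norm (\<eta> i)) J" .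
qed

text \<open>The form bound is tested against \<open>\<eta> = a \<xi>\<close>.\<close>

lemma form_bound_iff_L2:
  assumes M: "0 \<le> M"
  shows "form_bound J a M \<longleftrightarrow> (\<forall>\<xi>. L2_set (\<lambda>i. norm (\<Sum>j\<in>J. blinfun_apply (a i j) (\<xi> j))) J
    \<le> M * L2_set (\<lambda>j. norm (\<xi> j)) J)"
proof -
  have form: "matrix_form J a \<xi> \<eta> = (\<Sum>i\<in>J. cinner (\<Sum>j\<in>J. blinfun_apply (a i j) (\<xi> j)) (\<eta> i))" for \<xi> \<eta>
    by (simp add: matrix_form_def cinner.sum_left)
  show ?thesis
  proof
    assume fb: "form_bound J a M"
    show "\<forall>\<xi>. L2_set (\<lambda>i. norm (\<Sum>j\<in>J. blinfun_apply (a i j) (\<xi> j))) J \<le> M * L2_set (\<lambda>j. norm (\<xi> j)) J"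
    proof
      fix \<xi>
      define \<eta> where "\<eta> i = (\<Sum>j\<in>J. blinfun_apply (a i j) (\<xi> j))" for i
      let ?y = "L2_set (\<lambda>i. norm (\<eta> i)) J"
      have "matrix_form J a \<xi> \<eta> = of_real (?y\<^sup>2)"
        by (simp add: form \<eta>_def [symmetric] cinner_self L2_set_def sum_nonneg)
      then have "?y * ?y \<le> M * L2_set (\<lambda>j. norm (\<xi> j)) J * ?y"
        using fb [unfolded form_bound_def, rule_format, of \<xi> \<eta>]
        by (simp add: norm_power power2_eq_square norm_mult)
      then have "?y \<le> M * L2_set (\<lambda>j. norm (\<xi> j)) J"
      proof (cases "?y = 0")
        case False
        then have "0 < ?y" using L2_set_nonneg [of "\<lambda>i. norm (\<eta> i)" J] by linarith
        then show ?thesis using \<open>?y * ?y \<le> _\<close> by simp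
      qed (use M in simp)
      then show "L2_set (\<lambda>i. norm (\<Sum>j\<in>J. blinfun_apply (a i j) (\<xi> j))) J \<le> M * L2_set (\<lambda>j. norm (\<xi> j)) J"
        by (simp only: \<eta>_def)
    qed
  next
    assume L2: "\<forall>\<xi>. L2_set (\<lambda>i. norm (\<Sum>j\<in>J. blinfun_apply (a i j) (\<xi> j))) J \<le> M * L2_set (\<lambda>j. norm (\<xi> j)) J"
    show "form_bound J a M"
      unfolding form_bound_def
    proof (intro allI)
      fix \<xi> \<eta>
      let ?a = "\<lambda>i. \<Sum>j\<in>J. blinfun_apply (a i j) (\<xi> j)"
      have "cmod (matrix_form J a \<xi> \<eta>) \<le> (\<Sum>i\<in>J. norm (?a i) * norm (\<eta> i))"
        unfolding form by (intro order_trans [OF norm_sum] sum_mono norm_cinner_le)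
      also have "\<dots> \<le> L2_set (\<lambda>i. norm (?a i)) J * L2_set (\<lambda>i. norm (\<eta> i)) J"
        using L2_set_mult_ineq [of "\<lambda>i. norm (?a i)" "\<lambda>i. norm (\<eta> i)" J] by simp
      also have "\<dots> \<le> M * L2_set (\<lambda>j. norm (\<xi> j)) J * L2_set (\<lambda>i. norm (\<eta> i)) J"
        using L2 by (intro mult_right_mono) auto
      finally show "cmod (matrix_form J a \<xi> \<eta>) \<le> M * L2_set (\<lambda>j. norm (\<xi> j)) J * L2_set (\<lambda>i. norm (\<eta> i)) J" .
    qed
  qed
qed

lemma mat_norm_le_iff:
  fixes a :: "nat \<Rightarrow> nat \<Rightarrow> ('h::chilbert_space \<Rightarrow>\<^sub>L 'h)"
  assumes M: "0 \<le> M"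
  shows "mat_norm n a \<le> M \<longleftrightarrow> form_bound {..<n} a M"
proof -
  let ?L = "\<lambda>\<xi>. L2_set (\<lambda>i. norm (\<Sum>j<n. blinfun_apply (a i j) (\<xi> j))) {..<n}"
  let ?B = "{\<xi> :: nat \<Rightarrow> 'h. L2_set (\<lambda>j. norm (\<xi> j)) {..<n} \<le> 1}"
  define N where "N = norm (op_of {..<n} a)"
  have N: "0 \<le> N" "form_bound {..<n} a N"
    using norm_op_of_le_iff [of "{..<n}" N a] by (simp_all add: N_def)
  have "?L \<xi> \<le> N" if "\<xi> \<in> ?B" for \<xi>
    using N form_bound_iff_L2 [OF N(1), of "{..<n}" a] mult_left_mono [OF _ N(1), of _ 1] that
    by (auto intro: order_trans)
  then have bdd: "bdd_above (?L ` ?B)" by (intro bdd_aboveI2)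
  have "(\<lambda>_. 0) \<in> ?B" by (simp add: L2_set_def)
  then have ne: "?B \<noteq> {}" by (metis empty_iff)
  show ?thesis
  proof
    assume le: "mat_norm n a \<le> M"
    show "form_bound {..<n} a M"
      unfolding form_bound_iff_L2 [OF M]
    proof
      fix \<xi> :: "nat \<Rightarrow> 'h"
      define r where "r = L2_set (\<lambda>j. norm (\<xi> j)) {..<n}"
      show "?L \<xi> \<le> M * L2_set (\<lambda>j. norm (\<xi> j)) {..<n}"
      proof (cases "r = 0")
        case True
        have "?L \<xi> \<le> N * r"
          unfolding r_def using N(2) [unfolded form_bound_iff_L2 [OF N(1)]] by (rule spec)
        then show ?thesis using True by (simp add: r_def)
      next
        case False
        then have r: "0 < r" by (simp add: r_def less_le)
        have "L2_set (\<lambda>j. norm (inverse r *\<^sub>R \<xi> j)) {..<n} = 1"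
          using r by (simp add: L2_set_right_distrib [symmetric] r_def [symmetric])
        then have "?L (\<lambda>j. inverse r *\<^sub>R \<xi> j) \<le> mat_norm n a"
          unfolding mat_norm_def by (intro cSUP_upper bdd) simp
        also have "?L (\<lambda>j. inverse r *\<^sub>R \<xi> j) = inverse r * ?L \<xi>"
          using r by (simp add: blinfun.scaleR_right scaleR_sum_right [symmetric] L2_set_right_distrib)
        finally have "inverse r * ?L \<xi> \<le> M" using le by simp
        then show ?thesis using r by (simp add: r_def [symmetric] field_simps)
      qed
    qed
  next
    assume "form_bound {..<n} a M"
    then show "mat_norm n a \<le> M"
      unfolding mat_norm_def form_bound_iff_L2 [OF M] using ne mult_left_mono [OF _ M, of _ 1]
      by (intro cSUP_least) (auto intro: order_trans)
  qed
qed

lemma form_bound_mat_norm: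
  fixes a :: "nat \<Rightarrow> nat \<Rightarrow> ('h::chilbert_space \<Rightarrow>\<^sub>L 'h)"
  shows "0 \<le> mat_norm n a" "form_bound {..<n} a (mat_norm n a)"
proof -
  show "0 \<le> mat_norm n a"
  proof (rule ccontr)
    assume neg: "\<not> 0 \<le> mat_norm n a"
    then have "form_bound {..<n} a 0" using mat_norm_le_iff [of 0 n a] by simp
    then have "L2_set (\<lambda>i. norm (\<Sum>j<n. blinfun_apply (a i j) (\<xi> j))) {..<n} = 0" for \<xi>
      using form_bound_iff_L2 [of 0 "{..<n}" a] L2_set_nonneg order_antisym by fastforce
    moreover have "\<exists>\<xi> :: nat \<Rightarrow> 'h. L2_set (\<lambda>j. norm (\<xi> j)) {..<n} \<le> 1"
      by (intro exI [where x = "\<lambda>_. 0"]) (simp add: L2_set_def)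
    ultimately have "mat_norm n a = 0"
      unfolding mat_norm_def by (auto simp: image_constant_conv)
    with neg show False by simp
  qed
  then show "form_bound {..<n} a (mat_norm n a)" using mat_norm_le_iff by blast
qed

lemma cb_norm_le:
  assumes C: "0 \<le> C"
    and "\<And>n a. a \<in> mats n S \<Longrightarrow> form_bound {..<n} a 1 \<Longrightarrow> form_bound {..<n} (\<lambda>i j. F (a i j)) C"
  shows "cb_norm S F \<le> ennreal C"
  unfolding cb_norm_def using assms
  by (intro SUP_least ennreal_leI) (auto simp: mat_norm_le_iff)

text \<open>Homogeneity reduces to matrices of norm at most \<open>1\<close>; for \<open>M = 0\<close> let \<open>M\<close> decrease to \<open>0\<close>.\<close>

lemma form_bound_cb_norm:
  fixes F :: "('a::chilbert_space \<Rightarrow>\<^sub>L 'a) \<Rightarrow> ('b::chilbert_space \<Rightarrow>\<^sub>L 'b)"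
  assumes F: "clinear_on S F" and S: "csubspace S" and C: "cb_norm S F \<le> ennreal C" "0 \<le> C"
    and a: "a \<in> mats n S" and M: "form_bound {..<n} a M" "0 \<le> M"
  shows "form_bound {..<n} (\<lambda>i j. F (a i j)) (C * M)"
proof -
  have pos: "form_bound {..<n} (\<lambda>i j. F (a i j)) (C * M)" if M: "form_bound {..<n} a M" "0 < M" for M
  proof -
    define b where "b i j = of_real (1 / M) *\<^sub>C a i j" for i j
    have form: "matrix_form {..<n} (\<lambda>i j. of_real (1 / M) *\<^sub>C c i j) \<xi> \<eta> = of_real (1 / M) * matrix_form {..<n} c \<xi> \<eta>"
      for c :: "nat \<Rightarrow> nat \<Rightarrow> ('z::chilbert_space \<Rightarrow>\<^sub>L 'z)" and \<xi> \<eta>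
      by (simp add: matrix_form_def cinner_scaleC_left sum_distrib_left)
    have "form_bound {..<n} b 1"
      unfolding form_bound_def b_def form
      using M(1) [unfolded form_bound_def, rule_format] M(2)
      by (auto simp: norm_mult norm_divide field_simps)
    moreover have "b \<in> mats n S"
      using a S by (auto simp: b_def mats_def complex_vector.subspace_scale)
    ultimately have "ennreal (mat_norm n (\<lambda>i j. F (b i j))) \<le> cb_norm S F"
      unfolding cb_norm_def by (intro SUP_upper2 [of n] SUP_upper) (auto simp: mat_norm_le_iff)
    then have "mat_norm n (\<lambda>i j. F (b i j)) \<le> C"
      using C order_trans by (metis ennreal_le_iff)
    then have fb: "form_bound {..<n} (\<lambda>i j. F (b i j)) C" using C(2) mat_norm_le_iff by blast
    have "form_bound {..<n} (\<lambda>i j. of_real (1 / M) *\<^sub>C F (a i j)) C"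
      by (rule form_bound_cong [THEN iffD1, OF _ fb])
        (use a in \<open>simp add: b_def mats_def clinear_onD(2) [OF F]\<close>)
    then show ?thesis
      using M(2) unfolding form_bound_def form
      by (auto simp: norm_mult norm_divide field_simps)
  qed
  show ?thesis
  proof (cases "M = 0")
    case True
    show ?thesis
      unfolding form_bound_def
    proof (intro allI)
      fix \<xi> \<eta> :: "nat \<Rightarrow> 'b"
      let ?K = "C * L2_set (\<lambda>j. norm (\<xi> j)) {..<n} * L2_set (\<lambda>i. norm (\<eta> i)) {..<n}"
      have K: "0 \<le> ?K" using C by simp
      have "cmod (matrix_form {..<n} (\<lambda>i j. F (a i j)) \<xi> \<eta>) \<le> 0"
      proof (rule field_le_epsilon)
        fix e :: real assume e: "0 < e"
        define d where "d = e / (?K + 1)"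
        have d: "0 < d" using e K by (simp add: d_def)
        have "form_bound {..<n} (\<lambda>i j. F (a i j)) (C * d)"
          using d True by (intro pos form_bound_mono [OF M(1)]) auto
        then have "cmod (matrix_form {..<n} (\<lambda>i j. F (a i j)) \<xi> \<eta>)
            \<le> C * d * L2_set (\<lambda>j. norm (\<xi> j)) {..<n} * L2_set (\<lambda>i. norm (\<eta> i)) {..<n}"
          unfolding form_bound_def by blast
        also have "\<dots> = ?K * d" by (simp only: mult_ac)
        also have "\<dots> = ?K * (e / (?K + 1))" by (simp only: d_def)
        also have "\<dots> \<le> e"
        proof -
          have "k * (e / (k + 1)) \<le> e" if "0 \<le> k" for k using that e by (simp add: field_simps)
          then show ?thesis using K .
        qed
        finally show "cmod (matrix_form {..<n} (\<lambda>i j. F (a i j)) \<xi> \<eta>) \<le> 0 + e" by simp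
      qed
      then show "cmod (matrix_form {..<n} (\<lambda>i j. F (a i j)) \<xi> \<eta>)
          \<le> C * M * L2_set (\<lambda>j. norm (\<xi> j)) {..<n} * L2_set (\<lambda>i. norm (\<eta> i)) {..<n}"
        using True by simp
    qed
  qed (use pos M in auto)
qed

lemma form_bound_single: "form_bound {..<Suc 0} (\<lambda>i j. T) M \<longleftrightarrow> norm T \<le> M" if "0 \<le> M"
proof -
  have "form_bound {..<Suc 0} (\<lambda>i j. T) M \<longleftrightarrow> (\<forall>x. norm (blinfun_apply T x) \<le> M * norm x)"
    unfolding form_bound_iff_L2 [OF that] by (auto simp: L2_set_def dest: spec [where x = "\<lambda>_. _"])
  also have "\<dots> \<longleftrightarrow> norm T \<le> M"
    using that norm_blinfun_bound [of M T] order_trans [OF norm_blinfun mult_right_mono [OF _ norm_ge_zero]]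
    by blast
  finally show ?thesis .
qed

lemma norm_le_cb_norm:
  assumes F: "clinear_on S F" and S: "csubspace S" and C: "cb_norm S F \<le> ennreal C" "0 \<le> C" and T: "T \<in> S"
  shows "norm (F T) \<le> C * norm T"
proof -
  have "form_bound {..<Suc 0} (\<lambda>i j. F T) (C * norm T)"
    using T by (intro form_bound_cb_norm [OF F S C, where a = "\<lambda>_ _. T"])
      (auto simp: mats_def form_bound_single)
  then show ?thesis using C(2) by (simp add: form_bound_single)
qed

lemma matrix_form_reindex:
  assumes "inj_on f I"
  shows "matrix_form (f ` I) a \<xi> \<eta> = matrix_form I (\<lambda>i j. a (f i) (f j)) (\<lambda>j. \<xi> (f j)) (\<lambda>i. \<eta> (f i))"
  unfolding matrix_form_def by (simp add: sum.reindex [OF assms] o_def)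

lemma psd_reindex:
  assumes f: "inj_on f I"
  shows "psd (f ` I) a \<longleftrightarrow> psd I (\<lambda>i j. a (f i) (f j))"
proof
  assume "psd (f ` I) a"
  then have "matrix_form (f ` I) a (\<lambda>p. \<xi> (inv_into I f p)) (\<lambda>p. \<xi> (inv_into I f p)) \<in> \<real>\<^sub>\<ge>\<^sub>0" for \<xi>
    by (simp add: psd_def)
  moreover have "matrix_form (f ` I) a (\<lambda>p. \<xi> (inv_into I f p)) (\<lambda>p. \<xi> (inv_into I f p))
      = matrix_form I (\<lambda>i j. a (f i) (f j)) \<xi> \<xi>" for \<xi>
    unfolding matrix_form_reindex [OF f] by (rule matrix_form_cong) (simp_all add: inv_into_f_f [OF f])
  ultimately show "psd I (\<lambda>i j. a (f i) (f j))" by (simp add: psd_def)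
qed (simp add: psd_def matrix_form_reindex [OF f])

lemma form_bound_reindex:
  assumes f: "inj_on f I" and fb: "form_bound (f ` I) a M"
  shows "form_bound I (\<lambda>i j. a (f i) (f j)) M"
  unfolding form_bound_def
proof (intro allI)
  fix \<xi> \<eta>
  have L2: "L2_set (\<lambda>p. norm (\<zeta> (inv_into I f p))) (f ` I) = L2_set (\<lambda>i. norm (\<zeta> i)) I" for \<zeta>
    by (simp add: L2_set_def sum.reindex [OF f] o_def inv_into_f_f [OF f] cong: sum.cong)
  have "matrix_form I (\<lambda>i j. a (f i) (f j)) \<xi> \<eta>
      = matrix_form (f ` I) a (\<lambda>p. \<xi> (inv_into I f p)) (\<lambda>p. \<eta> (inv_into I f p))"
    unfolding matrix_form_reindex [OF f] by (rule matrix_form_cong) (simp_all add: inv_into_f_f [OF f])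
  then show "cmod (matrix_form I (\<lambda>i j. a (f i) (f j)) \<xi> \<eta>)
      \<le> M * L2_set (\<lambda>j. norm (\<xi> j)) I * L2_set (\<lambda>i. norm (\<eta> i)) I"
    using fb [unfolded form_bound_def, rule_format, of "\<lambda>p. \<xi> (inv_into I f p)" "\<lambda>p. \<eta> (inv_into I f p)"]
    by (simp add: L2)
qed

text \<open>The identification of \<open>n \<times> n\<close> matrices over \<open>B(\<ell>\<^sup>2(X, H))\<close> with matrices over \<open>B(H)\<close> indexed by
  pairs. Truncation to finitely many points of \<open>X\<close> then reduces positivity and norm bounds at all
  matrix levels to finite matrices over \<open>B(H)\<close>.\<close>

definition flatten :: "('i \<Rightarrow> 'i \<Rightarrow> (('x, 'h::chilbert_space) l2 \<Rightarrow>\<^sub>L ('x, 'h) l2)) \<Rightarrow>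
    'i \<times> 'x \<Rightarrow> 'i \<times> 'x \<Rightarrow> ('h \<Rightarrow>\<^sub>L 'h)" where
  "flatten S p q = matrix_entry (S (fst p) (fst q)) (snd p) (snd q)"

lemma matrix_form_flatten:
  "matrix_form (J \<times> F) (flatten S) \<xi> \<eta>
    = matrix_form J S (\<lambda>j. finite_vec F (\<lambda>y. \<xi> (j, y))) (\<lambda>i. finite_vec F (\<lambda>x. \<eta> (i, x)))"
proof -
  have "matrix_form (J \<times> F) (flatten S) \<xi> \<eta> = (\<Sum>i\<in>J. \<Sum>x\<in>F. \<Sum>j\<in>J. \<Sum>y\<in>F.
      cinner (blinfun_apply (matrix_entry (S i j) x y) (\<xi> (j, y))) (\<eta> (i, x)))"
    by (simp only: matrix_form_def flatten_def sum.cartesian_product' fst_conv snd_conv)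
  also have "\<dots> = (\<Sum>i\<in>J. \<Sum>j\<in>J. \<Sum>x\<in>F. \<Sum>y\<in>F.
      cinner (blinfun_apply (matrix_entry (S i j) x y) (\<xi> (j, y))) (\<eta> (i, x)))"
    by (intro sum.cong refl sum.swap)
  also have "\<dots> = matrix_form J S (\<lambda>j. finite_vec F (\<lambda>y. \<xi> (j, y))) (\<lambda>i. finite_vec F (\<lambda>x. \<eta> (i, x)))"
    unfolding matrix_form_def [of J S] matrix_form_matrix_entry [symmetric] by (simp add: matrix_form_def)
  finally show ?thesis .
qed

lemma L2_set_flatten:
  assumes "finite F"
  shows "L2_set (\<lambda>p. norm (\<xi> p)) (J \<times> F) = L2_set (\<lambda>j. norm (finite_vec F (\<lambda>y. \<xi> (j, y)))) J"
  by (simp add: norm_finite_vec [OF assms] L2_set_def sum_nonneg sum.cartesian_product')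

lemma matrix_form_finite_vec_tendsto:
  "((\<lambda>F. matrix_form J S (\<lambda>j. finite_vec F (\<lambda>x. blinfun_apply (coord x) (\<xi> j)))
      (\<lambda>i. finite_vec F (\<lambda>x. blinfun_apply (coord x) (\<eta> i)))) \<longlongrightarrow> matrix_form J S \<xi> \<eta>)
    (finite_subsets_at_top UNIV)"
  unfolding matrix_form_def
  by (intro tendsto_sum cinner.tendsto blinfun.tendsto tendsto_const finite_vec_coord_tendsto)

lemma psd_iff_flatten: "psd J S \<longleftrightarrow> (\<forall>F. finite F \<longrightarrow> psd (J \<times> F) (flatten S))"
proof
  show "\<forall>F. finite F \<longrightarrow> psd (J \<times> F) (flatten S)" if "psd J S"
    using that by (simp add: psd_def matrix_form_flatten)
next
  assume *: "\<forall>F. finite F \<longrightarrow> psd (J \<times> F) (flatten S)"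
  show "psd J S"
    unfolding psd_def
  proof
    fix \<xi>
    show "matrix_form J S \<xi> \<xi> \<in> \<real>\<^sub>\<ge>\<^sub>0"
    proof (rule Lim_in_closed_set [OF closed_nonneg_Reals_complex _ finite_subsets_at_top_neq_bot])
      show "\<forall>\<^sub>F F in finite_subsets_at_top UNIV. matrix_form J S (\<lambda>j. finite_vec F (\<lambda>x. blinfun_apply (coord x) (\<xi> j)))
          (\<lambda>i. finite_vec F (\<lambda>x. blinfun_apply (coord x) (\<xi> i))) \<in> \<real>\<^sub>\<ge>\<^sub>0"
      proof (rule eventually_finite_subsets_at_top_weakI)
        fix F :: "'b set" assume "finite F"
        with * have "matrix_form (J \<times> F) (flatten S) (\<lambda>p. blinfun_apply (coord (snd p)) (\<xi> (fst p)))
            (\<lambda>p. blinfun_apply (coord (snd p)) (\<xi> (fst p))) \<in> \<real>\<^sub>\<ge>\<^sub>0"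
          unfolding psd_def by blast
        then show "matrix_form J S (\<lambda>j. finite_vec F (\<lambda>x. blinfun_apply (coord x) (\<xi> j)))
          (\<lambda>i. finite_vec F (\<lambda>x. blinfun_apply (coord x) (\<xi> i))) \<in> \<real>\<^sub>\<ge>\<^sub>0"
          by (simp add: matrix_form_flatten)
      qed
    qed (rule matrix_form_finite_vec_tendsto)
  qed
qed

lemma form_bound_flatten:
  assumes "form_bound J S M" "finite F"
  shows "form_bound (J \<times> F) (flatten S) M"
  using assms unfolding form_bound_def by (simp add: matrix_form_flatten L2_set_flatten)

lemma form_bound_if_flatten:
  fixes S :: "'i \<Rightarrow> 'i \<Rightarrow> (('x, 'h::chilbert_space) l2 \<Rightarrow>\<^sub>L ('x, 'h) l2)"
  assumes M: "0 \<le> M" and fb: "\<And>F. finite F \<Longrightarrow> form_bound (J \<times> F) (flatten S) M"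
  shows "form_bound J S M"
  unfolding form_bound_def
proof (intro allI)
  fix \<xi> \<eta> :: "'i \<Rightarrow> ('x, 'h) l2"
  let ?P = "\<lambda>F (\<zeta> :: ('x, 'h) l2). finite_vec F (\<lambda>x. blinfun_apply (coord x) \<zeta>)"
  show "cmod (matrix_form J S \<xi> \<eta>) \<le> M * L2_set (\<lambda>j. norm (\<xi> j)) J * L2_set (\<lambda>i. norm (\<eta> i)) J"
  proof (rule tendsto_upperbound)
    show "((\<lambda>F. cmod (matrix_form J S (\<lambda>j. ?P F (\<xi> j)) (\<lambda>i. ?P F (\<eta> i)))) \<longlongrightarrow> cmod (matrix_form J S \<xi> \<eta>))
      (finite_subsets_at_top UNIV)"
      by (intro tendsto_norm matrix_form_finite_vec_tendsto)
    show "\<forall>\<^sub>F F in finite_subsets_at_top UNIV. cmod (matrix_form J S (\<lambda>j. ?P F (\<xi> j)) (\<lambda>i. ?P F (\<eta> i)))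
        \<le> M * L2_set (\<lambda>j. norm (\<xi> j)) J * L2_set (\<lambda>i. norm (\<eta> i)) J"
    proof (rule eventually_finite_subsets_at_top_weakI)
      fix F :: "'x set" assume F: "finite F"
      have le: "L2_set (\<lambda>j. norm (?P F (\<zeta> j))) J \<le> L2_set (\<lambda>j. norm (\<zeta> j)) J" for \<zeta>
        using norm_coord_proj_le [OF F] unfolding coord_proj_apply by (intro L2_set_mono) auto
      have "cmod (matrix_form J S (\<lambda>j. ?P F (\<xi> j)) (\<lambda>i. ?P F (\<eta> i)))
          \<le> M * L2_set (\<lambda>j. norm (?P F (\<xi> j))) J * L2_set (\<lambda>i. norm (?P F (\<eta> i))) J"
        using fb [OF F, unfolded form_bound_def, rule_format,
            of "\<lambda>p. blinfun_apply (coord (snd p)) (\<xi> (fst p))" "\<lambda>p. blinfun_apply (coord (snd p)) (\<eta> (fst p))"]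
        unfolding matrix_form_flatten L2_set_flatten [OF F] by simp
      also have "\<dots> \<le> M * L2_set (\<lambda>j. norm (\<xi> j)) J * L2_set (\<lambda>i. norm (\<eta> i)) J"
        using M by (intro mult_mono mult_left_mono le) auto
      finally show "cmod (matrix_form J S (\<lambda>j. ?P F (\<xi> j)) (\<lambda>i. ?P F (\<eta> i)))
        \<le> M * L2_set (\<lambda>j. norm (\<xi> j)) J * L2_set (\<lambda>i. norm (\<eta> i)) J" .
    qed
  qed simp
qed

text \<open>The finitary form of the inequality \<open>\<parallel>S\<^sub>\<phi>\<parallel>\<^sub>c\<^sub>b \<le> C\<close>. It follows both from a dilation and from complete
  boundedness on Hilbert--Schmidt kernels, and it yields the canonical extension.\<close>

definition schur_bound :: "('h::chilbert_space \<Rightarrow>\<^sub>L 'h) set \<Rightarrow>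
    ('x \<Rightarrow> 'x \<Rightarrow> ('h \<Rightarrow>\<^sub>L 'h) \<Rightarrow> ('h \<Rightarrow>\<^sub>L 'h)) \<Rightarrow> real \<Rightarrow> bool" where
  "schur_bound A \<phi> C \<longleftrightarrow> (\<forall>n F a M. finite F \<longrightarrow> 0 \<le> M \<longrightarrow>
    (\<forall>p\<in>{..<n::nat} \<times> F. \<forall>q\<in>{..<n} \<times> F. a p q \<in> A) \<longrightarrow> form_bound ({..<n} \<times> F) a M \<longrightarrow>
    form_bound ({..<n} \<times> F) (\<lambda>p q. \<phi> (snd p) (snd q) (a p q)) (C * M))"

text \<open>This space contains both \<open>K \<otimes> A\<close> and \<open>B(\<ell>\<^sup>2(X)) \<otimes> A\<close>, so both extensions of \<open>S\<^sub>\<phi>\<close> are treated at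
  once.\<close>

definition entry_ops :: "('h::chilbert_space \<Rightarrow>\<^sub>L 'h) set \<Rightarrow> (('x, 'h) l2 \<Rightarrow>\<^sub>L ('x, 'h) l2) set" where
  "entry_ops A = {T \<in> bops. \<forall>x y. matrix_entry T x y \<in> A}"

lemma canonical_extension_eqI:
  assumes "S \<in> bops" "\<And>x y. matrix_entry S x y = \<phi> x y (matrix_entry T x y)"
  shows "canonical_extension \<phi> T = S"
  unfolding canonical_extension_def
proof (rule the_equality)
  show "U = S" if "U \<in> bops \<and> (\<forall>x y. matrix_entry U x y = \<phi> x y (matrix_entry T x y))" for U
    using that assms by (intro blinfun_eq_if_matrix_entry_eq) auto
qed (use assms in blast)

text \<open>The finite truncations of the matrix \<open>(\<phi>(x, y)(T\<^sub>x\<^sub>y))\<close> are bounded by \<open>C \<parallel>T\<parallel>\<close>, by the case of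
  \<open>1 \<times> 1\<close> matrices in \<open>schur_bound\<close>; so the matrix belongs to an operator.\<close>

lemma canonical_extension_entries:
  fixes \<phi> :: "'x \<Rightarrow> 'x \<Rightarrow> ('h::chilbert_space \<Rightarrow>\<^sub>L 'h) \<Rightarrow> ('h \<Rightarrow>\<^sub>L 'h)"
  assumes \<phi>: "\<And>x y a. a \<in> A \<Longrightarrow> \<phi> x y a \<in> bops" and C: "schur_bound A \<phi> C" "0 \<le> C"
    and T: "T \<in> entry_ops A"
  shows "canonical_extension \<phi> T \<in> bops"
    "matrix_entry (canonical_extension \<phi> T) x y = \<phi> x y (matrix_entry T x y)"
proof -
  have ent: "matrix_entry T x y \<in> A" for x y using T by (simp add: entry_ops_def)
  have "form_bound F (\<lambda>x y. \<phi> x y (matrix_entry T x y)) (C * norm T)" if F: "finite F" for F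
  proof -
    have "form_bound ({..<Suc 0} \<times> F) (flatten (\<lambda>_ _. T)) (norm T)"
      by (intro form_bound_flatten F) (simp add: form_bound_single)
    then have "form_bound ({..<Suc 0} \<times> F) (\<lambda>p q. \<phi> (snd p) (snd q) (flatten (\<lambda>_ _. T) p q)) (C * norm T)"
      using C(1)[unfolded schur_bound_def, rule_format, OF F, of "norm T" "Suc 0" "flatten (\<lambda>_ _. T)"] ent
      by (simp add: flatten_def)
    also have "{..<Suc 0} \<times> F = Pair 0 ` F" by auto
    finally show ?thesis
      using form_bound_reindex [of "Pair (0::nat)" F
          "\<lambda>p q. \<phi> (snd p) (snd q) (flatten (\<lambda>_ _. T) p q)" "C * norm T"]
      by (simp add: flatten_def inj_on_def)
  qed
  then have "\<exists>S\<in>bops. (\<forall>x y. matrix_entry S x y = \<phi> x y (matrix_entry T x y)) \<and> norm S \<le> C * norm T"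
    by (intro op_from_matrix \<phi> ent mult_nonneg_nonneg C(2) norm_ge_zero)
  then obtain S where S: "S \<in> bops" "\<And>x y. matrix_entry S x y = \<phi> x y (matrix_entry T x y)"
    by blast
  show "canonical_extension \<phi> T \<in> bops"
    "matrix_entry (canonical_extension \<phi> T) x y = \<phi> x y (matrix_entry T x y)"
    using S canonical_extension_eqI [of S \<phi> T, OF S] by simp_all
qed

lemma canonical_extension_clinear_on:
  fixes \<phi> :: "'x \<Rightarrow> 'x \<Rightarrow> ('h::chilbert_space \<Rightarrow>\<^sub>L 'h) \<Rightarrow> ('h \<Rightarrow>\<^sub>L 'h)"
  assumes \<phi>: "\<And>x y a. a \<in> A \<Longrightarrow> \<phi> x y a \<in> bops" and C: "schur_bound A \<phi> C" "0 \<le> C"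
    and lin: "\<And>x y. clinear_on A (\<phi> x y)" and D: "D \<subseteq> entry_ops A"
  shows "clinear_on D (canonical_extension \<phi>)"
  unfolding clinear_on_def
proof (intro conjI ballI allI)
  note ce = canonical_extension_entries [OF \<phi> C]
  fix S T c assume "S \<in> D" "T \<in> D"
  then have ST: "S \<in> entry_ops A" "T \<in> entry_ops A" using D by auto
  then have ent: "\<And>x y. matrix_entry S x y \<in> A" "\<And>x y. matrix_entry T x y \<in> A" by (auto simp: entry_ops_def)
  show "canonical_extension \<phi> (S + T) = canonical_extension \<phi> S + canonical_extension \<phi> T"
    by (rule canonical_extension_eqI)
      (simp_all add: ce ST complex_vector.subspace_add [OF csubspace_bops] matrix_entry_add
        clinear_onD(1) [OF lin] ent)
next
  note ce = canonical_extension_entries [OF \<phi> C]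
  fix T c assume "T \<in> D"
  then have T: "T \<in> entry_ops A" using D by auto
  then have ent: "\<And>x y. matrix_entry T x y \<in> A" by (auto simp: entry_ops_def)
  show "canonical_extension \<phi> (c *\<^sub>C T) = c *\<^sub>C canonical_extension \<phi> T"
    by (rule canonical_extension_eqI)
      (simp_all add: ce T complex_vector.subspace_scale [OF csubspace_bops] matrix_entry_scaleC
        clinear_onD(2) [OF lin] ent)
qed

lemma flatten_canonical_extension:
  assumes \<phi>: "\<And>x y a. a \<in> A \<Longrightarrow> \<phi> x y a \<in> bops" and C: "schur_bound A \<phi> C" "0 \<le> C"
    and S: "S \<in> mats n (entry_ops A)" "p \<in> {..<n} \<times> F" "q \<in> {..<n} \<times> F"
  shows "flatten (\<lambda>i j. canonical_extension \<phi> (S i j)) p q = \<phi> (snd p) (snd q) (flatten S p q)"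
    "flatten S p q \<in> A"
proof -
  have *: "S (fst p) (fst q) \<in> entry_ops A" using S by (auto simp: mats_def)
  show "flatten (\<lambda>i j. canonical_extension \<phi> (S i j)) p q = \<phi> (snd p) (snd q) (flatten S p q)"
    unfolding flatten_def by (rule canonical_extension_entries(2) [OF \<phi> C *])
  show "flatten S p q \<in> A" using * by (simp add: flatten_def entry_ops_def)
qed

lemma canonical_extension_cb_norm_le:
  fixes \<phi> :: "'x \<Rightarrow> 'x \<Rightarrow> ('h::chilbert_space \<Rightarrow>\<^sub>L 'h) \<Rightarrow> ('h \<Rightarrow>\<^sub>L 'h)"
  assumes \<phi>: "\<And>x y a. a \<in> A \<Longrightarrow> \<phi> x y a \<in> bops" and C: "schur_bound A \<phi> C" "0 \<le> C"
    and D: "D \<subseteq> entry_ops A"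
  shows "cb_norm D (canonical_extension \<phi>) \<le> ennreal C"
proof (rule cb_norm_le [OF C(2)])
  fix n a assume a: "a \<in> mats n D" "form_bound {..<n} a 1"
  then have aD: "a \<in> mats n (entry_ops A)" using D by (auto simp: mats_def)
  show "form_bound {..<n} (\<lambda>i j. canonical_extension \<phi> (a i j)) C"
  proof (rule form_bound_if_flatten [OF C(2)])
    fix F :: "'x set" assume F: "finite F"
    note fl = flatten_canonical_extension [OF \<phi> C aD]
    have "form_bound ({..<n} \<times> F) (\<lambda>p q. \<phi> (snd p) (snd q) (flatten a p q)) (C * 1)"
      using C(1) [unfolded schur_bound_def, rule_format, OF F, of 1 n "flatten a"]
        form_bound_flatten [OF a(2) F] fl(2) by auto
    then show "form_bound ({..<n} \<times> F) (flatten (\<lambda>i j. canonical_extension \<phi> (a i j))) C"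
      by (subst form_bound_cong [OF fl(1)]) simp_all
  qed
qed

lemma positive_type_psd:
  assumes \<phi>: "positive_type A \<phi>" and J: "finite J" and a: "\<And>i j. i \<in> J \<Longrightarrow> j \<in> J \<Longrightarrow> a i j \<in> A"
    and pos: "psd J a"
  shows "psd J (\<lambda>i j. \<phi> (x i) (x j) (a i j))"
proof -
  obtain f where f: "bij_betw f {..<card J} J"
    using ex_bij_betw_nat_finite [OF J] by (auto simp: atLeast0LessThan)
  then have inj: "inj_on f {..<card J}" and im: "f ` {..<card J} = J" by (auto simp: bij_betw_def)
  have "psd {..<card J} (\<lambda>i j. a (f i) (f j))" using pos psd_reindex [OF inj] im by metis
  moreover have "(\<lambda>i j. a (f i) (f j)) \<in> mats (card J) A" using a im by (auto simp: mats_def)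
  ultimately have "psd {..<card J} (\<lambda>i j. \<phi> (x (f i)) (x (f j)) (a (f i) (f j)))"
    using \<phi> [unfolded positive_type_def mat_pos_iff_psd, rule_format,
        where a = "\<lambda>i j. a (f i) (f j)" and m = "card J" and x = "\<lambda>i. x (f i)"] by simp
  then show ?thesis
    using psd_reindex [OF inj, of "\<lambda>i j. \<phi> (x i) (x j) (a i j)"] im by simp
qed

text \<open>A positive \<open>n \<times> n\<close> matrix over operators on \<open>\<ell>\<^sup>2(X, H)\<close> flattens to positive matrices over \<open>A\<close>
  indexed by \<open>{..<n} \<times> F\<close>. Each point of \<open>F\<close> occurs \<open>n\<close> times there, which is why positive type
  has to allow repeated points.\<close>

lemma canonical_extension_completely_positive:
  fixes \<phi> :: "'x \<Rightarrow> 'x \<Rightarrow> ('h::chilbert_space \<Rightarrow>\<^sub>L 'h) \<Rightarrow> ('h \<Rightarrow>\<^sub>L 'h)"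
  assumes \<phi>: "\<And>x y a. a \<in> A \<Longrightarrow> \<phi> x y a \<in> bops" and C: "schur_bound A \<phi> C" "0 \<le> C"
    and lin: "\<And>x y. clinear_on A (\<phi> x y)" and pos: "positive_type A \<phi>" and D: "D \<subseteq> entry_ops A"
  shows "completely_positive D (canonical_extension \<phi>)"
  unfolding completely_positive_def
proof (intro conjI allI ballI impI)
  show "clinear_on D (canonical_extension \<phi>)" by (rule canonical_extension_clinear_on [OF \<phi> C lin D])
  show "canonical_extension \<phi> ` D \<subseteq> bops" using canonical_extension_entries(1) [OF \<phi> C] D by blast
  fix n a assume a: "a \<in> mats n D" "mat_pos n a"
  then have aD: "a \<in> mats n (entry_ops A)" using D by (auto simp: mats_def)
  show "mat_pos n (\<lambda>i j. canonical_extension \<phi> (a i j))"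
    unfolding mat_pos_iff_psd psd_iff_flatten
  proof (intro allI impI)
    fix F :: "'x set" assume F: "finite F"
    note fl = flatten_canonical_extension [OF \<phi> C aD]
    have "psd ({..<n} \<times> F) (\<lambda>p q. \<phi> (snd p) (snd q) (flatten a p q))"
      using a(2) F unfolding mat_pos_iff_psd psd_iff_flatten
      by (intro positive_type_psd [OF pos] fl(2)) auto
    then show "psd ({..<n} \<times> F) (flatten (\<lambda>i j. canonical_extension \<phi> (a i j)))"
      by (subst psd_cong [OF fl(1)]) simp_all
  qed
qed

section \<open>Kolmogorov decomposition of positive definite kernels\<close>

lemma cinner_linear_combinations:
  "cinner (\<Sum>i\<in>I. c i *\<^sub>C u i) (\<Sum>j\<in>J. d j *\<^sub>C w j)
    = (\<Sum>i\<in>I. \<Sum>j\<in>J. c i * cnj (d j) * cinner (u i) (w j))"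
  unfolding cinner.sum_left unfolding cinner.sum_right
  by (simp add: cinner_scaleC_left cinner_scaleC_right mult_ac)

text \<open>Polarisation with two indices and coefficients \<open>1, 1\<close> and \<open>1, \<i>\<close>.\<close>

lemma psd_kernel_hermitian:
  fixes P :: "'i \<Rightarrow> 'i \<Rightarrow> complex"
  assumes psd: "\<And>J c. finite J \<Longrightarrow> (\<Sum>i\<in>J. \<Sum>j\<in>J. c i * cnj (c j) * P i j) \<in> \<real>\<^sub>\<ge>\<^sub>0"
  shows "P i i \<in> \<real>\<^sub>\<ge>\<^sub>0" "P j i = cnj (P i j)"
proof -
  show pos: "P i i \<in> \<real>\<^sub>\<ge>\<^sub>0" for i using psd [of "{i}" "\<lambda>_. 1"] by simp
  have im: "Im (P i i) = 0" for i using pos [of i] by (simp add: complex_nonneg_Reals_iff)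
  show "P j i = cnj (P i j)"
  proof (cases "i = j")
    case True
    then show ?thesis using im by (simp add: complex_eq_iff)
  next
    case False
    then show ?thesis
      using psd [of "{i, j}" "\<lambda>_. 1"] psd [of "{i, j}" "\<lambda>k. if k = i then 1 else \<i>"] im [of i] im [of j]
      by (simp add: complex_nonneg_Reals_iff complex_eq_iff)
  qed
qed

text \<open>Gram--Schmidt along a well-ordering of the index set: the vector for \<open>i\<close> is
  \<open>w + s \<delta>\<^sub>i\<close>, where \<open>w\<close> represents the functional \<open>v\<^sub>j \<mapsto> P j i\<close> on the span of the earlier
  vectors, and \<open>s\<close> corrects the norm. As \<open>v\<^sub>i\<close> is supported on the indices up to \<open>i\<close>, the coordinate
  \<open>\<delta>\<^sub>i\<close> is orthogonal to all earlier vectors.\<close>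

lemma kolmogorov_decomposition:
  fixes P :: "'i \<Rightarrow> 'i \<Rightarrow> complex"
  assumes psd: "\<And>J c. finite J \<Longrightarrow> (\<Sum>i\<in>J. \<Sum>j\<in>J. c i * cnj (c j) * P i j) \<in> \<real>\<^sub>\<ge>\<^sub>0"
  shows "\<exists>v :: 'i \<Rightarrow> ('i, complex) l2. \<forall>i j. cinner (v i) (v j) = P i j"
proof -
  note herm = psd_kernel_hermitian [of P, OF psd]
  obtain r :: "'i rel" where r: "well_order_on UNIV r" using well_order_on by blast
  define R where "R = r - Id"
  have wf: "wf R" using r by (simp add: well_order_on_def R_def)
  have lin: "linear_order_on UNIV r" using r by (simp add: well_order_on_def)
  have tri: "(i, j) \<in> R \<or> i = j \<or> (j, i) \<in> R" for i j
    using lin by (auto simp: R_def linear_order_on_def total_on_def)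
  have trans: "(i, k) \<in> R" if "(i, j) \<in> R" "(j, k) \<in> R" for i j k
    using lin that unfolding R_def linear_order_on_def partial_order_on_def preorder_on_def
    by (auto dest: transD antisymD)
  have irr: "(i, i) \<notin> R" for i by (simp add: R_def)
  define Q where "Q v i u \<longleftrightarrow> (\<forall>j. (j, i) \<in> R \<longrightarrow> cinner u (v j) = P i j) \<and> cinner u u = P i i \<and>
    (\<forall>k. blinfun_apply (coord k) u \<noteq> 0 \<longrightarrow> k = i \<or> (k, i) \<in> R)"
    for v :: "'i \<Rightarrow> ('i, complex) l2" and i u
  have "\<exists>v. \<forall>i. Q v i (v i)"
  proof (rule dependent_wf_choice [OF wf])
    show "Q f i u = Q g i u" if "\<And>j. (j, i) \<in> R \<Longrightarrow> f j = g j" for f g i u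
      using that by (simp add: Q_def)
    fix i and v :: "'i \<Rightarrow> ('i, complex) l2"
    assume IH: "\<And>j. (j, i) \<in> R \<Longrightarrow> Q v j (v j)"
    define I where "I = {j. (j, i) \<in> R}"
    have iI: "i \<notin> I" by (simp add: I_def irr)
    have gram: "cinner (v j) (v k) = P j k" if "j \<in> I" "k \<in> I" for j k
    proof -
      consider "(k, j) \<in> R" | "j = k" | "(j, k) \<in> R" using tri by blast
      then show ?thesis
      proof cases
        case 3
        have "cinner (v k) (v j) = P k j" using IH [of k] that 3 by (simp add: I_def Q_def)
        then show ?thesis using herm(2) [of j k] cinner_commute [of "v j" "v k"] by simp
      qed (use IH [of j] that in \<open>auto simp: I_def Q_def\<close>)
    qed
    have supp: "blinfun_apply (coord k) (v j) = 0" if "j \<in> I" "k \<notin> I" for j k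
    proof (rule ccontr)
      assume "blinfun_apply (coord k) (v j) \<noteq> 0"
      then have "k = j \<or> (k, j) \<in> R" using IH [of j] that(1) unfolding I_def Q_def by blast
      then show False using trans that by (auto simp: I_def)
    qed
    define M where "M = sqrt (Re (P i i))"
    have Pii: "0 \<le> Re (P i i)" "P i i = of_real (Re (P i i))"
      using herm(1) [of i] by (simp_all add: complex_nonneg_Reals_iff complex_eq_iff)
    have M: "0 \<le> M" "M\<^sup>2 = Re (P i i)" using Pii by (simp_all add: M_def)
    \<comment> \<open>Cauchy--Schwarz for the kernel: positivity on \<open>insert i J\<close> with coefficient \<open>1\<close> at \<open>i\<close>.\<close>
    have bound: "norm (\<Sum>j\<in>J. c j *\<^sub>C P j i) \<le> M * norm (\<Sum>j\<in>J. c j *\<^sub>C v j)"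
      if J: "finite J" "J \<subseteq> I" for J c
    proof -
      define z where "z = (\<Sum>j\<in>J. c j *\<^sub>C P j i)"
      define \<beta> where "\<beta> = (norm (\<Sum>j\<in>J. c j *\<^sub>C v j))\<^sup>2"
      have \<beta>: "(\<Sum>j\<in>J. \<Sum>k\<in>J. c j * cnj (c k) * P j k) = of_real \<beta>"
      proof -
        have "of_real \<beta> = cinner (\<Sum>j\<in>J. c j *\<^sub>C v j) (\<Sum>k\<in>J. c k *\<^sub>C v k)"
          by (simp add: \<beta>_def cinner_self)
        also have "\<dots> = (\<Sum>j\<in>J. \<Sum>k\<in>J. c j * cnj (c k) * P j k)"
          unfolding cinner_linear_combinations using J by (intro sum.cong refl) (auto simp: gram subset_iff)
        finally show ?thesis by simp
      qed
      have "(cmod z)\<^sup>2 \<le> Re (P i i) * \<beta>"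
      proof (rule discriminant_le)
        fix s :: complex
        define d where "d j = (if j = i then 1 else s * c j)" for j
        have iJ: "i \<notin> J" using J iI by blast
        have dJ: "d j = s * c j" if "j \<in> J" for j using that iJ by (auto simp: d_def)
        have conj: "(\<Sum>k\<in>J. cnj (d k) * P i k) = cnj (s * z)"
          unfolding z_def cnj_sum complex_cnj_mult sum_distrib_left
          by (intro sum.cong refl) (simp add: dJ scaleC_complex_def herm(2) [of i])
        have "(\<Sum>j\<in>insert i J. \<Sum>k\<in>insert i J. d j * cnj (d k) * P j k)
            = P i i + (\<Sum>k\<in>J. cnj (d k) * P i k) + (\<Sum>j\<in>J. d j * P j i)
              + (\<Sum>j\<in>J. \<Sum>k\<in>J. d j * cnj (d k) * P j k)"
          using J(1) iJ by (simp add: sum.distrib) (simp add: d_def)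
        also have "(\<Sum>j\<in>J. d j * P j i) = s * z"
          by (simp add: z_def sum_distrib_left dJ scaleC_complex_def mult.assoc)
        also have "(\<Sum>j\<in>J. \<Sum>k\<in>J. d j * cnj (d k) * P j k) = s * cnj s * of_real \<beta>"
          unfolding \<beta> [symmetric] by (simp add: sum_distrib_left dJ mult_ac)
        finally have expand: "(\<Sum>j\<in>insert i J. \<Sum>k\<in>insert i J. d j * cnj (d k) * P j k)
            = P i i + cnj (s * z) + s * z + s * cnj s * of_real \<beta>"
          unfolding conj .
        have "s * cnj s * of_real \<beta> = of_real ((cmod s)\<^sup>2 * \<beta>)"
          using complex_norm_square [of s] by simp
        moreover have "0 \<le> Re (P i i + cnj (s * z) + s * z + s * cnj s * of_real \<beta>)"
          using psd [of "insert i J" d] J(1) unfolding expand complex_nonneg_Reals_iff by simp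
        ultimately show "0 \<le> Re (P i i) + 2 * Re (s * z) + (cmod s)\<^sup>2 * \<beta>"
          by (simp only: plus_complex.sel Re_complex_of_real complex_cnj) simp
      qed (simp add: \<beta>_def)
      then have "(cmod z)\<^sup>2 \<le> (M * norm (\<Sum>j\<in>J. c j *\<^sub>C v j))\<^sup>2"
        by (simp add: power_mult_distrib M \<beta>_def)
      then show ?thesis unfolding z_def [symmetric] by (rule power2_le_imp_le) (simp add: M)
    qed
    obtain T :: "('i, complex) l2 \<Rightarrow>\<^sub>L complex" where T: "T \<in> bops" "\<And>j. j \<in> I \<Longrightarrow> blinfun_apply T (v j) = P j i"
        "\<And>z. (\<And>j. j \<in> I \<Longrightarrow> cinner z (v j) = 0) \<Longrightarrow> blinfun_apply T z = 0" "norm T \<le> M"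
      by (rule bounded_family_extension [of M I "\<lambda>j. P j i" v])
        (rule M, erule (1) bound, (rule that; blast))
    define w where "w = blinfun_apply (adj T) 1"
    have w: "cinner x w = blinfun_apply T x" for x
      using cinner_adj [OF T(1), of x 1] by (simp add: w_def cinner_complex_def)
    have wv: "cinner w (v j) = P i j" if "j \<in> I" for j
      using w [of "v j"] T(2) [OF that] herm(2) [of i j] cinner_commute [of w "v j"] by simp
    have w_supp: "blinfun_apply (coord k) w = 0" if k: "k \<notin> I" for k
    proof -
      have "blinfun_apply T (blinfun_apply (emb k) 1) = 0"
        by (rule T(3)) (simp add: cinner_emb supp k cinner.zero_right)
      then have "cinner (1::complex) (blinfun_apply (coord k) w) = 0"
        by (simp add: w [symmetric] cinner_emb)
      then show ?thesis by (simp add: cinner_complex_def)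
    qed
    have "norm w \<le> M"
      using norm_blinfun [of "adj T" 1] norm_adj_le [OF T(1)] T(4) by (simp add: w_def)
    then have w_norm: "(norm w)\<^sup>2 \<le> Re (P i i)" using M(2) power_mono [OF _ norm_ge_zero] by metis
    define s where "s = sqrt (Re (P i i) - (norm w)\<^sup>2)"
    define e where "e = blinfun_apply (emb i) (of_real s :: complex)"
    have ce: "cinner e x = s * cnj (blinfun_apply (coord i) x)" for x
      by (simp add: e_def cinner_emb cinner_complex_def)
    have "cinner (w + e) (v j) = P i j" if "(j, i) \<in> R" for j
    proof -
      have "j \<in> I" using that by (simp add: I_def)
      then show ?thesis using iI by (simp add: cinner_add_left wv ce supp)
    qed
    moreover have "cinner (w + e) (w + e) = P i i"
    proof -
      have ew: "cinner e w = 0" using iI by (simp add: ce w_supp)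
      then have we: "cinner w e = 0" by (simp add: cinner_eq_0_commute)
      have ee: "cinner e e = of_real (s\<^sup>2)" unfolding ce by (simp add: e_def coord_emb power2_eq_square)
      have "cinner (w + e) (w + e) = of_real ((norm w)\<^sup>2 + s\<^sup>2)"
        unfolding cinner_add_left cinner_add_right ew we ee by (simp add: cinner_self)
      also have "(norm w)\<^sup>2 + s\<^sup>2 = Re (P i i)" using w_norm by (simp add: s_def)
      finally show ?thesis using Pii(2) by simp
    qed
    moreover have "k = i \<or> (k, i) \<in> R" if "blinfun_apply (coord k) (w + e) \<noteq> 0" for k
    proof (rule ccontr)
      assume "\<not> (k = i \<or> (k, i) \<in> R)"
      then show False using that w_supp [of k] by (simp add: I_def blinfun.add_right e_def coord_emb)
    qed
    ultimately have "Q v i (w + e)" unfolding Q_def by blast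
    then show "\<exists>u. Q v i u" ..
  qed
  then obtain v where v: "\<And>i. Q v i (v i)" by blast
  have "cinner (v i) (v j) = P i j" for i j
  proof -
    consider "(j, i) \<in> R" | "i = j" | "(i, j) \<in> R" using tri by blast
    then show ?thesis
    proof cases
      case 3
      then have "cinner (v j) (v i) = P j i" using v [of j] by (simp add: Q_def)
      then show ?thesis using herm(2) [of i j] cinner_commute [of "v i" "v j"] by simp
    qed (use v [of i] in \<open>auto simp: Q_def\<close>)
  qed
  then show ?thesis by blast
qed

section \<open>From positive type to a dilation\<close>

lemma compose_assoc: "(S o\<^sub>L T) o\<^sub>L U = S o\<^sub>L (T o\<^sub>L U)"
  by (rule blinfun_eqI) simp

lemma matrix_form_gram:
  assumes "\<And>i. i \<in> J \<Longrightarrow> b i \<in> bops"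
  shows "matrix_form J (\<lambda>i j. adj (b i) o\<^sub>L b j) \<xi> \<xi>
    = of_real ((norm (\<Sum>j\<in>J. blinfun_apply (b j) (\<xi> j)))\<^sup>2)"
proof -
  have "matrix_form J (\<lambda>i j. adj (b i) o\<^sub>L b j) \<xi> \<xi>
      = (\<Sum>i\<in>J. \<Sum>j\<in>J. cinner (blinfun_apply (b j) (\<xi> j)) (blinfun_apply (b i) (\<xi> i)))"
    unfolding matrix_form_def using assms by (intro sum.cong refl) (simp add: cinner_adj_left)
  also have "\<dots> = (\<Sum>j\<in>J. \<Sum>i\<in>J. cinner (blinfun_apply (b j) (\<xi> j)) (blinfun_apply (b i) (\<xi> i)))"
    by (rule sum.swap)
  also have "\<dots> = cinner (\<Sum>j\<in>J. blinfun_apply (b j) (\<xi> j)) (\<Sum>j\<in>J. blinfun_apply (b j) (\<xi> j))"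
    unfolding cinner.sum_left unfolding cinner.sum_right ..
  finally show ?thesis by (simp add: cinner_self)
qed

text \<open>The space \<open>K\<close> is generated by vectors \<open>v(a, x, h)\<close>, to be thought of as \<open>\<rho>(a) V(x) h\<close>, with
  inner products \<open>\<langle>v(a, x, h), v(b, y, g)\<rangle> = \<langle>\<phi>(y, x)(b\<^sup>* a) h, g\<rangle>\<close>. Left multiplication on \<open>a\<close> gives
  \<open>\<rho>\<close>, and \<open>V(x)\<^sup>*\<close> is \<open>v(a, y, h) \<mapsto> \<phi>(x, y)(a) h\<close>. Testing with \<open>v(e, x, g)\<close> for an approximate
  unit \<open>e\<close> shows that \<open>V(x)\<^sup>*\<close> is bounded, with the sharp constant.\<close>

lemma positive_type_imp_dilation:
  fixes A :: "('h::chilbert_space \<Rightarrow>\<^sub>L 'h) set"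
    and \<phi> :: "'x \<Rightarrow> 'x \<Rightarrow> ('h \<Rightarrow>\<^sub>L 'h) \<Rightarrow> ('h \<Rightarrow>\<^sub>L 'h)"
  assumes A: "cstar_subalgebra A" and lin: "\<And>x y. clinear_on A (\<phi> x y)"
    and \<phi>b: "\<And>x y a. a \<in> A \<Longrightarrow> \<phi> x y a \<in> bops"
    and C: "\<And>x y a. a \<in> A \<Longrightarrow> norm (\<phi> x y a) \<le> C * norm a" "0 \<le> C"
    and pos: "positive_type A \<phi>"
  shows "\<exists>(K :: ('x, 'h) dilation_space set) \<rho> V. dilation A \<phi> K \<rho> V \<and>
    (\<forall>x B. (\<forall>a\<in>A. norm a \<le> 1 \<longrightarrow> norm (\<phi> x x a) \<le> B) \<longrightarrow> (norm (V x))\<^sup>2 \<le> B)"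
proof -
  note A' = cstar_subalgebraD [OF A]
  have zero: "0 \<in> A" by (rule complex_vector.subspace_0 [OF A'(2)])
  have Ab: "\<And>a. a \<in> A \<Longrightarrow> a \<in> bops" using A'(1) by blast
  \<comment> \<open>The index set of the kernel contains all operators; those outside \<open>A\<close> are replaced by \<open>0\<close>.\<close>
  define clip where "clip a = (if a \<in> A then a else 0)" for a
  have clip: "\<And>a. clip a \<in> A" "\<And>a. a \<in> A \<Longrightarrow> clip a = a" using zero by (auto simp: clip_def)
  define op where "op i = clip (fst i)" for i :: "('h \<Rightarrow>\<^sub>L 'h) \<times> 'x \<times> 'h"
  define pt where "pt i = fst (snd i)" for i :: "('h \<Rightarrow>\<^sub>L 'h) \<times> 'x \<times> 'h"
  define vc where "vc i = snd (snd i)" for i :: "('h \<Rightarrow>\<^sub>L 'h) \<times> 'x \<times> 'h"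
  have opA: "op i \<in> A" for i by (simp add: op_def clip)
  have op_pair: "op (a, x, h) = clip a" "pt (a, x, h) = x" "vc (a, x, h) = h" for a x h
    by (simp_all add: op_def pt_def vc_def)
  define P where "P i j = cinner (blinfun_apply (\<phi> (pt j) (pt i) (adj (op j) o\<^sub>L op i)) (vc i)) (vc j)" for i j
  have P_form: "(\<Sum>i\<in>J. \<Sum>j\<in>J. c i * cnj (c j) * P i j)
      = matrix_form J (\<lambda>i j. \<phi> (pt i) (pt j) (adj (op i) o\<^sub>L op j)) (\<lambda>i. c i *\<^sub>C vc i) (\<lambda>i. c i *\<^sub>C vc i)" for J c
  proof -
    have "(\<Sum>i\<in>J. \<Sum>j\<in>J. c i * cnj (c j) * P i j) = (\<Sum>j\<in>J. \<Sum>i\<in>J. c i * cnj (c j) * P i j)" by (rule sum.swap)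
    also have "\<dots> = matrix_form J (\<lambda>i j. \<phi> (pt i) (pt j) (adj (op i) o\<^sub>L op j)) (\<lambda>i. c i *\<^sub>C vc i) (\<lambda>i. c i *\<^sub>C vc i)"
      unfolding matrix_form_def
      by (intro sum.cong refl)
        (simp add: P_def bops_apply_scaleC [OF \<phi>b] A' opA cinner_simps mult_ac)
    finally show ?thesis .
  qed
  have "psd J (\<lambda>i j. adj (op i) o\<^sub>L op j)" for J
    unfolding psd_def by (simp add: matrix_form_gram Ab opA del: of_real_power)
  then have "psd J (\<lambda>i j. \<phi> (pt i) (pt j) (adj (op i) o\<^sub>L op j))" if "finite J" for J
    using that by (intro positive_type_psd [OF pos] A' opA)
  then have P_psd: "(\<Sum>i\<in>J. \<Sum>j\<in>J. c i * cnj (c j) * P i j) \<in> \<real>\<^sub>\<ge>\<^sub>0" if "finite J" for J c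
    using that unfolding P_form by (simp add: psd_def)
  obtain v :: "('h \<Rightarrow>\<^sub>L 'h) \<times> 'x \<times> 'h \<Rightarrow> ('x, 'h) dilation_space" where v: "\<And>i j. cinner (v i) (v j) = P i j"
    using kolmogorov_decomposition [of P, OF P_psd] by blast
  define K where "K = closure (cspan (range v))"
  have K: "csubspace K" "closed K"
    by (simp_all add: K_def csubspace_closure complex_vector.subspace_span)
  have vK: "v i \<in> K" for i
    unfolding K_def using complex_vector.span_base [of "v i" "range v"] closure_subset by blast
  have orthK: "cinner u w = 0" if "\<And>i. cinner u (v i) = 0" "w \<in> K" for u w
    using that unfolding K_def by (auto intro: cinner_zero_on_closure_cspan [of "range v"])
  have K_eqI: "e = f" if "e \<in> K" "f \<in> K" "\<And>j. cinner e (v j) = cinner f (v j)" for e f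
  proof -
    have "cinner (e - f) (e - f) = 0"
    proof (rule orthK)
      show "cinner (e - f) (v i) = 0" for i using that(3) by (simp add: cinner.diff_left)
      show "e - f \<in> K" by (rule csubspace_diff [OF K(1) that(1,2)])
    qed
    then show ?thesis by (simp add: cinner_self)
  qed
  have op_eqI: "S = T" if S: "S \<in> bops" "\<And>z. (\<And>i. cinner z (v i) = 0) \<Longrightarrow> blinfun_apply S z = 0"
    and T: "T \<in> bops" "\<And>z. (\<And>i. cinner z (v i) = 0) \<Longrightarrow> blinfun_apply T z = 0"
    and eq: "\<And>i. blinfun_apply S (v i) = blinfun_apply T (v i)"
    for S T :: "('x, 'h) dilation_space \<Rightarrow>\<^sub>L ('x, 'h) dilation_space"
  proof (rule blinfun_eqI)
    fix x
    have "csubspace {x. blinfun_apply S x = blinfun_apply T x}"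
      by (rule complex_vector.subspaceI)
        (auto simp: blinfun.zero_right blinfun.add_right bops_apply_scaleC S(1) T(1))
    then have "cspan (range v) \<subseteq> {x. blinfun_apply S x = blinfun_apply T x}"
      using eq by (intro complex_vector.span_minimal) auto
    moreover have "closed {x. blinfun_apply S x = blinfun_apply T x}"
      by (intro closed_Collect_eq continuous_intros)
    ultimately have KST: "blinfun_apply S x = blinfun_apply T x" if "x \<in> K" for x
      using that closure_minimal unfolding K_def by blast
    obtain p where p: "p \<in> K" "\<And>w. w \<in> K \<Longrightarrow> cinner (x - p) w = 0"
      using orthogonal_projection_exists [OF K, of x] by blast
    have "blinfun_apply S (x - p) = 0" "blinfun_apply T (x - p) = 0"
      using p(2) vK by (auto intro!: S(2) T(2))
    then show "blinfun_apply S x = blinfun_apply T x" using KST [OF p(1)] by (simp add: blinfun.diff_right)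
  qed
  have v_norm: "(norm (\<Sum>i\<in>J. c i *\<^sub>C v i))\<^sup>2 = Re (matrix_form J
      (\<lambda>i j. \<phi> (pt i) (pt j) (adj (op i) o\<^sub>L op j)) (\<lambda>i. c i *\<^sub>C vc i) (\<lambda>i. c i *\<^sub>C vc i))" for J c
    unfolding P_form [symmetric] norm_sq_eq_cinner
    by (simp add: cinner_linear_combinations v)

  define act where "act a i = (a o\<^sub>L op i, pt i, vc i)" for a :: "'h \<Rightarrow>\<^sub>L 'h" and i
  have op_act: "op (act a i) = a o\<^sub>L op i" "pt (act a i) = pt i" "vc (act a i) = vc i" if "a \<in> A" for a i
    using that by (simp_all add: act_def op_pair clip A' opA)
  \<comment> \<open>The matrix of \<open>b\<^sub>i\<^sup>* (\<parallel>a\<parallel>\<^sup>2 - a\<^sup>* a) b\<^sub>j\<close> is positive.\<close>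
  have act_bound: "norm (\<Sum>i\<in>J. c i *\<^sub>C v (act a i)) \<le> norm a * norm (\<Sum>i\<in>J. c i *\<^sub>C v i)"
    if a: "a \<in> A" and J: "finite J" for a J c
  proof -
    define d where "d i j = (norm a)\<^sup>2 *\<^sub>R (adj (op i) o\<^sub>L op j) - (adj (a o\<^sub>L op i) o\<^sub>L (a o\<^sub>L op j))" for i j
    have form_d: "matrix_form J (\<lambda>i j. r *\<^sub>R f i j - g i j) \<xi> \<eta> = of_real r * matrix_form J f \<xi> \<eta> - matrix_form J g \<xi> \<eta>"
      for r and f g :: "('h \<Rightarrow>\<^sub>L 'h) \<times> 'x \<times> 'h \<Rightarrow> ('h \<Rightarrow>\<^sub>L 'h) \<times> 'x \<times> 'h \<Rightarrow> ('h \<Rightarrow>\<^sub>L 'h)" and \<xi> \<eta>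
      by (simp add: matrix_form_def blinfun.bilinear_simps cinner.diff_left cinner.scaleR_left
          scaleR_conv_of_real sum_subtractf sum_distrib_left)
    have "psd J d"
      unfolding psd_def
    proof
      fix \<xi>
      define y where "y = (\<Sum>j\<in>J. blinfun_apply (op j) (\<xi> j))"
      have "matrix_form J d \<xi> \<xi> = of_real ((norm a)\<^sup>2) * of_real ((norm y)\<^sup>2) - of_real ((norm (blinfun_apply a y))\<^sup>2)"
        unfolding d_def form_d
        by (simp add: matrix_form_gram Ab opA A' a y_def blinfun.sum_right del: of_real_power)
      also have "\<dots> = of_real ((norm a * norm y)\<^sup>2 - (norm (blinfun_apply a y))\<^sup>2)"
        by (simp add: power_mult_distrib)
      also have "\<dots> \<in> \<real>\<^sub>\<ge>\<^sub>0"
        using power_mono [OF norm_blinfun norm_ge_zero, of a y 2] unfolding nonneg_Reals_of_real_iff by simp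
      finally show "matrix_form J d \<xi> \<xi> \<in> \<real>\<^sub>\<ge>\<^sub>0" .
    qed
    moreover have dA: "d i j \<in> A" for i j
      unfolding d_def by (intro csubspace_diff csubspace_scaleR A' opA a)
    ultimately have "psd J (\<lambda>i j. \<phi> (pt i) (pt j) (d i j))"
      by (intro positive_type_psd [OF pos J])
    moreover have "\<phi> (pt i) (pt j) (d i j) = (norm a)\<^sup>2 *\<^sub>R \<phi> (pt i) (pt j) (adj (op i) o\<^sub>L op j)
        - \<phi> (pt i) (pt j) (adj (a o\<^sub>L op i) o\<^sub>L (a o\<^sub>L op j))" for i j
      unfolding d_def
      by (subst clinear_on_diff [OF lin A'(2)])
        (simp_all add: A' opA a csubspace_scaleR clinear_onD(3) [OF lin])
    ultimately have "0 \<le> Re (matrix_form J (\<lambda>i j. (norm a)\<^sup>2 *\<^sub>R \<phi> (pt i) (pt j) (adj (op i) o\<^sub>L op j)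
        - \<phi> (pt i) (pt j) (adj (a o\<^sub>L op i) o\<^sub>L (a o\<^sub>L op j))) (\<lambda>i. c i *\<^sub>C vc i) (\<lambda>i. c i *\<^sub>C vc i))"
      by (simp add: psd_def complex_nonneg_Reals_iff)
    moreover have "(norm (\<Sum>i\<in>J. c i *\<^sub>C v (act a i)))\<^sup>2 = Re (matrix_form J
        (\<lambda>i j. \<phi> (pt i) (pt j) (adj (a o\<^sub>L op i) o\<^sub>L (a o\<^sub>L op j))) (\<lambda>i. c i *\<^sub>C vc i) (\<lambda>i. c i *\<^sub>C vc i))"
      unfolding norm_sq_eq_cinner matrix_form_def cinner_linear_combinations
      by (subst sum.swap)
        (simp add: v P_def op_act a bops_apply_scaleC [OF \<phi>b] A' opA cinner_simps mult_ac)
    ultimately have "(norm (\<Sum>i\<in>J. c i *\<^sub>C v (act a i)))\<^sup>2 \<le> (norm a)\<^sup>2 * (norm (\<Sum>i\<in>J. c i *\<^sub>C v i))\<^sup>2"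
      unfolding form_d v_norm by simp
    then have "(norm (\<Sum>i\<in>J. c i *\<^sub>C v (act a i)))\<^sup>2 \<le> (norm a * norm (\<Sum>i\<in>J. c i *\<^sub>C v i))\<^sup>2"
      by (simp add: power_mult_distrib)
    then show ?thesis by (rule power2_le_imp_le) simp
  qed
  have "\<exists>T. T \<in> bops \<and> (\<forall>i. blinfun_apply T (v i) = v (act a i)) \<and>
      (\<forall>z. (\<forall>i. cinner z (v i) = 0) \<longrightarrow> blinfun_apply T z = 0) \<and> range (blinfun_apply T) \<subseteq> K" if a: "a \<in> A" for a
  proof (rule bounded_family_extension [of "norm a" UNIV "\<lambda>i. v (act a i)" v])
    show "norm (\<Sum>i\<in>J. c i *\<^sub>C v (act a i)) \<le> norm a * norm (\<Sum>i\<in>J. c i *\<^sub>C v i)" if "finite J" for J c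
      by (rule act_bound [OF a that])
    fix T :: "('x, 'h) dilation_space \<Rightarrow>\<^sub>L ('x, 'h) dilation_space"
    assume T: "T \<in> bops" "\<And>i. i \<in> UNIV \<Longrightarrow> blinfun_apply T (v i) = v (act a i)"
      "\<And>z. (\<And>i. i \<in> UNIV \<Longrightarrow> cinner z (v i) = 0) \<Longrightarrow> blinfun_apply T z = 0"
      "range (blinfun_apply T) \<subseteq> closure (cspan (range (\<lambda>i. v (act a i))))"
    have "cspan (range (\<lambda>i. v (act a i))) \<subseteq> cspan (range v)" by (intro complex_vector.span_mono) auto
    then have "range (blinfun_apply T) \<subseteq> K" unfolding K_def using T(4) closure_mono by blast
    with T show ?thesis by auto
  qed simp
  then have "\<exists>\<rho>. \<forall>a\<in>A. \<rho> a \<in> bops \<and> (\<forall>i. blinfun_apply (\<rho> a) (v i) = v (act a i)) \<and>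
      (\<forall>z. (\<forall>i. cinner z (v i) = 0) \<longrightarrow> blinfun_apply (\<rho> a) z = 0) \<and> range (blinfun_apply (\<rho> a)) \<subseteq> K"
    by (intro bchoice ballI)
  then obtain \<rho> where \<rho>: "\<And>a. a \<in> A \<Longrightarrow> \<rho> a \<in> bops" "\<And>a i. a \<in> A \<Longrightarrow> blinfun_apply (\<rho> a) (v i) = v (act a i)"
      "\<And>a z. a \<in> A \<Longrightarrow> (\<And>i. cinner z (v i) = 0) \<Longrightarrow> blinfun_apply (\<rho> a) z = 0"
      "\<And>a u. a \<in> A \<Longrightarrow> blinfun_apply (\<rho> a) u \<in> K"
    by (fastforce simp: image_subset_iff)
  have \<rho>_adj_K: "blinfun_apply (adj (\<rho> a)) u \<in> K" if a: "a \<in> A" for a u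
  proof (rule double_orthogonal_complement [OF K])
    fix z assume "\<And>w. w \<in> K \<Longrightarrow> cinner z w = 0"
    then have "blinfun_apply (\<rho> a) z = 0" using vK by (intro \<rho>(3) a) auto
    then show "cinner z (blinfun_apply (adj (\<rho> a)) u) = 0"
      using cinner_adj [OF \<rho>(1) [OF a], of z u] by (simp add: cinner.zero_left)
  qed
  have \<rho>_adj: "\<rho> (adj a) = adj (\<rho> a)" if a: "a \<in> A" for a
  proof (rule op_eqI)
    show "\<rho> (adj a) \<in> bops" "adj (\<rho> a) \<in> bops" by (intro adj_bops \<rho>(1) A'(5) a)+
    show "blinfun_apply (\<rho> (adj a)) z = 0" if "\<And>i. cinner z (v i) = 0" for z
      using A'(5) [OF a] that by (rule \<rho>(3))
    show "blinfun_apply (adj (\<rho> a)) z = 0" if z: "\<And>i. cinner z (v i) = 0" for z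
    proof -
      have "cinner (blinfun_apply (adj (\<rho> a)) z) w = 0" for w
        using orthK [OF z \<rho>(4) [OF a]] by (simp add: cinner_adj_left \<rho>(1) a)
      from this [of "blinfun_apply (adj (\<rho> a)) z"] show ?thesis by (simp add: cinner_self)
    qed
    show "blinfun_apply (\<rho> (adj a)) (v i) = blinfun_apply (adj (\<rho> a)) (v i)" for i
    proof (rule K_eqI)
      fix j
      show "cinner (blinfun_apply (\<rho> (adj a)) (v i)) (v j) = cinner (blinfun_apply (adj (\<rho> a)) (v i)) (v j)"
        using a by (simp add: cinner_adj_left \<rho> A' v P_def op_act adj_compose Ab opA adj_bops compose_assoc)
    qed (auto intro: \<rho>(4) A' a \<rho>_adj_K)
  qed
  have v_lin: "cinner (v (act (a + b) i)) (v j) = cinner (v (act a i)) (v j) + cinner (v (act b i)) (v j)"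
    "cinner (v (act (c *\<^sub>C a) i)) (v j) = c * cinner (v (act a i)) (v j)"
    if ab: "a \<in> A" "b \<in> A" for a b c i j
    using ab
    by (simp_all add: v P_def op_act complex_vector.subspace_add [OF A'(2)] complex_vector.subspace_scale [OF A'(2)]
        compose_add_left compose_add_right compose_scaleC_left compose_scaleC_right A' opA adj_bops Ab
        clinear_onD [OF lin] blinfun.add_left cinner_simps)
  have \<rho>_lin: "clinear_on A \<rho>"
    unfolding clinear_on_def
  proof (intro conjI ballI allI)
    fix a b assume ab: "a \<in> A" "b \<in> A"
    have sum: "a + b \<in> A" using ab by (rule complex_vector.subspace_add [OF A'(2)])
    show "\<rho> (a + b) = \<rho> a + \<rho> b"
    proof (rule op_eqI)
      show "\<rho> (a + b) \<in> bops" "\<rho> a + \<rho> b \<in> bops"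
        using ab sum by (auto intro: \<rho>(1) complex_vector.subspace_add [OF csubspace_bops])
      show "blinfun_apply (\<rho> (a + b)) z = 0" "blinfun_apply (\<rho> a + \<rho> b) z = 0"
        if "\<And>i. cinner z (v i) = 0" for z
        using \<rho>(3) [OF sum that] \<rho>(3) [OF ab(1) that] \<rho>(3) [OF ab(2) that]
        by (simp_all add: blinfun.add_left)
      fix i
      show "blinfun_apply (\<rho> (a + b)) (v i) = blinfun_apply (\<rho> a + \<rho> b) (v i)"
        using ab complex_vector.subspace_add [OF A'(2) ab] complex_vector.subspace_add [OF K(1)]
        by (intro K_eqI) (auto simp: \<rho> blinfun.add_left v_lin cinner_add_left vK)
    qed
  next
    fix c a assume a: "a \<in> A"
    have ca: "c *\<^sub>C a \<in> A" using a by (rule complex_vector.subspace_scale [OF A'(2)])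
    show "\<rho> (c *\<^sub>C a) = c *\<^sub>C \<rho> a"
    proof (rule op_eqI)
      show "\<rho> (c *\<^sub>C a) \<in> bops" "c *\<^sub>C \<rho> a \<in> bops"
        using a ca by (auto intro: \<rho>(1) complex_vector.subspace_scale [OF csubspace_bops])
      show "blinfun_apply (\<rho> (c *\<^sub>C a)) z = 0" "blinfun_apply (c *\<^sub>C \<rho> a) z = 0"
        if "\<And>i. cinner z (v i) = 0" for z
        using \<rho>(3) [OF ca that] \<rho>(3) [OF a that] by simp_all
      fix i
      show "blinfun_apply (\<rho> (c *\<^sub>C a)) (v i) = blinfun_apply (c *\<^sub>C \<rho> a) (v i)"
        using a complex_vector.subspace_scale [OF A'(2) a] complex_vector.subspace_scale [OF K(1)]
        by (intro K_eqI) (auto simp: \<rho> v_lin(2) [OF a a] cinner_scaleC_left vK)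
    qed
  qed
  have \<rho>_mult: "\<rho> (a o\<^sub>L b) = \<rho> a o\<^sub>L \<rho> b" if ab: "a \<in> A" "b \<in> A" for a b
  proof (rule op_eqI)
    show "\<rho> (a o\<^sub>L b) \<in> bops" "\<rho> a o\<^sub>L \<rho> b \<in> bops"
      using ab by (auto intro: \<rho>(1) A'(4) bops_compose)
    show "blinfun_apply (\<rho> (a o\<^sub>L b)) z = 0" "blinfun_apply (\<rho> a o\<^sub>L \<rho> b) z = 0"
      if "\<And>i. cinner z (v i) = 0" for z
      using \<rho>(3) [OF A'(4) [OF ab] that] \<rho>(3) [OF ab(2) that] by (simp_all add: blinfun.zero_right)
    fix i
    have "act (a o\<^sub>L b) i = act a (act b i)"
      using ab by (simp add: act_def [of _ "act b i"] op_act) (simp add: act_def compose_assoc)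
    then show "blinfun_apply (\<rho> (a o\<^sub>L b)) (v i) = blinfun_apply (\<rho> a o\<^sub>L \<rho> b) (v i)"
      using ab by (simp add: \<rho> A')
  qed
  have v_diff: "v (a, x, h) - v (b, x, h) = v (a - b, x, h)" if ab: "a \<in> A" "b \<in> A" for a b x h
  proof (rule K_eqI)
    show "cinner (v (a, x, h) - v (b, x, h)) (v j) = cinner (v (a - b, x, h)) (v j)" for j
      using ab
      by (simp add: cinner.diff_left v P_def op_pair clip csubspace_diff [OF A'(2)] compose_diff_right
          clinear_on_diff [OF lin A'(2)] A' opA blinfun.diff_left)
  qed (auto intro: csubspace_diff [OF K(1)] vK)
  have v_single: "(norm (v (a, x, h)))\<^sup>2 \<le> norm (\<phi> x x (adj a o\<^sub>L a)) * (norm h)\<^sup>2" if a: "a \<in> A" for a x h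
    using Re_cinner_apply_le [of "\<phi> x x (adj a o\<^sub>L a)" h] a
    by (simp add: norm_sq_eq_cinner v P_def op_pair clip) 
  have act_small: "norm (v (a, x, h)) \<le> sqrt C * norm a * norm h" if a: "a \<in> A" for a x h
  proof -
    have "norm (\<phi> x x (adj a o\<^sub>L a)) \<le> C * norm (adj a o\<^sub>L a)" using a by (intro C(1) A')
    also have "\<dots> \<le> C * (norm a)\<^sup>2" by (intro mult_left_mono norm_adj_compose_self Ab a C(2))
    finally have "(norm (v (a, x, h)))\<^sup>2 \<le> C * (norm a)\<^sup>2 * (norm h)\<^sup>2"
      using v_single [OF a, of x h] mult_right_mono [OF _ zero_le_power2] order_trans by blast
    also have "\<dots> = (sqrt C * norm a * norm h)\<^sup>2" using C(2) by (simp add: power_mult_distrib)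
    finally show ?thesis by (rule power2_le_imp_le) (simp add: C(2))
  qed
  \<comment> \<open>\<open>v(e b, x, h) = \<rho>(e) v(b, x, h)\<close> is close to \<open>v(b, x, h)\<close> for an approximate unit \<open>e\<close>.\<close>
  have nondeg: "closure (cspan {blinfun_apply (\<rho> a) u | a u. a \<in> A \<and> u \<in> K}) = K"
  proof
    let ?N = "{blinfun_apply (\<rho> a) u | a u. a \<in> A \<and> u \<in> K}"
    show "closure (cspan ?N) \<subseteq> K"
      using \<rho>(4) by (intro closure_minimal complex_vector.span_minimal K) auto
    have "v i \<in> closure (cspan ?N)" for i
      unfolding closure_approachable
    proof (intro allI impI)
      fix \<epsilon> :: real assume \<epsilon>: "0 < \<epsilon>"
      define D where "D = sqrt C * norm (vc i) + 1"
      have D: "0 < D" using C(2) by (simp add: D_def add_nonneg_pos)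
      obtain e where e: "e \<in> A" "norm (op i - (e o\<^sub>L op i)) \<le> \<epsilon> / (2 * D)"
        using approximate_unit [OF A, of "{i}" op "\<epsilon> / (2 * D)"] opA \<epsilon> D
        by (metis divide_pos_pos finite.emptyI finite_insert mult_pos_pos singletonI zero_less_numeral)
      have "v i = v (op i, pt i, vc i)"
        by (rule K_eqI) (simp_all add: vK v P_def op_pair clip opA)
      then have "v i - v (act e i) = v (op i - (e o\<^sub>L op i), pt i, vc i)"
        using v_diff [OF opA A'(4) [OF e(1) opA]] by (simp add: act_def)
      then have "norm (v i - v (act e i)) \<le> sqrt C * norm (op i - (e o\<^sub>L op i)) * norm (vc i)"
        using act_small [OF csubspace_diff [OF A'(2) opA A'(4) [OF e(1) opA]]] by simp
      also have "\<dots> = (sqrt C * norm (vc i)) * norm (op i - (e o\<^sub>L op i))" by simp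
      also have "\<dots> \<le> D * (\<epsilon> / (2 * D))"
        using e(2) C(2) D by (intro mult_mono) (auto simp: D_def)
      also have "\<dots> < \<epsilon>" using D \<epsilon> by simp
      finally have "dist (v (act e i)) (v i) < \<epsilon>" by (simp add: dist_norm norm_minus_commute)
      moreover have "v (act e i) \<in> cspan ?N"
        using \<rho>(2) [OF e(1)] e(1) vK by (intro complex_vector.span_base) (metis (mono_tags, lifting) mem_Collect_eq)
      ultimately show "\<exists>y\<in>cspan ?N. dist y (v i) < \<epsilon>" by blast
    qed
    then show "K \<subseteq> closure (cspan ?N)"
      unfolding K_def
      by (intro closure_minimal complex_vector.span_minimal closed_closure csubspace_closure
          complex_vector.subspace_span) auto
  qed

  define Bd where "Bd x = (SUP a\<in>{a \<in> A. norm a \<le> 1}. norm (\<phi> x x a))" for x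
  have Bd_bdd: "bdd_above ((\<lambda>a. norm (\<phi> x x a)) ` {a \<in> A. norm a \<le> 1})" for x
  proof (rule bdd_aboveI2)
    show "norm (\<phi> x x a) \<le> C" if "a \<in> {a \<in> A. norm a \<le> 1}" for a
      using C(1) [of a x x] mult_left_mono [of "norm a" 1 C] C(2) that by auto
  qed
  have Bd: "norm (\<phi> x x a) \<le> Bd x" if "a \<in> A" "norm a \<le> 1" for x a
    unfolding Bd_def using that by (intro cSUP_upper Bd_bdd) auto
  have Bd0: "0 \<le> Bd x" for x by (rule order_trans [OF norm_ge_zero Bd [OF zero]]) simp
  have Bd_le: "Bd x \<le> B" if "\<forall>a\<in>A. norm a \<le> 1 \<longrightarrow> norm (\<phi> x x a) \<le> B" for x B
    unfolding Bd_def using that zero by (intro cSUP_least) auto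
  define w where "w x i = blinfun_apply (\<phi> x (pt i) (op i)) (vc i)" for x i
  \<comment> \<open>\<open>\<langle>\<Sum> c\<^sub>i \<phi>(x, y\<^sub>i)(e b\<^sub>i) h\<^sub>i, g\<rangle> = \<langle>\<Sum> c\<^sub>i v\<^sub>i, v(e, x, g)\<rangle>\<close>, where \<open>\<parallel>v(e, x, g)\<parallel>\<^sup>2 \<le> Bd x \<parallel>g\<parallel>\<^sup>2\<close>.\<close>
  have Z_bound: "norm (\<Sum>i\<in>J. c i *\<^sub>C w x i) \<le> sqrt (Bd x) * norm (\<Sum>i\<in>J. c i *\<^sub>C v i)"
    if J: "finite J" for J c x
  proof (rule norm_le_if_cinner_le)
    fix g :: 'h
    define S where "S = (\<Sum>i\<in>J. c i *\<^sub>C v i)"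
    define D where "D = (\<Sum>i\<in>J. cmod (c i) * C * norm (vc i)) * norm g"
    have D: "0 \<le> D" using C(2) by (simp add: D_def sum_nonneg)
    have approx: "cmod (cinner (\<Sum>i\<in>J. c i *\<^sub>C w x i) g) \<le> norm S * (sqrt (Bd x) * norm g) + \<epsilon> * D"
      if \<epsilon>: "0 < \<epsilon>" for \<epsilon>
    proof -
      obtain e where e: "e \<in> A" "adj e = e" "norm e \<le> 1" "\<And>i. i \<in> J \<Longrightarrow> norm (op i - (e o\<^sub>L op i)) \<le> \<epsilon>"
        by (rule approximate_unit [of A J op \<epsilon>]) (rule A, rule J, rule opA, rule \<epsilon>, (rule that; assumption))
      define w' where "w' i = blinfun_apply (\<phi> x (pt i) (e o\<^sub>L op i)) (vc i)" for i
      have "cinner (\<Sum>i\<in>J. c i *\<^sub>C w' i) g = cinner S (v (e, x, g))"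
        by (simp add: S_def cinner.sum_left cinner_scaleC_left v P_def op_pair clip e w'_def)
      then have "cmod (cinner (\<Sum>i\<in>J. c i *\<^sub>C w' i) g) \<le> norm S * norm (v (e, x, g))"
        by (simp add: norm_cinner_le)
      also have "\<dots> \<le> norm S * (sqrt (Bd x) * norm g)"
      proof (intro mult_left_mono norm_ge_zero)
        have "norm (adj e o\<^sub>L e) \<le> 1"
          using norm_adj_compose_self [OF Ab [OF e(1)]] power_le_one [OF norm_ge_zero e(3), of 2] by linarith
        then have "norm (\<phi> x x (adj e o\<^sub>L e)) \<le> Bd x" using e(1) by (intro Bd A')
        then have "(norm (v (e, x, g)))\<^sup>2 \<le> Bd x * (norm g)\<^sup>2"
          using v_single [OF e(1), of x g] mult_right_mono [OF _ zero_le_power2] order_trans by blast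
        then have "(norm (v (e, x, g)))\<^sup>2 \<le> (sqrt (Bd x) * norm g)\<^sup>2"
          using Bd0 by (simp add: power_mult_distrib)
        then show "norm (v (e, x, g)) \<le> sqrt (Bd x) * norm g"
          by (rule power2_le_imp_le) (simp add: Bd0)
      qed
      finally have 1: "cmod (cinner (\<Sum>i\<in>J. c i *\<^sub>C w' i) g) \<le> norm S * (sqrt (Bd x) * norm g)" .
      have "norm (c i *\<^sub>C (w x i - w' i)) \<le> \<epsilon> * (cmod (c i) * C * norm (vc i))" if i: "i \<in> J" for i
      proof -
        have "w x i - w' i = blinfun_apply (\<phi> x (pt i) (op i - (e o\<^sub>L op i))) (vc i)"
          by (simp add: w_def w'_def clinear_on_diff [OF lin A'(2)] A' opA e blinfun.diff_left)
        then have "norm (w x i - w' i) \<le> norm (\<phi> x (pt i) (op i - (e o\<^sub>L op i))) * norm (vc i)"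
          by (simp add: norm_blinfun)
        also have "\<dots> \<le> (C * norm (op i - (e o\<^sub>L op i))) * norm (vc i)"
          by (intro mult_right_mono C csubspace_diff A' opA e) simp
        also have "\<dots> \<le> (C * \<epsilon>) * norm (vc i)"
          by (intro mult_right_mono mult_left_mono e(4) i C(2)) simp
        finally have "cmod (c i) * norm (w x i - w' i) \<le> cmod (c i) * ((C * \<epsilon>) * norm (vc i))"
          by (intro mult_left_mono) simp_all
        then show ?thesis by (simp add: norm_scaleC mult_ac)
      qed
      then have "norm (\<Sum>i\<in>J. c i *\<^sub>C (w x i - w' i)) \<le> (\<Sum>i\<in>J. \<epsilon> * (cmod (c i) * C * norm (vc i)))"
        by (intro order_trans [OF norm_sum] sum_mono)
      then have "cmod (cinner (\<Sum>i\<in>J. c i *\<^sub>C (w x i - w' i)) g) \<le> (\<Sum>i\<in>J. \<epsilon> * (cmod (c i) * C * norm (vc i))) * norm g"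
        by (intro order_trans [OF norm_cinner_le] mult_right_mono) simp_all
      then have 2: "cmod (cinner (\<Sum>i\<in>J. c i *\<^sub>C (w x i - w' i)) g) \<le> \<epsilon> * D"
        by (simp only: D_def sum_distrib_left [symmetric] mult.assoc)
      have "cinner (\<Sum>i\<in>J. c i *\<^sub>C w x i) g = cinner (\<Sum>i\<in>J. c i *\<^sub>C w' i) g + cinner (\<Sum>i\<in>J. c i *\<^sub>C (w x i - w' i)) g"
        by (simp add: cinner_add_left [symmetric] sum.distrib [symmetric] scaleC_add_right [symmetric])
      then show ?thesis
        using 1 2 norm_triangle_ineq [of "cinner (\<Sum>i\<in>J. c i *\<^sub>C w' i) g" "cinner (\<Sum>i\<in>J. c i *\<^sub>C (w x i - w' i)) g"]
        by simp
    qed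
    have "cmod (cinner (\<Sum>i\<in>J. c i *\<^sub>C w x i) g) \<le> norm S * (sqrt (Bd x) * norm g)"
    proof (rule field_le_epsilon)
      fix \<epsilon> :: real assume \<epsilon>: "0 < \<epsilon>"
      have "\<epsilon> / (D + 1) * D \<le> \<epsilon>" using D \<epsilon> by (simp add: field_simps)
      then show "cmod (cinner (\<Sum>i\<in>J. c i *\<^sub>C w x i) g) \<le> norm S * (sqrt (Bd x) * norm g) + \<epsilon>"
        using approx [of "\<epsilon> / (D + 1)"] D \<epsilon> by (simp add: add_nonneg_pos)
    qed
    then show "cmod (cinner (\<Sum>i\<in>J. c i *\<^sub>C w x i) g) \<le> sqrt (Bd x) * norm (\<Sum>i\<in>J. c i *\<^sub>C v i) * norm g"
      by (simp add: S_def mult_ac)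
  qed (simp add: Bd0)
  have "\<exists>T. T \<in> bops \<and> (\<forall>i. blinfun_apply T (v i) = w x i) \<and>
      (\<forall>z. (\<forall>i. cinner z (v i) = 0) \<longrightarrow> blinfun_apply T z = 0) \<and> norm T \<le> sqrt (Bd x)" for x
  proof (rule bounded_family_extension [of "sqrt (Bd x)" UNIV "w x" v])
    show "norm (\<Sum>i\<in>J. c i *\<^sub>C w x i) \<le> sqrt (Bd x) * norm (\<Sum>i\<in>J. c i *\<^sub>C v i)" if "finite J" for J c
      by (rule Z_bound [OF that])
  qed (auto simp: Bd0)
  then have "\<exists>Z. \<forall>x. Z x \<in> bops \<and> (\<forall>i. blinfun_apply (Z x) (v i) = w x i) \<and>
      (\<forall>z. (\<forall>i. cinner z (v i) = 0) \<longrightarrow> blinfun_apply (Z x) z = 0) \<and> norm (Z x) \<le> sqrt (Bd x)"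
    by (intro choice allI)
  then obtain Z where Z: "\<And>x. Z x \<in> bops" "\<And>x i. blinfun_apply (Z x) (v i) = w x i"
      "\<And>x z. (\<And>i. cinner z (v i) = 0) \<Longrightarrow> blinfun_apply (Z x) z = 0" "\<And>x. norm (Z x) \<le> sqrt (Bd x)"
    by blast
  define V where "V x = adj (Z x)" for x
  have V_bops: "V x \<in> bops" for x by (simp add: V_def adj_bops Z)
  have V_norm: "norm (V x) \<le> sqrt (Bd x)" for x using Z(4) norm_adj_le [OF Z(1)] order_trans V_def by metis
  have V_K: "blinfun_apply (V x) h \<in> K" for x h
  proof (rule double_orthogonal_complement [OF K])
    fix z assume "\<And>w. w \<in> K \<Longrightarrow> cinner z w = 0"
    then have "blinfun_apply (Z x) z = 0" using vK by (intro Z(3)) auto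
    then show "cinner z (blinfun_apply (V x) h) = 0"
      using cinner_adj [OF Z(1), of x z h] by (simp add: V_def cinner.zero_left)
  qed
  have \<rho>V: "blinfun_apply (\<rho> a) (blinfun_apply (V y) h) = v (a, y, h)" if a: "a \<in> A" for a y h
  proof (rule K_eqI)
    fix j
    have "cinner (blinfun_apply (\<rho> a) (blinfun_apply (V y) h)) (v j) = cinner (blinfun_apply (V y) h) (v (act (adj a) j))"
      by (simp add: cinner_adj \<rho> a \<rho>_adj [OF a, symmetric] A')
    also have "\<dots> = cinner h (w y (act (adj a) j))"
      by (simp add: V_def cinner_adj_left Z)
    also have "\<dots> = cnj (P j (a, y, h))"
      using cinner_commute [of h] a by (simp add: w_def P_def op_act op_pair clip A')
    also have "\<dots> = cinner (v (a, y, h)) (v j)"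
      using cinner_commute [of "v (a, y, h)" "v j"] by (simp add: v)
    finally show "cinner (blinfun_apply (\<rho> a) (blinfun_apply (V y) h)) (v j) = cinner (v (a, y, h)) (v j)" .
  qed (auto intro: \<rho>(4) a vK)
  have "\<phi> x y a = adj (V x) o\<^sub>L \<rho> a o\<^sub>L V y" if "a \<in> A" for x y a
    by (rule blinfun_eqI)
      (simp add: V_def adj_adj Z \<rho>V [unfolded V_def] that w_def op_pair clip)
  moreover have "bounded (range V)"
  proof (rule boundedI)
    fix T assume "T \<in> range V"
    then obtain x where "T = V x" by blast
    moreover have "Bd x \<le> C"
    proof (rule Bd_le, intro ballI impI)
      fix a assume a: "a \<in> A" "norm a \<le> 1"
      show "norm (\<phi> x x a) \<le> C" using C(1) [OF a(1), of x x] mult_left_mono [OF a(2) C(2)] by simp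
    qed
    ultimately show "norm T \<le> sqrt C" using order_trans [OF V_norm real_sqrt_le_mono] by simp
  qed
  moreover have "nondegenerate_rep A K \<rho>"
    unfolding nondegenerate_rep_def bops_on_def
    using \<rho>_lin \<rho>(1,4) \<rho>_mult \<rho>_adj nondeg \<rho>(3) vK by blast
  ultimately have "dilation A \<phi> K \<rho> V"
    unfolding dilation_def using K V_bops V_K by blast
  moreover have "(norm (V x))\<^sup>2 \<le> B" if "\<forall>a\<in>A. norm a \<le> 1 \<longrightarrow> norm (\<phi> x x a) \<le> B" for x B
  proof -
    have "(norm (V x))\<^sup>2 \<le> (sqrt (Bd x))\<^sup>2" by (intro power_mono V_norm norm_ge_zero)
    then show ?thesis using Bd_le [OF that] Bd0 by simp
  qed
  ultimately show ?thesis by blast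
qed

section \<open>Schur multipliers of positive type\<close>

lemma dilationD:
  assumes "dilation A \<phi> K \<rho> V"
  shows "star_rep A \<rho>" "\<And>x. V x \<in> bops" "bounded (range V)"
    "\<And>x y a. a \<in> A \<Longrightarrow> \<phi> x y a = adj (V x) o\<^sub>L \<rho> a o\<^sub>L V y"
  using assms by (auto simp: dilation_def nondegenerate_rep_def star_rep_def bops_on_def)

lemma matrix_form_dilation:
  assumes D: "dilation A \<phi> K \<rho> V" and a: "\<And>i j. i \<in> J \<Longrightarrow> j \<in> J \<Longrightarrow> a i j \<in> A"
  shows "matrix_form J (\<lambda>i j. \<phi> (x i) (x j) (a i j)) \<xi> \<eta>
    = matrix_form J (\<lambda>i j. \<rho> (a i j)) (\<lambda>j. blinfun_apply (V (x j)) (\<xi> j)) (\<lambda>i. blinfun_apply (V (x i)) (\<eta> i))"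
  unfolding matrix_form_def using dilationD [OF D] a
  by (intro sum.cong refl) (simp add: cinner_adj_left)

lemma dilation_imp_positive_type:
  fixes K :: "'k::chilbert_space set" and A :: "('h::chilbert_space \<Rightarrow>\<^sub>L 'h) set"
    and \<phi> :: "'x \<Rightarrow> 'x \<Rightarrow> ('h \<Rightarrow>\<^sub>L 'h) \<Rightarrow> ('h \<Rightarrow>\<^sub>L 'h)"
  assumes A: "cstar_subalgebra A" and D: "dilation A \<phi> K \<rho> V"
  shows "positive_type A \<phi>"
  unfolding positive_type_def mat_pos_iff_psd
proof (intro allI ballI impI)
  fix m and x :: "nat \<Rightarrow> 'x" and a assume a: "a \<in> mats m A" "psd {..<m} a"
  then have aA: "\<And>i j. i \<in> {..<m} \<Longrightarrow> j \<in> {..<m} \<Longrightarrow> a i j \<in> A" by (simp add: mats_def)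
  have "psd {..<m} (\<lambda>i j. \<rho> (a i j))"
    by (rule star_rep_psd [OF A dilationD(1) [OF D]]) (use aA a(2) in auto)
  then show "psd {..<m} (\<lambda>p q. \<phi> (x p) (x q) (a p q))"
    unfolding psd_def by (subst matrix_form_dilation [OF D aA]) auto
qed

text \<open>Representations are contractive on matrices over \<open>A\<close>, and each \<open>V(x)\<close> contributes a factor \<open>\<surd>C\<close>.\<close>

lemma dilation_imp_schur_bound:
  fixes K :: "'k::chilbert_space set" and A :: "('h::chilbert_space \<Rightarrow>\<^sub>L 'h) set"
    and \<phi> :: "'x \<Rightarrow> 'x \<Rightarrow> ('h \<Rightarrow>\<^sub>L 'h) \<Rightarrow> ('h \<Rightarrow>\<^sub>L 'h)"
  assumes A: "cstar_subalgebra A" and D: "dilation A \<phi> K \<rho> V" and C: "\<And>x. (norm (V x))\<^sup>2 \<le> C" "0 \<le> C"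
  shows "schur_bound A \<phi> C"
  unfolding schur_bound_def
proof (intro allI impI)
  fix n and F :: "'x set" and a M
  assume F: "finite F" and M: "0 \<le> M"
    and aA: "\<forall>p\<in>{..<n} \<times> F. \<forall>q\<in>{..<n} \<times> F. a p q \<in> A" and fb: "form_bound ({..<n::nat} \<times> F) a M"
  let ?J = "{..<n} \<times> F"
  have rb: "form_bound ?J (\<lambda>p q. \<rho> (a p q)) M"
    by (rule star_rep_form_bound [OF A dilationD(1) [OF D]]) (use F aA fb M in auto)
  have V: "norm (V x) \<le> sqrt C" for x using C(1) [of x] by (simp add: real_le_rsqrt)
  have L2: "L2_set (\<lambda>p. norm (blinfun_apply (V (snd p)) (\<xi> p))) ?J \<le> sqrt C * L2_set (\<lambda>p. norm (\<xi> p)) ?J"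
    for \<xi> :: "nat \<times> 'x \<Rightarrow> 'h"
  proof -
    have "L2_set (\<lambda>p. norm (blinfun_apply (V (snd p)) (\<xi> p))) ?J \<le> L2_set (\<lambda>p. sqrt C * norm (\<xi> p)) ?J"
      using order_trans [OF norm_blinfun mult_right_mono [OF V norm_ge_zero]] by (intro L2_set_mono) auto
    then show ?thesis using C(2) by (simp add: L2_set_right_distrib)
  qed
  show "form_bound ?J (\<lambda>p q. \<phi> (snd p) (snd q) (a p q)) (C * M)"
    unfolding form_bound_def
  proof (intro allI)
    fix \<xi> \<eta>
    have "cmod (matrix_form ?J (\<lambda>p q. \<phi> (snd p) (snd q) (a p q)) \<xi> \<eta>)
        = cmod (matrix_form ?J (\<lambda>p q. \<rho> (a p q)) (\<lambda>q. blinfun_apply (V (snd q)) (\<xi> q)) (\<lambda>p. blinfun_apply (V (snd p)) (\<eta> p)))"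
      by (subst matrix_form_dilation [OF D]) (use aA in auto)
    also have "\<dots> \<le> M * L2_set (\<lambda>p. norm (blinfun_apply (V (snd p)) (\<xi> p))) ?J
        * L2_set (\<lambda>p. norm (blinfun_apply (V (snd p)) (\<eta> p))) ?J"
      using rb unfolding form_bound_def by blast
    also have "\<dots> \<le> M * (sqrt C * L2_set (\<lambda>p. norm (\<xi> p)) ?J) * (sqrt C * L2_set (\<lambda>p. norm (\<eta> p)) ?J)"
      using M C(2) by (intro mult_mono mult_left_mono L2) auto
    also have "\<dots> = (sqrt C * sqrt C) * M * L2_set (\<lambda>p. norm (\<xi> p)) ?J * L2_set (\<lambda>p. norm (\<eta> p)) ?J"
      by (simp only: mult_ac)
    also have "sqrt C * sqrt C = C" using C(2) by simp
    finally show "cmod (matrix_form ?J (\<lambda>p q. \<phi> (snd p) (snd q) (a p q)) \<xi> \<eta>)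
        \<le> C * M * L2_set (\<lambda>p. norm (\<xi> p)) ?J * L2_set (\<lambda>p. norm (\<eta> p)) ?J" .
  qed
qed

lemma hs_ops_subset_entry_ops: "A \<subseteq> bops \<Longrightarrow> hs_ops A \<subseteq> entry_ops A"
  by (auto simp: hs_ops_iff entry_ops_def l2_kernels_def)

lemma min_tensor_subset_entry_ops: "csubspace A \<Longrightarrow> closed A \<Longrightarrow> min_tensor B A \<subseteq> entry_ops A"
  using min_tensor_entries by (auto simp: entry_ops_def)

lemma schur_map_hs_eq_canonical_extension:
  assumes A: "A \<subseteq> bops" and \<phi>: "\<And>x y a. a \<in> A \<Longrightarrow> \<phi> x y a \<in> bops"
    and C: "schur_bound A \<phi> C" "0 \<le> C" and T: "T \<in> hs_ops A"
  shows "schur_map_hs A \<phi> T = canonical_extension \<phi> T"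
proof -
  have "T \<in> entry_ops A" using T hs_ops_subset_entry_ops [OF A] by blast
  then show ?thesis
    unfolding schur_map_hs_eq [OF A T]
    by (intro kernel_op_eq canonical_extension_entries(2) [OF \<phi> C])
qed

lemma cb_norm_cong: "(\<And>a. a \<in> S \<Longrightarrow> F a = G a) \<Longrightarrow> cb_norm S F = cb_norm S G"
proof -
  assume eq: "\<And>a. a \<in> S \<Longrightarrow> F a = G a"
  have "mat_norm n (\<lambda>i j. F (a i j)) = mat_norm n (\<lambda>i j. G (a i j))" if "a \<in> mats n S" for n a
    unfolding mat_norm_def using that eq
    by (intro SUP_cong refl L2_set_cong arg_cong [where f = norm] sum.cong) (auto simp: mats_def)
  then show ?thesis unfolding cb_norm_def by (intro SUP_cong refl) auto
qed

lemma clinear_on_cong: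
  assumes "csubspace S" "\<And>a. a \<in> S \<Longrightarrow> F a = G a" "clinear_on S G"
  shows "clinear_on S F"
  using assms by (auto simp: clinear_on_def complex_vector.subspace_add complex_vector.subspace_scale)

lemma canonical_extension_completely_bounded:
  fixes \<phi> :: "'x \<Rightarrow> 'x \<Rightarrow> ('h::chilbert_space \<Rightarrow>\<^sub>L 'h) \<Rightarrow> ('h \<Rightarrow>\<^sub>L 'h)"
  assumes \<phi>: "\<And>x y a. a \<in> A \<Longrightarrow> \<phi> x y a \<in> bops" and lin: "\<And>x y. clinear_on A (\<phi> x y)"
    and C: "schur_bound A \<phi> C" "0 \<le> C" and D: "D \<subseteq> entry_ops A"
  shows "completely_bounded D (canonical_extension \<phi>)"
  unfolding completely_bounded_def
proof (intro conjI)
  show "clinear_on D (canonical_extension \<phi>)" by (rule canonical_extension_clinear_on [OF \<phi> C lin D])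
  show "canonical_extension \<phi> ` D \<subseteq> bops" using canonical_extension_entries(1) [OF \<phi> C] D by blast
  show "cb_norm D (canonical_extension \<phi>) < \<infinity>"
    unfolding infinity_ennreal_def
    by (rule le_less_trans [OF canonical_extension_cb_norm_le [OF \<phi> C D] ennreal_less_top])
qed

lemma schur_bound_imp_schur_multiplier:
  fixes \<phi> :: "'x \<Rightarrow> 'x \<Rightarrow> ('h::chilbert_space \<Rightarrow>\<^sub>L 'h) \<Rightarrow> ('h \<Rightarrow>\<^sub>L 'h)"
  assumes A: "A \<subseteq> bops" "csubspace A" and \<phi>: "\<And>x y a. a \<in> A \<Longrightarrow> \<phi> x y a \<in> bops"
    and lin: "\<And>x y. clinear_on A (\<phi> x y)" and C: "schur_bound A \<phi> C" "0 \<le> C"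
  shows "schur_multiplier A \<phi>"
proof -
  note eq = schur_map_hs_eq_canonical_extension [OF A(1) \<phi> C]
  have "completely_bounded (hs_ops A) (canonical_extension \<phi>)"
    by (intro canonical_extension_completely_bounded [OF \<phi> lin C] hs_ops_subset_entry_ops A)
  then show ?thesis
    unfolding schur_multiplier_def completely_bounded_def
    using cb_norm_cong [of "hs_ops A" "schur_map_hs A \<phi>" "canonical_extension \<phi>", OF eq]
      clinear_on_cong [OF csubspace_hs_ops [OF A], of "schur_map_hs A \<phi>" "canonical_extension \<phi>", OF eq] eq
    by (simp add: image_subset_iff)
qed

text \<open>A matrix over \<open>A\<close> indexed by \<open>{..<n} \<times> F\<close> is the flattening of an \<open>n \<times> n\<close> matrix of finitely
  supported kernels with the same norm.\<close>

lemma schur_multiplier_imp_schur_bound: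
  fixes \<phi> :: "'x \<Rightarrow> 'x \<Rightarrow> ('h::chilbert_space \<Rightarrow>\<^sub>L 'h) \<Rightarrow> ('h \<Rightarrow>\<^sub>L 'h)"
  assumes A: "A \<subseteq> bops" "csubspace A" and lin: "\<And>x y. clinear_on A (\<phi> x y)"
    and sm: "schur_multiplier A \<phi>"
    and hs: "\<And>T. T \<in> hs_ops A \<Longrightarrow> matrix_entry (schur_map_hs A \<phi> T) = (\<lambda>x y. \<phi> x y (matrix_entry T x y))"
  shows "\<exists>C\<ge>0. schur_bound A \<phi> C"
proof -
  have cb: "clinear_on (hs_ops A) (schur_map_hs A \<phi>)" "cb_norm (hs_ops A) (schur_map_hs A \<phi>) < \<infinity>"
    using sm by (auto simp: schur_multiplier_def completely_bounded_def)
  define C where "C = enn2real (cb_norm (hs_ops A) (schur_map_hs A \<phi>))"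
  have C: "cb_norm (hs_ops A) (schur_map_hs A \<phi>) \<le> ennreal C" "0 \<le> C"
    using cb(2) by (simp_all add: C_def)
  have "schur_bound A \<phi> C"
    unfolding schur_bound_def
  proof (intro allI impI)
    fix n and F :: "'x set" and a M
    assume F: "finite F" and M: "0 \<le> M"
      and aA: "\<forall>p\<in>{..<n} \<times> F. \<forall>q\<in>{..<n} \<times> F. a p q \<in> A" and fb: "form_bound ({..<n::nat} \<times> F) a M"
    define T where "T i j = op_of F (\<lambda>x y. a (i, x) (j, y))" for i j
    have T: "T \<in> mats n (hs_ops A)"
      using aA by (auto simp: mats_def T_def intro!: op_of_hs_ops A F)
    have "form_bound {..<n} T M"
      unfolding form_bound_def
    proof (intro allI)
      fix \<xi> \<eta> :: "nat \<Rightarrow> ('x, 'h) l2"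
      let ?c = "\<lambda>(\<zeta> :: nat \<Rightarrow> ('x, 'h) l2) p. blinfun_apply (coord (snd p)) (\<zeta> (fst p))"
      have "matrix_form {..<n} T \<xi> \<eta> = (\<Sum>i<n. \<Sum>j<n. \<Sum>x\<in>F. \<Sum>y\<in>F.
          cinner (blinfun_apply (a (i, x) (j, y)) (blinfun_apply (coord y) (\<xi> j))) (blinfun_apply (coord x) (\<eta> i)))"
        by (simp add: matrix_form_def [of "{..<n}"] T_def cinner_op_of) (simp add: matrix_form_def)
      also have "\<dots> = (\<Sum>i<n. \<Sum>x\<in>F. \<Sum>j<n. \<Sum>y\<in>F.
          cinner (blinfun_apply (a (i, x) (j, y)) (blinfun_apply (coord y) (\<xi> j))) (blinfun_apply (coord x) (\<eta> i)))"
        by (intro sum.cong refl sum.swap)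
      also have "\<dots> = matrix_form ({..<n} \<times> F) a (?c \<xi>) (?c \<eta>)"
        by (simp only: matrix_form_def sum.cartesian_product' fst_conv snd_conv)
      finally have "cmod (matrix_form {..<n} T \<xi> \<eta>)
          \<le> M * L2_set (\<lambda>p. norm (?c \<xi> p)) ({..<n} \<times> F) * L2_set (\<lambda>p. norm (?c \<eta> p)) ({..<n} \<times> F)"
        using fb unfolding form_bound_def by simp
      moreover have "L2_set (\<lambda>p. norm (?c \<zeta> p)) ({..<n} \<times> F) \<le> L2_set (\<lambda>j. norm (\<zeta> j)) {..<n}" for \<zeta>
        using norm_coord_proj_le [OF F] unfolding L2_set_flatten [OF F] fst_conv snd_conv coord_proj_apply
        by (intro L2_set_mono) auto
      ultimately show "cmod (matrix_form {..<n} T \<xi> \<eta>)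
          \<le> M * L2_set (\<lambda>j. norm (\<xi> j)) {..<n} * L2_set (\<lambda>i. norm (\<eta> i)) {..<n}"
        using M by (meson L2_set_nonneg mult_left_mono mult_mono mult_nonneg_nonneg order_trans)
    qed
    then have "form_bound {..<n} (\<lambda>i j. schur_map_hs A \<phi> (T i j)) (C * M)"
      by (intro form_bound_cb_norm [OF cb(1) csubspace_hs_ops [OF A] C T] M)
    then have fl: "form_bound ({..<n} \<times> F) (flatten (\<lambda>i j. schur_map_hs A \<phi> (T i j))) (C * M)"
      by (intro form_bound_flatten F)
    show "form_bound ({..<n} \<times> F) (\<lambda>p q. \<phi> (snd p) (snd q) (a p q)) (C * M)"
    proof (rule form_bound_cong [THEN iffD1, OF _ fl])
      fix p q assume pq: "p \<in> {..<n} \<times> F" "q \<in> {..<n} \<times> F"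
      then have "T (fst p) (fst q) \<in> hs_ops A" using T by (auto simp: mats_def)
      then show "flatten (\<lambda>i j. schur_map_hs A \<phi> (T i j)) p q = \<phi> (snd p) (snd q) (a p q)"
        using pq by (auto simp: flatten_def hs T_def matrix_entry_op_of F)
    qed
  qed
  with C(2) show ?thesis by blast
qed

lemma completely_bounded_tendsto:
  assumes F: "completely_bounded S F" and S: "csubspace S"
    and T: "\<And>n. T n \<in> S" "T \<longlonglongrightarrow> T'" "T' \<in> S"
  shows "(\<lambda>n. F (T n)) \<longlonglongrightarrow> F T'"
proof -
  have cb: "clinear_on S F" "cb_norm S F < \<infinity>" using F by (auto simp: completely_bounded_def)
  define C where "C = enn2real (cb_norm S F)"
  have C: "cb_norm S F \<le> ennreal C" "0 \<le> C" using cb(2) by (simp_all add: C_def)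
  have le: "norm (F (T n) - F T') \<le> C * norm (T n - T')" for n
    unfolding clinear_on_diff [OF cb(1) S T(1,3), symmetric]
    by (intro norm_le_cb_norm [OF cb(1) S C] csubspace_diff S T)
  have lim: "(\<lambda>n. C * norm (T n - T')) \<longlonglongrightarrow> C * 0"
    by (intro tendsto_mult tendsto_const tendsto_norm_zero LIM_zero T(2))
  have "(\<lambda>n. F (T n) - F T') \<longlonglongrightarrow> 0"
  proof (rule Lim_null_comparison)
    show "\<forall>\<^sub>F n in sequentially. norm (F (T n) - F T') \<le> C * norm (T n - T')"
      by (intro always_eventually allI le)
    show "(\<lambda>n. C * norm (T n - T')) \<longlonglongrightarrow> 0" using lim by simp
  qed
  then show ?thesis by (rule LIM_zero_cancel)
qed

text \<open>Both maps are continuous on \<open>K \<otimes> A\<close> and agree on the dense subspace of Hilbert--Schmidt kernels.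
  The canonical extension itself witnesses that the choice in \<open>schur_map\<close> is possible.\<close>

lemma schur_map_eq_canonical_extension:
  fixes \<phi> :: "'x \<Rightarrow> 'x \<Rightarrow> ('h::chilbert_space \<Rightarrow>\<^sub>L 'h) \<Rightarrow> ('h \<Rightarrow>\<^sub>L 'h)"
  assumes A: "A \<subseteq> bops" "csubspace A" "closed A" and \<phi>: "\<And>x y a. a \<in> A \<Longrightarrow> \<phi> x y a \<in> bops"
    and lin: "\<And>x y. clinear_on A (\<phi> x y)" and C: "schur_bound A \<phi> C" "0 \<le> C"
    and T: "T \<in> min_tensor compact_ops A"
  shows "schur_map A \<phi> T = canonical_extension \<phi> T"
proof -
  let ?S = "min_tensor compact_ops A :: (('x, 'h) l2 \<Rightarrow>\<^sub>L ('x, 'h) l2) set"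
  note eq = schur_map_hs_eq_canonical_extension [OF A(1) \<phi> C]
  have ce: "completely_bounded ?S (canonical_extension \<phi>)"
    by (intro canonical_extension_completely_bounded [OF \<phi> lin C] min_tensor_subset_entry_ops A)
  have "completely_bounded ?S (schur_map A \<phi>) \<and> (\<forall>T\<in>hs_ops A. schur_map A \<phi> T = schur_map_hs A \<phi> T)"
    unfolding schur_map_def
    by (rule someI [where x = "canonical_extension \<phi>"]) (use ce eq in auto)
  then have F: "completely_bounded ?S (schur_map A \<phi>)" "\<And>T. T \<in> hs_ops A \<Longrightarrow> schur_map A \<phi> T = canonical_extension \<phi> T"
    using eq by auto
  have "T \<in> closure (hs_ops A)" using T min_tensor_subset_closure_hs_ops [OF A(1,2)] by blast
  then obtain U where U: "\<And>n. U n \<in> hs_ops A" "U \<longlonglongrightarrow> T" by (auto simp: closure_sequential)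
  have US: "\<And>n. U n \<in> ?S" using U(1) hs_ops_subset_min_tensor [OF A(1)] by blast
  have "(\<lambda>n. schur_map A \<phi> (U n)) \<longlonglongrightarrow> schur_map A \<phi> T"
    by (rule completely_bounded_tendsto [OF F(1) csubspace_min_tensor US U(2) T])
  moreover have "(\<lambda>n. canonical_extension \<phi> (U n)) \<longlonglongrightarrow> canonical_extension \<phi> T"
    by (rule completely_bounded_tendsto [OF ce csubspace_min_tensor US U(2) T])
  ultimately show ?thesis using F(2) [OF U(1)] LIMSEQ_unique by auto
qed

lemma schur_kernel_l2_kernels:
  fixes \<phi> :: "'x \<Rightarrow> 'x \<Rightarrow> ('h::chilbert_space \<Rightarrow>\<^sub>L 'h) \<Rightarrow> ('h \<Rightarrow>\<^sub>L 'h)"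
  assumes \<phi>: "\<And>x y a. a \<in> A \<Longrightarrow> \<phi> x y a \<in> bops" and B: "\<And>x y a. a \<in> A \<Longrightarrow> norm (\<phi> x y a) \<le> B * norm a"
    and k: "k \<in> l2_kernels A"
  shows "(\<lambda>x y. \<phi> x y (k x y)) \<in> l2_kernels bops"
proof -
  have kA: "\<And>x y. k x y \<in> A" using k by (simp add: l2_kernels_def)
  have "(\<lambda>p. B\<^sup>2 * (norm (k (fst p) (snd p)))\<^sup>2) summable_on UNIV"
    using k by (intro summable_on_cmult_right) (simp add: l2_kernels_def case_prod_beta')
  then have "(\<lambda>p. (norm (\<phi> (fst p) (snd p) (k (fst p) (snd p))))\<^sup>2) summable_on UNIV"
  proof (rule summable_on_comparison_test)
    fix p :: "'x \<times> 'x"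
    show "(norm (\<phi> (fst p) (snd p) (k (fst p) (snd p))))\<^sup>2 \<le> B\<^sup>2 * (norm (k (fst p) (snd p)))\<^sup>2"
      unfolding power_mult_distrib [symmetric] by (intro power_mono B kA norm_ge_zero)
  qed simp
  then show ?thesis using \<phi> [OF kA] by (simp add: l2_kernels_def case_prod_beta')
qed

lemma canonical_extension_min_tensor:
  fixes \<phi> :: "'x \<Rightarrow> 'x \<Rightarrow> ('h::chilbert_space \<Rightarrow>\<^sub>L 'h) \<Rightarrow> ('h \<Rightarrow>\<^sub>L 'h)"
  assumes A: "A \<subseteq> bops" "csubspace A" "closed A" and \<phi>: "\<And>x y a. a \<in> A \<Longrightarrow> \<phi> x y a \<in> bops"
    and lin: "\<And>x y. clinear_on A (\<phi> x y)" and C: "schur_bound A \<phi> C" "0 \<le> C"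
    and B: "\<And>x y a. a \<in> A \<Longrightarrow> norm (\<phi> x y a) \<le> B * norm a"
    and T: "T \<in> min_tensor compact_ops A"
  shows "canonical_extension \<phi> T \<in> min_tensor compact_ops bops"
proof -
  let ?S = "min_tensor compact_ops A :: (('x, 'h) l2 \<Rightarrow>\<^sub>L ('x, 'h) l2) set"
  have hs: "canonical_extension \<phi> U \<in> hs_ops bops" if U: "U \<in> hs_ops A" for U :: "('x, 'h) l2 \<Rightarrow>\<^sub>L ('x, 'h) l2"
  proof -
    have "U \<in> entry_ops A" using U hs_ops_subset_entry_ops [OF A(1)] by blast
    note ce = canonical_extension_entries [OF \<phi> C this]
    have k: "matrix_entry U \<in> l2_kernels A" using U hs_ops_iff [OF A(1)] by blast
    have "matrix_entry (canonical_extension \<phi> U) = (\<lambda>x y. \<phi> x y (matrix_entry U x y))"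
      by (intro ext ce(2))
    then show ?thesis
      using ce(1) schur_kernel_l2_kernels [OF \<phi> B k] by (simp add: hs_ops_iff)
  qed
  have "T \<in> closure (hs_ops A)" using T min_tensor_subset_closure_hs_ops [OF A(1,2)] by blast
  then obtain U where U: "\<And>n. U n \<in> hs_ops A" "U \<longlonglongrightarrow> T" by (auto simp: closure_sequential)
  have US: "\<And>n. U n \<in> ?S" using U(1) hs_ops_subset_min_tensor [OF A(1)] by blast
  have ce: "completely_bounded ?S (canonical_extension \<phi>)"
    by (intro canonical_extension_completely_bounded [OF \<phi> lin C] min_tensor_subset_entry_ops A)
  have lim: "(\<lambda>n. canonical_extension \<phi> (U n)) \<longlonglongrightarrow> canonical_extension \<phi> T"
    by (rule completely_bounded_tendsto [OF ce csubspace_min_tensor US U(2) T])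
  have cl: "closed (min_tensor compact_ops bops :: (('x, 'h) l2 \<Rightarrow>\<^sub>L ('x, 'h) l2) set)"
    by (simp add: min_tensor_def)
  show ?thesis
    by (rule closed_sequentially [OF cl _ lim]) (use hs U(1) hs_ops_subset_min_tensor [OF subset_refl] in blast)
qed

text \<open>Thus each \<open>\<phi>(x, y)\<close> can be read off from \<open>S\<^sub>\<phi>\<close> on \<open>K \<otimes> A\<close>.\<close>

lemma canonical_extension_matrix_unit:
  assumes A: "csubspace A" and \<phi>: "\<And>x y a. a \<in> A \<Longrightarrow> \<phi> x y a \<in> bops"
    and lin: "\<And>x y. clinear_on A (\<phi> x y)" and a: "a \<in> A"
  shows "canonical_extension \<phi> (emb x o\<^sub>L a o\<^sub>L coord y) = emb x o\<^sub>L \<phi> x y a o\<^sub>L coord y"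
proof (rule canonical_extension_eqI)
  show "emb x o\<^sub>L \<phi> x y a o\<^sub>L coord y \<in> bops" by (intro bops_compose emb_bops coord_bops \<phi> a)
  have ent: "matrix_entry (emb x o\<^sub>L b o\<^sub>L coord y) u w = (if u = x \<and> w = y then b else 0)" for b u w
    by (rule blinfun_eqI) (auto simp: matrix_entry_apply coord_emb blinfun.zero_right)
  have "\<phi> u w 0 = 0" for u w
    using clinear_onD(2) [OF lin complex_vector.subspace_0 [OF A], of u w 0] by simp
  then show "matrix_entry (emb x o\<^sub>L \<phi> x y a o\<^sub>L coord y) u w = \<phi> u w (matrix_entry (emb x o\<^sub>L a o\<^sub>L coord y) u w)" for u w
    unfolding ent by simp
qed

lemma matrix_unit_min_tensor:
  "A \<subseteq> bops \<Longrightarrow> a \<in> A \<Longrightarrow> emb x o\<^sub>L a o\<^sub>L coord y \<in> min_tensor compact_ops A"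
  unfolding min_tensor_def
  by (rule closure_subset [THEN subsetD], rule complex_vector.span_base, rule elementary_op)
    (auto intro: matrix_unit_compact)

lemma matrix_form_units:
  "matrix_form J (\<lambda>p q. emb (x p) o\<^sub>L a p q o\<^sub>L coord (x q)) \<xi> \<eta>
    = matrix_form J a (\<lambda>q. blinfun_apply (coord (x q)) (\<xi> q)) (\<lambda>p. blinfun_apply (coord (x p)) (\<eta> p))"
  by (simp add: matrix_form_def cinner_emb)

text \<open>The matrix \<open>(E\<^bsub>x\<^sub>p x\<^sub>q\<^esub> \<otimes> a\<^sub>p\<^sub>q)\<close> over \<open>K \<otimes> A\<close> is positive if \<open>(a\<^sub>p\<^sub>q)\<close> is. Since it is a matrix over
  \<open>K \<otimes> A\<close> and not an element of \<open>K \<otimes> A\<close>, the points \<open>x\<^sub>p\<close> may coincide.\<close>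

lemma completely_positive_imp_positive_type:
  fixes \<phi> :: "'x \<Rightarrow> 'x \<Rightarrow> ('h::chilbert_space \<Rightarrow>\<^sub>L 'h) \<Rightarrow> ('h \<Rightarrow>\<^sub>L 'h)"
  assumes A: "A \<subseteq> bops" "csubspace A" and \<phi>: "\<And>x y a. a \<in> A \<Longrightarrow> \<phi> x y a \<in> bops"
    and lin: "\<And>x y. clinear_on A (\<phi> x y)"
    and cp: "completely_positive (min_tensor compact_ops A) F"
    and F: "\<And>T. T \<in> min_tensor compact_ops A \<Longrightarrow> F T = canonical_extension \<phi> T"
  shows "positive_type A \<phi>"
  unfolding positive_type_def mat_pos_iff_psd
proof (intro allI ballI impI)
  fix m and x :: "nat \<Rightarrow> 'x" and a assume a: "a \<in> mats m A" "psd {..<m} a"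
  define b where "b = (\<lambda>p q. emb (x p) o\<^sub>L a p q o\<^sub>L coord (x q))"
  have "psd {..<m} b" using a(2) by (simp add: psd_def b_def matrix_form_units)
  moreover have bm: "b \<in> mats m (min_tensor compact_ops A)"
    using a(1) A(1) by (auto simp: mats_def b_def intro: matrix_unit_min_tensor)
  ultimately have "psd {..<m} (\<lambda>p q. F (b p q))"
    using cp unfolding completely_positive_def mat_pos_iff_psd by blast
  moreover have "F (b p q) = emb (x p) o\<^sub>L \<phi> (x p) (x q) (a p q) o\<^sub>L coord (x q)" if "p < m" "q < m" for p q
  proof -
    have "b p q \<in> min_tensor compact_ops A" "a p q \<in> A" using bm a(1) that by (auto simp: mats_def)
    then show ?thesis by (simp add: F canonical_extension_matrix_unit [OF A(2) \<phi> lin] b_def)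
  qed
  ultimately have pos: "psd {..<m} (\<lambda>p q. emb (x p) o\<^sub>L \<phi> (x p) (x q) (a p q) o\<^sub>L coord (x q))"
    by (subst (asm) psd_cong) auto
  show "psd {..<m} (\<lambda>p q. \<phi> (x p) (x q) (a p q))"
    unfolding psd_def
  proof
    fix \<xi> :: "nat \<Rightarrow> 'h"
    show "matrix_form {..<m} (\<lambda>p q. \<phi> (x p) (x q) (a p q)) \<xi> \<xi> \<in> \<real>\<^sub>\<ge>\<^sub>0"
      using pos [unfolded psd_def, rule_format, of "\<lambda>p. blinfun_apply (emb (x p)) (\<xi> p)"]
      by (simp add: matrix_form_units coord_emb)
  qed
qed

text \<open>On the corner \<open>E\<^sub>x\<^sub>x \<otimes> A\<close>, a completely isometric copy of \<open>A\<close>, the map \<open>S\<^sub>\<phi>\<close> acts as \<open>\<phi>(x, x)\<close>.\<close>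

lemma cb_norm_diagonal_le:
  fixes \<phi> :: "'x \<Rightarrow> 'x \<Rightarrow> ('h::chilbert_space \<Rightarrow>\<^sub>L 'h) \<Rightarrow> ('h \<Rightarrow>\<^sub>L 'h)"
  assumes A: "A \<subseteq> bops" "csubspace A" and \<phi>: "\<And>x y a. a \<in> A \<Longrightarrow> \<phi> x y a \<in> bops"
    and lin: "\<And>x y. clinear_on A (\<phi> x y)"
  shows "cb_norm A (\<phi> x x) \<le> cb_norm (min_tensor compact_ops A) (canonical_extension \<phi>)"
  unfolding cb_norm_def [of A]
proof (intro SUP_least)
  fix n a assume "a \<in> {a \<in> mats n A. mat_norm n a \<le> 1}"
  then have a: "a \<in> mats n A" "form_bound {..<n} a 1" by (auto simp: mat_norm_le_iff)
  define b where "b = (\<lambda>i j. emb x o\<^sub>L a i j o\<^sub>L coord x)"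
  have form: "matrix_form J (\<lambda>i j. emb x o\<^sub>L c i j o\<^sub>L coord x) \<xi> \<eta>
      = matrix_form J c (\<lambda>q. blinfun_apply (coord x) (\<xi> q)) (\<lambda>p. blinfun_apply (coord x) (\<eta> p))" for J c \<xi> \<eta>
    using matrix_form_units [of J "\<lambda>_. x" c] by simp
  have "form_bound {..<n} b 1"
    unfolding form_bound_def b_def form
  proof (intro allI)
    fix \<xi> \<eta> :: "nat \<Rightarrow> ('x, 'h) l2"
    have "cmod (matrix_form {..<n} a (\<lambda>q. blinfun_apply (coord x) (\<xi> q)) (\<lambda>p. blinfun_apply (coord x) (\<eta> p)))
        \<le> 1 * L2_set (\<lambda>j. norm (blinfun_apply (coord x) (\<xi> j))) {..<n} * L2_set (\<lambda>i. norm (blinfun_apply (coord x) (\<eta> i))) {..<n}"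
      using a(2) unfolding form_bound_def by blast
    also have "\<dots> \<le> 1 * L2_set (\<lambda>j. norm (\<xi> j)) {..<n} * L2_set (\<lambda>i. norm (\<eta> i)) {..<n}"
      by (intro mult_mono mult_left_mono L2_set_mono norm_coord_le) auto
    finally show "cmod (matrix_form {..<n} a (\<lambda>q. blinfun_apply (coord x) (\<xi> q)) (\<lambda>p. blinfun_apply (coord x) (\<eta> p)))
        \<le> 1 * L2_set (\<lambda>j. norm (\<xi> j)) {..<n} * L2_set (\<lambda>i. norm (\<eta> i)) {..<n}" .
  qed
  moreover have "b \<in> mats n (min_tensor compact_ops A)"
    using a(1) A(1) by (auto simp: mats_def b_def intro: matrix_unit_min_tensor)
  ultimately have "ennreal (mat_norm n (\<lambda>i j. canonical_extension \<phi> (b i j)))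
      \<le> cb_norm (min_tensor compact_ops A) (canonical_extension \<phi>)"
    unfolding cb_norm_def by (intro SUP_upper2 [of n] SUP_upper) (auto simp: mat_norm_le_iff)
  moreover have "mat_norm n (\<lambda>i j. \<phi> x x (a i j)) \<le> mat_norm n (\<lambda>i j. canonical_extension \<phi> (b i j))"
  proof (subst mat_norm_le_iff [OF form_bound_mat_norm(1)])
    let ?M = "mat_norm n (\<lambda>i j. canonical_extension \<phi> (b i j))"
    have "form_bound {..<n} (\<lambda>i j. emb x o\<^sub>L \<phi> x x (a i j) o\<^sub>L coord x) ?M"
    proof (rule form_bound_cong [THEN iffD1, OF _ form_bound_mat_norm(2)])
      show "canonical_extension \<phi> (b i j) = emb x o\<^sub>L \<phi> x x (a i j) o\<^sub>L coord x" if "i \<in> {..<n}" "j \<in> {..<n}" for i j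
        unfolding b_def using a(1) that
        by (intro canonical_extension_matrix_unit [OF A(2) \<phi> lin]) (auto simp: mats_def)
    qed
    then have "cmod (matrix_form {..<n} (\<lambda>i j. emb x o\<^sub>L \<phi> x x (a i j) o\<^sub>L coord x)
        (\<lambda>j. blinfun_apply (emb x) (\<xi> j)) (\<lambda>i. blinfun_apply (emb x) (\<eta> i)))
      \<le> ?M * L2_set (\<lambda>j. norm (blinfun_apply (emb x) (\<xi> j))) {..<n} * L2_set (\<lambda>i. norm (blinfun_apply (emb x) (\<eta> i))) {..<n}"
      for \<xi> \<eta> unfolding form_bound_def by blast
    then show "form_bound {..<n} (\<lambda>i j. \<phi> x x (a i j)) ?M"
      unfolding form_bound_def by (simp add: form norm_emb coord_emb)
  qed
  ultimately show "ennreal (mat_norm n (\<lambda>i j. \<phi> x x (a i j)))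
      \<le> cb_norm (min_tensor compact_ops A) (canonical_extension \<phi>)"
    using ennreal_leI order_trans by blast
qed

(* The Hilbert space in (iii) is found inside a fixed Hilbert space type; conversely a dilation on
   a Hilbert space of any type 'k gives (i). *)
theorem theorem2p6:
  fixes A :: "('h::chilbert_space \<Rightarrow>\<^sub>L 'h) set"
    and \<phi> :: "'x \<Rightarrow> 'x \<Rightarrow> ('h \<Rightarrow>\<^sub>L 'h) \<Rightarrow> ('h \<Rightarrow>\<^sub>L 'h)"
  assumes "cstar_subalgebra A" and "nondegenerate A"
    and "\<forall>x y. completely_bounded A (\<phi> x y)"
    and "(SUP x. SUP y. cb_norm A (\<phi> x y)) < \<infinity>"
  shows
    "(positive_type A \<phi> \<longleftrightarrow>
      schur_multiplier A \<phi> \<and>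
      schur_map A \<phi> ` min_tensor compact_ops A \<subseteq> min_tensor compact_ops bops \<and>
      completely_positive (min_tensor compact_ops A) (schur_map A \<phi>) \<and>
      cb_norm (min_tensor compact_ops A) (schur_map A \<phi>) = (SUP x. cb_norm A (\<phi> x x))) \<and>
    (positive_type A \<phi> \<longleftrightarrow>
      (\<exists>(K :: ('x, 'h) dilation_space set) \<rho> V. dilation A \<phi> K \<rho> V)) \<and>
    ((\<exists>(K :: 'k::chilbert_space set) \<rho> V. dilation A \<phi> K \<rho> V) \<longrightarrow> positive_type A \<phi>) \<and>
    (positive_type A \<phi> \<longrightarrow>
      (\<forall>T\<in>min_tensor bops A.
        canonical_extension \<phi> T \<in> weak_star_tensor bops bops \<and>
        (\<forall>x y. matrix_entry (canonical_extension \<phi> T) x y = \<phi> x y (matrix_entry T x y))) \<and>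
      completely_positive (min_tensor bops A) (canonical_extension \<phi>))"
proof -
  note A = cstar_subalgebraD(1-3) [OF assms(1)]
  have \<phi>: "\<phi> x y a \<in> bops" if "a \<in> A" for x y a
    using assms(3) that by (auto simp: completely_bounded_def)
  have lin: "clinear_on A (\<phi> x y)" for x y using assms(3) by (simp add: completely_bounded_def)
  define B where "B = enn2real (SUP x. SUP y. cb_norm A (\<phi> x y))"
  have B0: "0 \<le> B" by (simp add: B_def)
  have cbB: "cb_norm A (\<phi> x y) \<le> ennreal B" for x y
  proof -
    have "cb_norm A (\<phi> x y) \<le> (SUP y. cb_norm A (\<phi> x y))" by (rule SUP_upper) simp
    also have "\<dots> \<le> (SUP x. SUP y. cb_norm A (\<phi> x y))" by (rule SUP_upper) simp
    finally show ?thesis using assms(4) by (simp add: B_def)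
  qed
  have B: "norm (\<phi> x y a) \<le> B * norm a" if "a \<in> A" for x y a
    by (rule norm_le_cb_norm [OF lin A(2) cbB B0 that])
  define C where "C = enn2real (SUP x. cb_norm A (\<phi> x x))"
  have C0: "0 \<le> C" by (simp add: C_def)
  have CSUP: "(SUP x. cb_norm A (\<phi> x x)) = ennreal C"
  proof -
    have "(SUP x. cb_norm A (\<phi> x x)) \<le> ennreal B" by (intro SUP_least cbB)
    then have "(SUP x. cb_norm A (\<phi> x x)) < top" by (rule le_less_trans) simp
    then show ?thesis by (simp add: C_def)
  qed
  have dil: "\<exists>(K :: ('x, 'h) dilation_space set) \<rho> V. dilation A \<phi> K \<rho> V \<and> (\<forall>x. (norm (V x))\<^sup>2 \<le> C)"
    if pos: "positive_type A \<phi>"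
  proof -
    have "norm (\<phi> x x a) \<le> C" if "a \<in> A" "norm a \<le> 1" for x a
    proof -
      have "cb_norm A (\<phi> x x) \<le> ennreal C" unfolding CSUP [symmetric] by (rule SUP_upper) simp
      then have "norm (\<phi> x x a) \<le> C * norm a" by (rule norm_le_cb_norm [OF lin A(2) _ C0 that(1)])
      also have "\<dots> \<le> C" using mult_left_mono [OF that(2) C0] by simp
      finally show ?thesis .
    qed
    then show ?thesis using positive_type_imp_dilation [OF assms(1) lin \<phi> B B0 pos] by blast
  qed
  have sb: "schur_bound A \<phi> C" if "positive_type A \<phi>"
    using dil [OF that] dilation_imp_schur_bound [OF assms(1)] C0 by blast
  have ii: "schur_multiplier A \<phi> \<and>
      schur_map A \<phi> ` min_tensor compact_ops A \<subseteq> min_tensor compact_ops bops \<and>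
      completely_positive (min_tensor compact_ops A) (schur_map A \<phi>) \<and>
      cb_norm (min_tensor compact_ops A) (schur_map A \<phi>) = (SUP x. cb_norm A (\<phi> x x))"
    if pos: "positive_type A \<phi>"
  proof (intro conjI)
    let ?S = "min_tensor compact_ops A :: (('x, 'h) l2 \<Rightarrow>\<^sub>L ('x, 'h) l2) set"
    note C = sb [OF pos] C0
    have D: "?S \<subseteq> entry_ops A" by (rule min_tensor_subset_entry_ops [OF A(2,3)])
    have eq: "schur_map A \<phi> T = canonical_extension \<phi> T" if "T \<in> ?S" for T
      by (rule schur_map_eq_canonical_extension [OF A \<phi> lin C that])
    show "schur_multiplier A \<phi>" by (rule schur_bound_imp_schur_multiplier [OF A(1,2) \<phi> lin C])
    show "schur_map A \<phi> ` ?S \<subseteq> min_tensor compact_ops bops"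
      using eq canonical_extension_min_tensor [OF A \<phi> lin C B] by auto
    have "completely_positive ?S (canonical_extension \<phi>)"
      by (rule canonical_extension_completely_positive [OF \<phi> C lin pos D])
    then show "completely_positive ?S (schur_map A \<phi>)"
      unfolding completely_positive_def
    proof (elim conjE, intro conjI allI ballI impI)
      assume "clinear_on ?S (canonical_extension \<phi>)"
      then show "clinear_on ?S (schur_map A \<phi>)"
        using clinear_on_cong [OF csubspace_min_tensor, where F = "schur_map A \<phi>" and G = "canonical_extension \<phi>", OF eq]
        by blast
      assume "canonical_extension \<phi> ` ?S \<subseteq> bops"
      then show "schur_map A \<phi> ` ?S \<subseteq> bops" by (auto simp: eq)
      fix n a assume a: "a \<in> mats n ?S" "mat_pos n a"
        and "\<forall>n. \<forall>a\<in>mats n ?S. mat_pos n a \<longrightarrow> mat_pos n (\<lambda>i j. canonical_extension \<phi> (a i j))"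
      then have "psd {..<n} (\<lambda>i j. canonical_extension \<phi> (a i j))" by (simp add: mat_pos_iff_psd)
      then show "mat_pos n (\<lambda>i j. schur_map A \<phi> (a i j))"
        unfolding mat_pos_iff_psd
        by (rule psd_cong [THEN iffD1, rotated]) (use a(1) eq in \<open>auto simp: mats_def\<close>)
    qed
    have cb_eq: "cb_norm ?S (schur_map A \<phi>) = cb_norm ?S (canonical_extension \<phi>)"
      by (rule cb_norm_cong) (rule eq)
    show "cb_norm ?S (schur_map A \<phi>) = (SUP x. cb_norm A (\<phi> x x))"
    proof (rule antisym)
      show "cb_norm ?S (schur_map A \<phi>) \<le> (SUP x. cb_norm A (\<phi> x x))"
        unfolding CSUP cb_eq by (rule canonical_extension_cb_norm_le [OF \<phi> C D])
      show "(SUP x. cb_norm A (\<phi> x x)) \<le> cb_norm ?S (schur_map A \<phi>)"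
        unfolding cb_eq by (intro SUP_least cb_norm_diagonal_le [OF A(1,2) \<phi> lin])
    qed
  qed
  have ii_imp_i: "positive_type A \<phi>"
    if sm: "schur_multiplier A \<phi>" and cp: "completely_positive (min_tensor compact_ops A) (schur_map A \<phi>)"
  proof -
    have ent: "matrix_entry (schur_map_hs A \<phi> T) = (\<lambda>x y. \<phi> x y (matrix_entry T x y))" if T: "T \<in> hs_ops A" for T
    proof -
      have k: "matrix_entry T \<in> l2_kernels A" using T hs_ops_iff [OF A(1)] by blast
      show ?thesis
        unfolding schur_map_hs_eq [OF A(1) T]
        by (rule kernel_op_l2_kernels(2) [OF schur_kernel_l2_kernels [OF \<phi> B k] subset_refl])
    qed
    obtain C' where C': "schur_bound A \<phi> C'" "0 \<le> C'"
      using schur_multiplier_imp_schur_bound [OF A(1,2) lin sm ent] by blast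
    have eq: "schur_map A \<phi> T = canonical_extension \<phi> T" if "T \<in> min_tensor compact_ops A" for T
      by (rule schur_map_eq_canonical_extension [OF A \<phi> lin C' that])
    show ?thesis
      by (rule completely_positive_imp_positive_type [OF A(1,2) \<phi> lin cp eq])
  qed
  have last: "(\<forall>T\<in>min_tensor bops A.
        canonical_extension \<phi> T \<in> weak_star_tensor bops bops \<and>
        (\<forall>x y. matrix_entry (canonical_extension \<phi> T) x y = \<phi> x y (matrix_entry T x y))) \<and>
      completely_positive (min_tensor bops A) (canonical_extension \<phi>)" if pos: "positive_type A \<phi>"
  proof -
    note C = sb [OF pos] C0
    have D: "min_tensor bops A \<subseteq> entry_ops A" by (rule min_tensor_subset_entry_ops [OF A(2,3)])
    then show ?thesis
      using canonical_extension_entries [OF \<phi> C] bops_in_weak_star_tensor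
        canonical_extension_completely_positive [OF \<phi> C lin pos D] by blast
  qed
  show ?thesis
  proof (intro conjI iffI impI)
    show "\<exists>(K :: ('x, 'h) dilation_space set) \<rho> V. dilation A \<phi> K \<rho> V" if "positive_type A \<phi>"
      using dil [OF that] by blast
    show "positive_type A \<phi>" if "\<exists>(K :: ('x, 'h) dilation_space set) \<rho> V. dilation A \<phi> K \<rho> V"
      using that dilation_imp_positive_type [OF assms(1)] by blast
    show "positive_type A \<phi>" if "\<exists>(K :: 'k set) \<rho> V. dilation A \<phi> K \<rho> V"
      using that dilation_imp_positive_type [OF assms(1)] by blast
  qed (use ii ii_imp_i last in blast)+
qed

end
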